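(* Let $K\subset\mathbb{C}$ be a regular compact set, let $\tau$ be a finite measure on $K$ satisfying the Bernstein-Markov property on $K$, and let $q_0,q_1,q_2,\dots$ be the orthonormal polynomials obtained by applying Gram-Schmidt to $1,z,z^2,\dots$ in $L^2(\tau)$. Let $\xi_0,\xi_1,\dots$ be a sequence of non-degenerate i.i.d. complex random variables satisfying $\mathbb{P}(|\xi_0|>e^{t})=o(t^{-1})$ as $t\to+\infty$. For $n\ge 1$ let $$H_n(z)=\sum_{j=0}^n\xi_j q_j(z).$$ Then the normalized zero counting measure $Z_{H_n}$ converges in probability to the equilibrium measure $\mu_K$ in the weak* topology; that is, for every weak* open set $U$ containing $\mu_K$, $\mathbb{P}(Z_{H_n}\in U)\to 1$ as $n\to\infty$.
   Context: For $K\subset\mathbb{C}$ compact, the Green function is $V_K(z)=\sup\{\frac{1}{\deg p}\log|p(z)| : p \text{ a non-constant polynomial with } \sup_K|p|\le 1\}$. $K$ is called regular if $V_K$ is (finite and) continuous on $\mathbb{C}$; in particular $K$ is then non-polar. The equilibrium measure $\mu_K$ is the unique probability measure minimizing $\iint\log\frac{1}{|z-t|}\,d\mu(z)\,d\mu(t)$ over probability measures $\mu$ on $K$; equivalently, for $K$ regular, $\mu_K=\frac{1}{2\pi}\Delta V_K$ in the sense of distributions. The measure $\tau$ satisfies the Bernstein-Markov property on $K$ if for every $\epsilon>0$ there is $M>0$ such that for all $n$ and all polynomials $p$ of degree at most $n$, $\sup_K|p|\le Me^{\epsilon n}\|p\|_{L^2(\tau)}$. A random variable is non-degenerate if its law is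 supported on at least two points. $Z_{H_n}=\frac{1}{2\pi}\Delta\left(\frac1n\log|H_n|\right)=\frac1n\sum_j\delta_{z_j}$, the sum being over the zeros of $H_n$ counted with multiplicity (set to be the zero measure on the event $H_n\equiv0$). It is a positive measure of total mass at most $1$; the weak* topology is that of testing against bounded continuous functions on $\mathbb{C}$. *)

theory Defs
  imports "HOL-Probability.Probability" "HOL-Computational_Algebra.Polynomial"
    "HOL-Library.Landau_Symbols"
begin

text \<open>Logarithm on \<open>[0, \<infinity>)\<close> with value \<open>-\<infinity>\<close> at 0 (the library's \<^const>\<open>ln\<close> is 0 there).\<close>

definition elog :: "real \<Rightarrow> ereal" where
  "elog x = (if x = 0 then -\<infinity> else ereal (ln x))"

definition green_function :: "complex set \<Rightarrow> complex \<Rightarrow> ereal" where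
  "green_function K z =
     (SUP p \<in> {p :: complex poly. degree p > 0 \<and> (\<forall>w\<in>K. cmod (poly p w) \<le> 1)}.
        elog (cmod (poly p z)) / ereal (real (degree p)))"

definition regular_set :: "complex set \<Rightarrow> bool" where
  "regular_set K \<longleftrightarrow>
     (\<forall>z. \<bar>green_function K z\<bar> \<noteq> \<infinity>) \<and> continuous_on UNIV (green_function K)"

definition borel_measure_on :: "complex set \<Rightarrow> complex measure \<Rightarrow> bool" where
  "borel_measure_on K \<mu> \<longleftrightarrow> sets \<mu> = sets borel \<and> emeasure \<mu> (- K) = 0"

text \<open>The integral of \<open>log (1 / |z - t|)\<close>, as integral of the positive part minus integral of
  the negative part. For a finite measure on a compact set the latter is finite, so the value lies
  in \<open>(-\<infinity>, \<infinity>]\<close>.\<close>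

definition log_energy :: "complex measure \<Rightarrow> ereal" where
  "log_energy \<mu> =
     enn2ereal (\<integral>\<^sup>+z. (\<integral>\<^sup>+t. e2ennreal (- elog (cmod (z - t))) \<partial>\<mu>) \<partial>\<mu>)
   - enn2ereal (\<integral>\<^sup>+z. (\<integral>\<^sup>+t. e2ennreal (elog (cmod (z - t))) \<partial>\<mu>) \<partial>\<mu>)"

definition energy_minimizer :: "complex set \<Rightarrow> complex measure \<Rightarrow> bool" where
  "energy_minimizer K \<mu> \<longleftrightarrow> prob_space \<mu> \<and> borel_measure_on K \<mu> \<and>
     (\<forall>\<nu>. prob_space \<nu> \<longrightarrow> borel_measure_on K \<nu> \<longrightarrow> log_energy \<mu> \<le> log_energy \<nu>)"

text \<open>Meaningful only for non-polar \<open>K\<close>, where the minimizer exists and is unique.\<close>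

definition equilibrium_measure :: "complex set \<Rightarrow> complex measure" where
  "equilibrium_measure K = (THE \<mu>. energy_minimizer K \<mu>)"

definition L2_inner_poly :: "complex measure \<Rightarrow> complex poly \<Rightarrow> complex poly \<Rightarrow> complex" where
  "L2_inner_poly \<tau> p q = (\<integral>z. poly p z * cnj (poly q z) \<partial>\<tau>)"

definition L2_norm_poly :: "complex measure \<Rightarrow> complex poly \<Rightarrow> real" where
  "L2_norm_poly \<tau> p = sqrt (\<integral>z. (cmod (poly p z))\<^sup>2 \<partial>\<tau>)"

definition bernstein_markov :: "complex set \<Rightarrow> complex measure \<Rightarrow> bool" where
  "bernstein_markov K \<tau> \<longleftrightarrow>
     (\<forall>\<epsilon>>0. \<exists>M>0. \<forall>n::nat. \<forall>p :: complex poly. degree p \<le> n \<longrightarrow>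
        (\<forall>z\<in>K. cmod (poly p z) \<le> M * exp (\<epsilon> * real n) * L2_norm_poly \<tau> p))"

text \<open>Gram-Schmidt applied to \<open>1, z, z\<^sup>2, \<dots>\<close>. It never divides by 0 when the support of \<open>\<tau>\<close> is
  infinite, as it is for a measure with the Bernstein-Markov property on an infinite set.\<close>

fun gram_schmidt_poly :: "complex measure \<Rightarrow> nat \<Rightarrow> complex poly" where
  "gram_schmidt_poly \<tau> j =
     (let r = monom 1 j -
            (\<Sum>k<j. smult (L2_inner_poly \<tau> (monom 1 j) (gram_schmidt_poly \<tau> k))
                      (gram_schmidt_poly \<tau> k))
      in smult (complex_of_real (1 / L2_norm_poly \<tau> r)) r)"

declare gram_schmidt_poly.simps [simp del]

definition measure_support :: "complex measure \<Rightarrow> complex set" where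
  "measure_support \<mu> = {x. \<forall>U. open U \<longrightarrow> x \<in> U \<longrightarrow> emeasure \<mu> U > 0}"

definition nondegenerate :: "'w measure \<Rightarrow> ('w \<Rightarrow> complex) \<Rightarrow> bool" where
  "nondegenerate M X \<longleftrightarrow>
     (\<exists>x\<in>measure_support (distr M borel X). \<exists>y\<in>measure_support (distr M borel X). x \<noteq> y)"

definition random_poly :: "complex measure \<Rightarrow> (nat \<Rightarrow> 'w \<Rightarrow> complex) \<Rightarrow> nat \<Rightarrow> 'w \<Rightarrow> complex poly" where
  "random_poly \<tau> \<xi> n \<omega> = (\<Sum>j\<le>n. smult (\<xi> j \<omega>) (gram_schmidt_poly \<tau> j))"

text \<open>The measure \<open>(1/n) \<Sum> \<delta>\<^sub>z\<close> over the zeros of \<open>p\<close> with multiplicity. The normalization is by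
  \<open>n\<close>, not by the degree of \<open>p\<close>.\<close>

definition zero_measure :: "nat \<Rightarrow> complex poly \<Rightarrow> complex measure" where
  "zero_measure n p =
     (if p = 0 then null_measure borel
      else distr (point_measure {z. poly p z = 0} (\<lambda>z. ennreal (real (order z p) / real n)))
             borel (\<lambda>z. z))"

text \<open>The coarsest topology on the finite positive Borel measures for which integration against
  each bounded continuous function is continuous. (Real test functions give the same topology as
  complex ones.)\<close>

definition weak_star_topology :: "complex measure topology" where
  "weak_star_topology = topology_generated_by
     {{\<mu>. finite_measure \<mu> \<and> sets \<mu> = sets borel \<and> (\<integral>z. f z \<partial>\<mu>) \<in> V} | f V.
        continuous_on UNIV f \<and> bounded (range f) \<and> open (V :: real set)}"

end

theory Submission
  imports Defs "HOL-Complex_Analysis.Complex_Analysis"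
    "HOL-Computational_Algebra.Fundamental_Theorem_Algebra"
begin

text \<open>
  Let \<open>V\<close> be the Green function of \<open>K\<close>. With probability tending to 1 the polynomial \<open>H\<^sub>n\<close> satisfies
  \<open>(1/n) log |H\<^sub>n| \<le> V + \<delta>\<close> everywhere (union bound on the coefficients, Bernstein-Markov and
  Bernstein-Walsh) and \<open>(1/n) log |H\<^sub>n(z)| \<ge> V(z) - \<delta>\<close> at finitely many prescribed points \<open>z\<close> that are
  zeros of no \<open>q\<^sub>j\<close>: there, more and more of the \<open>|q\<^sub>j(z)|\<close> with \<open>j \<le> n\<close> exceed \<open>exp (n (V(z) - \<delta>/2))\<close>,
  so anti-concentration of weighted sums makes a smaller value of \<open>|H\<^sub>n(z)|\<close> unlikely.

  What remains is deterministic. If these bounds hold along a sequence of polynomials with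
  \<open>\<delta> \<rightarrow> 0\<close> and a dense set of points, every vague limit of the zero measures has logarithmic potential
  \<open>V\<close> up to a constant: the upper bound passes to the limit through circle means (Jensen's formula),
  the lower bound through truncated kernels. Near-Fekete points in \<open>K \<inter> \<partial>{V = 0}\<close> give such a sequence
  as well, whence a probability measure on \<open>K\<close> with potential \<open>V\<close> up to a constant.

  Both the uniqueness of a measure with this potential and its identification as the minimizer of the
  energy follow from strict positive definiteness of the logarithmic kernel, which on the Riemann
  sphere is visible from the expansion of \<open>- log (1 - c)\<close> in powers of
  \<open>c = |1 + z w*|\<^sup>2 / ((1 + |z|\<^sup>2) (1 + |w|\<^sup>2))\<close>, where \<open>1 - c\<close> is the squared chordal distance.
\<close>

section \<open>Circle means of the logarithm\<close>

text \<open>Two losses have to be excluded. Mass may escape to infinity: zeros are tested first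
  against functions vanishing there, so a vague limit has mass at most 1. That its mass is 1 is read
  off from the growth of \<open>V\<close>, at least ln |z| minus a constant, and only then does
  vague convergence improve to convergence against bounded functions. Moreover, the additive
  constants attached to the polynomials, built from leading coefficients and far zeros, are not
  bounded a priori; upper and lower bounds are therefore combined at the same polynomial, where the
  constant cancels. The tail condition is what a union bound over n + 1 coefficients at height exp
  (n d) asks for. The lower bound uses no moments: the number of large weights has to tend to
  infinity, nothing more. The conclusion measures an event, so the passage from coefficients to zero
  measures has to be measurable. It is continuous only while the leading coefficient stays away from
  0, hence a stratification by degree.\<close>

abbreviation unit_interval :: "real measure" where
  "unit_interval \<equiv> uniform_measure lborel {0..1}"

definition circle_point :: "complex \<Rightarrow> real \<Rightarrow> real \<Rightarrow> complex" where
  "circle_point a r t = a + of_real r * cis (2 * pi * t)"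

lemma continuous_circle_point [continuous_intros]:
  "continuous_on A (circle_point a r)"
  unfolding circle_point_def cis_conv_exp by (intro continuous_intros)

lemma measurable_circle_point [measurable]: "circle_point a r \<in> borel_measurable borel"
  by (intro borel_measurable_continuous_onI continuous_circle_point)

lemma dist_circle_point: "r \<ge> 0 \<Longrightarrow> dist (circle_point a r t) a = r"
  by (simp add: circle_point_def dist_norm norm_mult)

interpretation unit_interval: prob_space unit_interval
  by (rule prob_space_uniform_measure) auto

lemma integral_unit_interval:
  fixes f :: "real \<Rightarrow> real"
  assumes "continuous_on {0..1} f" and [measurable]: "f \<in> borel_measurable borel"
  shows "(\<integral>t. f t \<partial>unit_interval) = integral {0..1} f" and "integrable unit_interval f"
proof -
  have "set_integrable lborel {0..1} f"
    by (rule borel_integrable_atLeastAtMost') fact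
  then have *: "integrable lborel (\<lambda>x. indicator {0..1} x * f x)"
      "(\<integral>x. indicator {0..1} x * f x \<partial>lborel) = integral {0..1} f"
    using set_borel_integral_eq_integral(2)[of "{0..1}" f]
    by (auto simp: set_integrable_def set_lebesgue_integral_def)
  have "unit_interval = density lborel (\<lambda>x. ennreal (indicator {0..1} x))"
    unfolding uniform_measure_def
    by (intro density_cong AE_I2) (auto simp: indicator_def divide_ennreal_def)
  then show "(\<integral>t. f t \<partial>unit_interval) = integral {0..1} f" "integrable unit_interval f"
    using * by (simp_all add: integral_real_density integrable_real_density)
qed

text \<open>The values \<open>1 - \<zeta> * z\<close> stay in the right half-plane for
  \<open>cmod z \<le> 1\<close>, so \<open>Ln\<close> of them is continuous on the closed disc and
  holomorphic inside. Cauchy's formula at the centre gives the mean value \<open>Ln 1 = 0\<close>,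
  and the real part of \<open>Ln\<close> is the logarithm of the modulus.\<close>

lemma circle_mean_log_interior:
  fixes \<zeta> :: complex
  assumes "cmod \<zeta> < 1"
  shows "integrable unit_interval (\<lambda>t. ln (cmod (1 - \<zeta> * cis (2 * pi * t))))"
    and "(\<integral>t. ln (cmod (1 - \<zeta> * cis (2 * pi * t))) \<partial>unit_interval) = 0"
proof -
  have Re: "Re (1 - \<zeta> * z) > 0" if "cmod z \<le> 1" for z
  proof -
    have "cmod (\<zeta> * z) < 1"
      using assms that by (metis mult_le_one norm_ge_zero norm_mult mult_less_le_imp_less
        linorder_not_less mult.right_neutral mult_left_le order.strict_trans1)
    then show ?thesis using complex_Re_le_cmod[of "\<zeta> * z"] by simp
  qed
  let ?f = "\<lambda>z. Ln (1 - \<zeta> * z)"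
  have nR: "1 - \<zeta> * z \<notin> \<real>\<^sub>\<le>\<^sub>0" if "cmod z \<le> 1" for z
    using Re[OF that] by (auto simp: complex_nonpos_Reals_iff)
  have "((\<lambda>u. ?f u / (u - 0)) has_contour_integral (2 * of_real pi * \<i> * ?f 0)) (circlepath 0 1)"
    by (rule Cauchy_integral_circlepath)
      (auto intro!: continuous_intros holomorphic_intros nR simp: dist_norm)
  then have "((\<lambda>t. ?f (circlepath 0 1 t) / (circlepath 0 1 t) *
       (2 * pi * \<i> * 1 * exp (2 * of_real pi * \<i> * t))) has_integral 0) {0..1}"
    unfolding has_contour_integral_def
    by (subst (asm) has_integral_cong[where g="\<lambda>t. ?f (circlepath 0 1 t) / (circlepath 0 1 t) *
       (2 * pi * \<i> * 1 * exp (2 * of_real pi * \<i> * t))"])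
       (simp_all add: vector_derivative_circlepath01)
  then have "((\<lambda>t. 2 * pi * \<i> * ?f (cis (2 * pi * t))) has_integral 0) {0..1}"
    by (rule has_integral_eq[rotated]) (auto simp: circlepath cis_conv_exp mult_ac)
  then have "((\<lambda>t. (1 / (2 * pi * \<i>)) * (2 * pi * \<i> * ?f (cis (2 * pi * t)))) has_integral
      (1 / (2 * pi * \<i>)) * 0) {0..1}"
    by (rule has_integral_mult_right)
  then have "((\<lambda>t. ?f (cis (2 * pi * t))) has_integral 0) {0..1}"
    by simp
  then have "((\<lambda>t. Re (?f (cis (2 * pi * t)))) has_integral Re 0) {0..1}"
    by (rule has_integral_Re)
  moreover have ne: "1 - \<zeta> * cis t \<noteq> 0" for t
    using nR[of "cis t"] by force
  ultimately have hi: "((\<lambda>t. ln (cmod (1 - \<zeta> * cis (2 * pi * t)))) has_integral 0) {0..1}"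
    by (simp add: Re_Ln)
  have c: "continuous_on A (\<lambda>t. ln (cmod (1 - \<zeta> * cis (2 * pi * t))))" for A
    using ne by (intro continuous_intros continuous_on_ln) (auto intro!: continuous_intros)
  show "integrable unit_interval (\<lambda>t. ln (cmod (1 - \<zeta> * cis (2 * pi * t))))"
    using integral_unit_interval(2)[OF c] borel_measurable_continuous_onI[OF c] by simp
  show "(\<integral>t. ln (cmod (1 - \<zeta> * cis (2 * pi * t))) \<partial>unit_interval) = 0"
    using integral_unit_interval(1)[OF c] borel_measurable_continuous_onI[OF c] hi
    by (simp add: integral_unique)
qed


lemma AE_circle_ne: "AE t in unit_interval. 1 - \<zeta> * cis (2 * pi * t) \<noteq> 0"
proof -
  have "{t. 1 - \<zeta> * cis (2 * pi * t) = 0} \<subseteq> {t. cis (2 * pi * t) = inverse \<zeta>}"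
    using inverse_unique[of \<zeta>] by force
  also have "countable {t. cis (2 * pi * t) = inverse \<zeta>}"
  proof (cases "\<exists>t0. cis (2 * pi * t0) = inverse \<zeta>")
    case True
    then obtain t0 where t0: "cis (2 * pi * t0) = inverse \<zeta>" by blast
    have "t \<in> range (\<lambda>n::int. t0 + n)" if "cis (2 * pi * t) = inverse \<zeta>" for t
    proof -
      have "cis (2 * pi * t) = cis (2 * pi * t0)" using that t0 by simp
      then have "cos (2 * pi * t) = cos (2 * pi * t0) \<and> sin (2 * pi * t) = sin (2 * pi * t0)"
        by (simp add: complex_eq_iff)
      then obtain n where "2 * pi * t = 2 * pi * t0 + 2 * pi * real_of_int n"
        using sin_cos_eq_iff[of "2 * pi * t" "2 * pi * t0"] by auto
      then have "2 * pi * t = 2 * pi * (t0 + real_of_int n)" by (simp add: algebra_simps)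
      then have "t = t0 + real_of_int n" by simp
      then show ?thesis by blast
    qed
    then have "{t. cis (2 * pi * t) = inverse \<zeta>} \<subseteq> range (\<lambda>n::int. t0 + n)" by blast
    then show ?thesis by (rule countable_subset) simp
  qed simp
  finally (countable_subset) have "countable {t. 1 - \<zeta> * cis (2 * pi * t) = 0}" .
  then have "AE t in lborel. t \<notin> {t. 1 - \<zeta> * cis (2 * pi * t) = 0}"
    by (intro AE_not_in countable_imp_null_set_lborel)
  then show ?thesis
    by (intro AE_uniform_measureI) auto
qed

text \<open>For \<open>cmod \<zeta> = 1\<close> the logarithm has a singularity on the circle; this
  case is reached from the interior one by letting the factors \<open>\<rho> k\<close> increase to
  1.\<close>

lemma circle_mean_log_unit:
  fixes \<zeta> :: complex
  assumes "cmod \<zeta> \<le> 1"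
  shows "integrable unit_interval (\<lambda>t. ln (cmod (1 - \<zeta> * cis (2 * pi * t))))"
    and "(\<integral>t. ln (cmod (1 - \<zeta> * cis (2 * pi * t))) \<partial>unit_interval) = 0"
proof -
  define g where "g t = ln (cmod (1 - \<zeta> * cis (2 * pi * t)))" for t
  define \<rho> where "\<rho> k = 1 - 1 / (real k + 2)" for k
  define f where "f k t = ln (cmod (1 - (of_real (\<rho> k) * \<zeta>) * cis (2 * pi * t)))" for k t
  have \<rho>: "0 < \<rho> k" "\<rho> k < 1" for k
    by (simp_all add: \<rho>_def field_simps)
  have \<rho>1: "\<rho> \<longlonglongrightarrow> 1"
    unfolding \<rho>_def by real_asymp
  have \<rho>\<zeta>: "cmod (of_real (\<rho> k) * \<zeta>) < 1" for k
    using \<rho>[of k] assms by (simp add: norm_mult)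
      (metis less_eq_real_def mult.commute mult_left_le_one_le norm_ge_zero order.strict_trans1)
  have [measurable]: "g \<in> borel_measurable borel" "f k \<in> borel_measurable borel" for k
    unfolding g_def f_def cis_conv_exp by measurable
  have int0: "(\<integral>t. f k t \<partial>unit_interval) = 0" "integrable unit_interval (f k)" for k
    using circle_mean_log_interior[OF \<rho>\<zeta>[of k]] by (simp_all add: f_def[abs_def])
  have le2: "ln (cmod (1 - z)) \<le> ln 2" if "cmod z \<le> 1" for z
    using norm_triangle_ineq4[of 1 z] that by (cases "z = 1") auto
  have f2: "f k t \<le> ln 2" for k t
    unfolding f_def using \<rho>\<zeta>[of k] by (intro le2) (simp add: norm_mult)
  have g2: "g t \<le> ln 2" for t
    unfolding g_def using assms by (intro le2) (simp add: norm_mult)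
  have lim: "AE t in unit_interval. (\<lambda>k. f k t) \<longlonglongrightarrow> g t"
    using AE_circle_ne[of \<zeta>]
  proof eventually_elim
    case (elim t)
    have "(\<lambda>k. ln (cmod (1 - (of_real (\<rho> k) * \<zeta>) * cis (2 * pi * t)))) \<longlonglongrightarrow>
        ln (cmod (1 - (of_real 1 * \<zeta>) * cis (2 * pi * t)))"
      using elim by (intro tendsto_intros \<rho>1) auto
    then show ?case by (simp add: f_def g_def)
  qed
  \<comment> \<open>Comes from \<open>cmod (1 - v) \<le> 2 * cmod (1 - \<rho> k * v)\<close> for
    \<open>cmod v \<le> 1\<close>. It is the lower half of the domination, uniform in
    \<open>k\<close>.\<close>
  have low: "f k t \<ge> g t - ln 2" if "1 - \<zeta> * cis (2 * pi * t) \<noteq> 0" for k t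
  proof -
    define v where "v = \<zeta> * cis (2 * pi * t)"
    have v: "cmod v \<le> 1" "v \<noteq> 1" using that assms by (auto simp: v_def norm_mult)
    have "cmod (1 - v) = cmod ((1 - \<rho> k * v) - of_real (1 - \<rho> k) * v)"
      by (simp add: algebra_simps)
    also have "\<dots> \<le> cmod (1 - \<rho> k * v) + (1 - \<rho> k) * cmod v"
      using norm_triangle_ineq4[of "1 - \<rho> k * v" "of_real (1 - \<rho> k) * v"] \<rho>[of k]
      by (simp only: norm_mult norm_of_real)
    also have "(1 - \<rho> k) * cmod v \<le> 1 - \<rho> k * cmod v"
      using v \<rho>[of k] by (simp add: algebra_simps)
    also have "1 - \<rho> k * cmod v \<le> cmod (1 - \<rho> k * v)"
      using norm_triangle_ineq2[of 1 "\<rho> k * v"] \<rho>[of k] by (simp add: norm_mult)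
    finally have "cmod (1 - v) \<le> 2 * cmod (1 - \<rho> k * v)" by simp
    moreover have "cmod (1 - v) > 0" using v by simp
    ultimately have "ln (cmod (1 - v)) \<le> ln (2 * cmod (1 - \<rho> k * v))"
      by (intro ln_mono) auto
    also have "\<dots> = ln 2 + ln (cmod (1 - \<rho> k * v))"
      using \<open>cmod (1 - v) \<le> _\<close> \<open>cmod (1 - v) > 0\<close> by (subst ln_mult) auto
    finally show ?thesis by (simp add: f_def g_def v_def mult_ac)
  qed
  \<comment> \<open>These nonnegative functions all have the same integral, so Fatou's lemma makes
    \<open>g\<close> integrable before it serves as a dominating function.\<close>
  have nn_f: "(\<integral>\<^sup>+t. ennreal (ln 2 - f k t) \<partial>unit_interval) = ennreal (ln 2)" for k
    using int0[of k] f2[of k]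
    by (subst nn_integral_eq_integral) (auto simp: unit_interval.prob_space)
  have "(\<integral>\<^sup>+t. ennreal (ln 2 - g t) \<partial>unit_interval) =
      (\<integral>\<^sup>+t. liminf (\<lambda>k. ennreal (ln 2 - f k t)) \<partial>unit_interval)"
  proof (rule nn_integral_cong_AE)
    show "AE t in unit_interval. ennreal (ln 2 - g t) = liminf (\<lambda>k. ennreal (ln 2 - f k t))"
      using lim
    proof eventually_elim
      case (elim t)
      have "(\<lambda>k. ennreal (ln 2 - f k t)) \<longlonglongrightarrow> ennreal (ln 2 - g t)"
        by (intro tendsto_intros elim)
      then show ?case by (metis lim_imp_Liminf sequentially_bot)
    qed
  qed
  also have "\<dots> \<le> liminf (\<lambda>k. \<integral>\<^sup>+t. ennreal (ln 2 - f k t) \<partial>unit_interval)"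
    by (rule nn_integral_liminf) auto
  also have "\<dots> = ennreal (ln 2)"
    unfolding nn_f by (simp add: Liminf_const)
  finally have "(\<integral>\<^sup>+t. ennreal (ln 2 - g t) \<partial>unit_interval) < \<infinity>"
    by (rule order_le_less_trans) simp
  then have "integrable unit_interval (\<lambda>t. ln 2 - g t)"
    using g2 by (intro integrableI_bounded) auto
  then have "integrable unit_interval (\<lambda>t. ln 2 - (ln 2 - g t))"
    by (rule Bochner_Integration.integrable_diff[rotated]) simp
  then have ig: "integrable unit_interval g"
    by (simp only: diff_diff_eq2 add_diff_cancel_left')
  then show "integrable unit_interval (\<lambda>t. ln (cmod (1 - \<zeta> * cis (2 * pi * t))))"
    by (simp add: g_def[abs_def])
  have "(\<lambda>k. \<integral>t. f k t \<partial>unit_interval) \<longlonglongrightarrow> (\<integral>t. g t \<partial>unit_interval)"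
  proof (rule integral_dominated_convergence[where w = "\<lambda>t. \<bar>g t\<bar> + ln 2"])
    show "AE t in unit_interval. norm (f k t) \<le> \<bar>g t\<bar> + ln 2" for k
      using AE_circle_ne[of \<zeta>]
    proof eventually_elim
      case (elim t)
      show ?case using low[OF elim, of k] f2[of k t] by auto
    qed
  qed (use ig lim in auto)
  then have "(\<integral>t. g t \<partial>unit_interval) = 0"
    unfolding int0 using LIMSEQ_unique tendsto_const by blast
  then show "(\<integral>t. ln (cmod (1 - \<zeta> * cis (2 * pi * t))) \<partial>unit_interval) = 0"
    by (simp add: g_def[abs_def])
qed

text \<open>Jensen's formula for one linear factor: scaling reduces points inside and outside the
  circle to the unit case. The third claim matters because \<open>ln 0 = 0\<close>: only off the
  zeros does \<open>ln\<close> of a product split into a sum.\<close>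

theorem circle_mean_log:
  fixes a w :: complex
  assumes r: "r > 0"
  shows "integrable unit_interval (\<lambda>t. ln (cmod (circle_point a r t - w)))" (is ?I)
    and "(\<integral>t. ln (cmod (circle_point a r t - w)) \<partial>unit_interval) = ln (max r (cmod (w - a)))" (is ?E)
    and "AE t in unit_interval. circle_point a r t \<noteq> w" (is ?N)
proof -
  have *: "?I \<and> ?E \<and> ?N" if s: "s > 0" "s = max r (cmod (w - a))" and \<zeta>: "cmod \<zeta> \<le> 1"
    and eq: "\<And>t. cmod (circle_point a r t - w) = s * cmod (1 - \<zeta> * cis (2 * pi * t))" for s \<zeta>
  proof -
    have [measurable]: "(\<lambda>t. ln (cmod (circle_point a r t - w))) \<in> borel_measurable borel"
        "(\<lambda>t. ln (cmod (1 - \<zeta> * cis (2 * pi * t)))) \<in> borel_measurable borel"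
      unfolding cis_conv_exp by measurable
    have AE: "AE t in unit_interval. ln s + ln (cmod (1 - \<zeta> * cis (2 * pi * t))) =
        ln (cmod (circle_point a r t - w))"
      using AE_circle_ne[of \<zeta>]
    proof eventually_elim
      case (elim t)
      then show ?case using s by (simp add: eq ln_mult)
    qed
    note J = circle_mean_log_unit[OF \<zeta>]
    have "integrable unit_interval (\<lambda>t. ln s + ln (cmod (1 - \<zeta> * cis (2 * pi * t))))"
      using J by auto
    then have ?I
      by (rule Bochner_Integration.integrable_cong_AE_imp) (use AE in auto)
    moreover have "(\<integral>t. ln (cmod (circle_point a r t - w)) \<partial>unit_interval) =
        (\<integral>t. ln s + ln (cmod (1 - \<zeta> * cis (2 * pi * t))) \<partial>unit_interval)"
      using AE by (intro integral_cong_AE) (auto elim: eventually_mono)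
    then have ?E using J s by (simp add: unit_interval.prob_space)
    moreover have ?N
      using AE_circle_ne[of \<zeta>]
    proof eventually_elim
      case (elim t)
      then show ?case using eq[of t] s by auto
    qed
    ultimately show ?thesis by blast
  qed
  have "?I \<and> ?E \<and> ?N"
  proof (cases "cmod (w - a) \<le> r")
    case True
    \<comment> \<open>Inside the circle the conjugate enters through
      \<open>cmod (cis s - u) = cmod (1 - cnj u * cis s)\<close>, valid because \<open>cis s\<close>
      has modulus 1.\<close>
    define \<zeta> where "\<zeta> = cnj ((w - a) / of_real r)"
    have "cmod \<zeta> \<le> 1"
      unfolding \<zeta>_def complex_mod_cnj using r True by (simp add: norm_divide)
    show ?thesis
    proof (rule *)
      fix t
      have "circle_point a r t - w = r * (cis (2 * pi * t) * (1 - cnj (\<zeta> * cis (2 * pi * t))))"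
      proof -
        have "cis (2 * pi * t) * cnj (cis (2 * pi * t)) = 1"
          by (simp add: cis_cnj cis_mult)
        then have "r * (cis (2 * pi * t) * (1 - cnj (\<zeta> * cis (2 * pi * t)))) =
            r * cis (2 * pi * t) - r * cnj \<zeta>"
          by (simp only: right_diff_distrib complex_cnj_mult mult_1_right) (simp add: mult.left_commute)
        then show ?thesis using r by (simp add: circle_point_def \<zeta>_def)
      qed
      then have "cmod (circle_point a r t - w) = r * cmod (1 - cnj (\<zeta> * cis (2 * pi * t)))"
        using r by (simp add: norm_mult)
      also have "cmod (1 - cnj (\<zeta> * cis (2 * pi * t))) = cmod (cnj (1 - \<zeta> * cis (2 * pi * t)))"
        by simp
      finally show "cmod (circle_point a r t - w) = r * cmod (1 - \<zeta> * cis (2 * pi * t))"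
        by (simp only: complex_mod_cnj)
    qed (use r True \<open>cmod \<zeta> \<le> 1\<close> in auto)
  next
    case False
    define \<zeta> where "\<zeta> = of_real r / (w - a)"
    have "w \<noteq> a" using False r by auto
    show ?thesis
    proof (rule *)
      fix t
      have "circle_point a r t - w = (w - a) * (- (1 - \<zeta> * cis (2 * pi * t)))"
        using \<open>w \<noteq> a\<close> by (simp add: circle_point_def \<zeta>_def field_simps)
      then show "cmod (circle_point a r t - w) = cmod (w - a) * cmod (1 - \<zeta> * cis (2 * pi * t))"
        by (simp only: norm_mult norm_minus_cancel)
    qed (use r False in \<open>auto simp: \<zeta>_def norm_divide divide_le_eq_1\<close>)
  qed
  then show ?I ?E ?N by blast+
qed

section \<open>A square-filling curve\<close>

text \<open>The periodic function of Schoenberg's space-filling curve: 0 up to distance 1/3 from the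
  even integers, 1 from distance 2/3 on. Written as a clamped distance it is visibly
  continuous.\<close>

definition zigzag :: "real \<Rightarrow> real" where
  "zigzag t = max 0 (min 1 (3 * infdist t (range (\<lambda>n::int. 2 * real_of_int n)) - 1))"

lemma continuous_zigzag [continuous_intros]:
  "continuous_on A f \<Longrightarrow> continuous_on A (\<lambda>x. zigzag (f x))"
  unfolding zigzag_def by (intro continuous_intros)

lemma zigzag_bounds: "0 \<le> zigzag t" "zigzag t \<le> 1"
  by (auto simp: zigzag_def)

lemma zigzag_low:
  assumes "0 \<le> s" "s \<le> 1/3"
  shows "zigzag (2 * real_of_int N + s) = 0"
proof -
  have "infdist (2 * real_of_int N + s) (range (\<lambda>n::int. 2 * real_of_int n)) \<le>
      dist (2 * real_of_int N + s) (2 * real_of_int N)"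
    by (rule infdist_le) auto
  then show ?thesis using assms by (simp add: zigzag_def dist_real_def)
qed

lemma zigzag_high:
  assumes "2/3 \<le> s" "s \<le> 1"
  shows "zigzag (2 * real_of_int N + s) = 1"
proof -
  have "2/3 \<le> infdist (2 * real_of_int N + s) (range (\<lambda>n::int. 2 * real_of_int n))"
  proof (subst infdist_notempty, simp, rule cINF_greatest)
    fix y assume "y \<in> range (\<lambda>n::int. 2 * real_of_int n)"
    then obtain n :: int where y: "y = 2 * real_of_int n" by blast
    have "2/3 \<le> \<bar>2 * real_of_int (N - n) + s\<bar>"
    proof (cases "N - n \<ge> 0")
      case True
      then have "0 \<le> real_of_int (N - n)" by (simp only: of_int_0_le_iff)
      then have "2/3 \<le> 2 * real_of_int (N - n) + s" using assms by argo
      then show ?thesis by (rule order_trans[OF _ abs_ge_self])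
    next
      case False
      then have "N - n \<le> -1" by linarith
      then have "real_of_int (N - n) \<le> real_of_int (-1)" by (simp only: of_int_le_iff)
      then show ?thesis using assms by simp
    qed
    then show "2/3 \<le> dist (2 * real_of_int N + s) y"
      by (simp add: y dist_real_def algebra_simps)
  qed simp
  then show ?thesis by (simp add: zigzag_def)
qed

text \<open>The point of the Cantor set with ternary digits \<open>2 * c j\<close>.\<close>

definition cantor_point :: "(nat \<Rightarrow> real) \<Rightarrow> real" where
  "cantor_point c = (\<Sum>j. 2 * c j / 3 ^ Suc j)"

lemma summable_cantor:
  assumes "range c \<subseteq> {0, 1}"
  shows "summable (\<lambda>j. 2 * c j / 3 ^ Suc j :: real)"
proof (rule summable_comparison_test')
  show "summable (\<lambda>j. (2/3) * (1/3::real) ^ j)"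
    by (intro summable_mult summable_geometric) auto
  show "norm (2 * c j / 3 ^ Suc j) \<le> (2/3) * (1/3) ^ j" if "j \<ge> 0" for j
  proof -
    have "c j = 0 \<or> c j = 1" using assms rangeI[of c j] by blast
    then show ?thesis by (auto simp: power_divide)
  qed
qed

lemma cantor_point_bounds:
  assumes "range c \<subseteq> {0, 1}"
  shows "0 \<le> cantor_point c" "cantor_point c \<le> 1"
proof -
  have c: "c j = 0 \<or> c j = 1" for j using assms rangeI[of c j] by blast
  then have c0: "c j \<ge> 0" "c j \<le> 1" for j by (metis order_refl zero_le_one)+
  show "0 \<le> cantor_point c"
    unfolding cantor_point_def by (intro suminf_nonneg summable_cantor assms) (use c0 in auto)
  have "(\<lambda>j. (2/3) * (1/3::real) ^ j) sums ((2/3) * (1 / (1 - 1/3)))"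
    by (intro sums_mult geometric_sums) auto
  then have s: "summable (\<lambda>j. (2/3) * (1/3::real) ^ j)" "(\<Sum>j. (2/3) * (1/3::real) ^ j) = 1"
    by (auto simp: sums_iff)
  have "cantor_point c \<le> (\<Sum>j. (2/3) * (1/3::real) ^ j)"
    unfolding cantor_point_def
    by (intro suminf_le summable_cantor assms s) (use c0 in \<open>auto simp: power_divide divide_right_mono\<close>)
  then show "cantor_point c \<le> 1" using s by simp
qed

lemma cantor_point_rec:
  assumes "range c \<subseteq> {0, 1}"
  shows "3 * cantor_point c = 2 * c 0 + cantor_point (\<lambda>j. c (Suc j))"
proof -
  have c': "range (\<lambda>j. c (Suc j)) \<subseteq> {0, 1}" using assms by auto
  have "cantor_point c = (\<Sum>j. 2 * c (Suc j) / 3 ^ Suc (Suc j)) + 2 * c 0 / 3"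
    unfolding cantor_point_def using suminf_split_head[OF summable_cantor[OF assms]] by simp
  also have "(\<Sum>j. 2 * c (Suc j) / 3 ^ Suc (Suc j)) = (\<Sum>j. 2 * c (Suc j) / 3 ^ Suc j) / 3"
    by (subst suminf_divide[OF summable_cantor[OF c'], symmetric]) (simp add: mult_ac)
  finally show ?thesis by (simp add: cantor_point_def)
qed

text \<open>Multiplying by \<open>3 ^ k\<close> shifts the ternary digits. What is split off is an
  even integer because all digits are 0 or 2, and the remainder lies in [0, 1/3] or [2/3, 1]
  according to the digit \<open>c k\<close>; so \<open>zigzag\<close> reads this digit.\<close>

lemma zigzag_cantor_point:
  assumes "range c \<subseteq> {0, 1}"
  shows "zigzag (3 ^ k * cantor_point c) = c k"
proof -
  have "\<exists>N::int. 3 ^ k * cantor_point c = 2 * real_of_int N + cantor_point (\<lambda>j. c (k + j))"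
  proof (induction k)
    case 0
    then show ?case by (intro exI[of _ 0]) simp
  next
    case (Suc k)
    then obtain N :: int where N: "3 ^ k * cantor_point c = 2 * real_of_int N + cantor_point (\<lambda>j. c (k + j))"
      by blast
    have "range (\<lambda>j. c (k + j)) \<subseteq> {0, 1}" using assms by auto
    from cantor_point_rec[OF this]
    have "3 ^ Suc k * cantor_point c = 6 * real_of_int N + 2 * c k + cantor_point (\<lambda>j. c (Suc k + j))"
      using N by (simp add: algebra_simps)
    moreover have "\<exists>b::int. c k = real_of_int b" using assms rangeI[of c k]
      by (metis insert_iff of_int_0 of_int_1 singletonD subsetD)
    then obtain b :: int where "c k = real_of_int b" by blast
    ultimately show ?case by (intro exI[of _ "3 * N + b"]) simp
  qed
  then obtain N :: int where N: "3 ^ k * cantor_point c = 2 * real_of_int N + cantor_point (\<lambda>j. c (k + j))"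
    by blast
  have r: "range (\<lambda>j. c (k + j)) \<subseteq> {0, 1}" "range (\<lambda>j. c (k + Suc j)) \<subseteq> {0, 1}" using assms by auto
  note rec = cantor_point_rec[OF r(1)]
  have b: "0 \<le> cantor_point (\<lambda>j. c (k + Suc j))" "cantor_point (\<lambda>j. c (k + Suc j)) \<le> 1"
    using cantor_point_bounds[OF r(2)] by auto
  have "c k = 0 \<or> c k = 1" using assms rangeI[of c k] by blast
  then show ?thesis
  proof
    assume "c k = 0"
    then show ?thesis unfolding N using rec b by (subst zigzag_low) auto
  next
    assume "c k = 1"
    then show ?thesis unfolding N using rec b by (subst zigzag_high) auto
  qed
qed

lemma binary_expansion:
  fixes x :: real
  assumes "0 \<le> x" "x \<le> 1"
  obtains b :: "nat \<Rightarrow> real" where "range b \<subseteq> {0, 1}" "(\<lambda>k. b k / 2 ^ Suc k) sums x"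
proof -
  define d :: "real \<Rightarrow> real" where "d y = (if y \<ge> 1/2 then 1 else 0)" for y
  define X where "X k = ((\<lambda>y. 2 * y - d y) ^^ k) x" for k
  have X: "0 \<le> X k \<and> X k \<le> 1" for k
    by (induction k) (use assms in \<open>auto simp: X_def d_def\<close>)
  have S: "x - (\<Sum>k<n. d (X k) / 2 ^ Suc k) = X n / 2 ^ n" for n
    by (induction n) (auto simp: X_def field_simps)
  have "(\<lambda>n. X n / 2 ^ n) \<longlonglongrightarrow> 0"
  proof (rule tendsto_sandwich)
    show "(\<lambda>n. 0::real) \<longlonglongrightarrow> 0" by simp
    show "(\<lambda>n. (1/2::real) ^ n) \<longlonglongrightarrow> 0" by (rule LIMSEQ_realpow_zero) auto
  qed (use X in \<open>auto simp: power_divide divide_right_mono\<close>)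
  then have "(\<lambda>n. x - X n / 2 ^ n) \<longlonglongrightarrow> x - 0" by (intro tendsto_intros)
  then have "(\<lambda>k. d (X k) / 2 ^ Suc k) sums x"
    unfolding sums_def S[symmetric] by (simp only: diff_0_right algebra_simps) simp
  then show thesis
    by (intro that[of "\<lambda>k. d (X k)"]) (auto simp: d_def)
qed

lemma schoenberg_coordinate:
  "continuous_on UNIV (\<lambda>t. \<Sum>k. zigzag (3 ^ m k * t) / 2 ^ Suc k)"
proof -
  have "uniform_limit UNIV (\<lambda>n t. \<Sum>k<n. zigzag (3 ^ m k * t) / 2 ^ Suc k)
      (\<lambda>t. \<Sum>k. zigzag (3 ^ m k * t) / 2 ^ Suc k) sequentially"
  proof (rule Weierstrass_m_test)
    show "summable (\<lambda>k. (1/2::real) ^ Suc k)" by (simp add: summable_Suc_iff summable_geometric)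
    show "norm (zigzag (3 ^ m k * t) / 2 ^ Suc k) \<le> (1/2) ^ Suc k" for k t
      using zigzag_bounds[of "3 ^ m k * t"] by (auto simp: power_divide divide_right_mono)
  qed
  then show ?thesis
    by (rule uniform_limit_theorem[rotated])
       (auto intro!: always_eventually continuous_intros)
qed

text \<open>Schoenberg's curve: its coordinates reassemble binary expansions from the even and the
  odd digits of a Cantor point. It lets measures on the plane be carried by an interval, where
  compactness is Helly's theorem.\<close>

theorem square_filling_curve:
  obtains \<gamma> :: "real \<Rightarrow> complex" where "continuous_on UNIV \<gamma>"
    "\<And>z. \<bar>Re z\<bar> \<le> 1 \<Longrightarrow> \<bar>Im z\<bar> \<le> 1 \<Longrightarrow> \<exists>t\<in>{0..1}. \<gamma> t = z"
proof
  define X where "X e t = (\<Sum>k. zigzag (3 ^ (2 * k + e) * t) / 2 ^ Suc k)" for e t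
  define \<gamma> where "\<gamma> t = Complex (2 * X 0 t - 1) (2 * X 1 t - 1)" for t
  have "continuous_on UNIV (X e)" for e
    unfolding X_def by (rule schoenberg_coordinate)
  then show "continuous_on UNIV \<gamma>"
    unfolding \<gamma>_def Complex_eq by (intro continuous_intros) auto
  fix z :: complex assume z: "\<bar>Re z\<bar> \<le> 1" "\<bar>Im z\<bar> \<le> 1"
  obtain b0 where b0: "range b0 \<subseteq> {0, 1}" "(\<lambda>k. b0 k / 2 ^ Suc k) sums ((Re z + 1) / 2)"
    by (rule binary_expansion[of "(Re z + 1) / 2"]) (use z in auto)
  obtain b1 where b1: "range b1 \<subseteq> {0, 1}" "(\<lambda>k. b1 k / 2 ^ Suc k) sums ((Im z + 1) / 2)"
    by (rule binary_expansion[of "(Im z + 1) / 2"]) (use z in auto)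
  define c where "c j = (if even j then b0 (j div 2) else b1 (j div 2))" for j
  have c: "range c \<subseteq> {0, 1}" using b0(1) b1(1) by (auto simp: c_def)
  have "X 0 (cantor_point c) = (Re z + 1) / 2" "X 1 (cantor_point c) = (Im z + 1) / 2"
    unfolding X_def zigzag_cantor_point[OF c] using b0(2) b1(2) by (auto simp: c_def sums_iff)
  then have "\<gamma> (cantor_point c) = z"
    by (simp add: \<gamma>_def complex_eq_iff)
  then show "\<exists>t\<in>{0..1}. \<gamma> t = z"
    using cantor_point_bounds[OF c] by auto
qed


section \<open>Vague compactness of root measures\<close>

lemma bounded_if_vanishes_at_infinity:
  fixes f :: "complex \<Rightarrow> real"
  assumes "continuous_on UNIV f" "(f \<longlongrightarrow> 0) at_infinity"
  obtains B where "\<And>z. \<bar>f z\<bar> \<le> B"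
proof -
  have "\<forall>\<^sub>F z in at_infinity. dist (f z) 0 < 1"
    using assms(2) by (rule tendstoD) simp
  then obtain R where R: "\<And>z. cmod z \<ge> R \<Longrightarrow> \<bar>f z\<bar> < 1"
    by (auto simp: eventually_at_infinity)
  have "bounded (f ` cball 0 R)"
    by (intro compact_imp_bounded compact_continuous_image continuous_on_subset[OF assms(1)]) auto
  then obtain B where B: "\<And>z. z \<in> cball 0 R \<Longrightarrow> \<bar>f z\<bar> \<le> B"
    unfolding bounded_iff by (metis image_eqI real_norm_def)
  have "\<bar>f z\<bar> \<le> max B 1" for z
    using B[of z] R[of z] by (cases "cmod z \<le> R") auto
  then show thesis by (rule that)
qed

text \<open>Shrinking the plane to the open unit disc turns a function vanishing at infinity into a
  continuous function vanishing off the disc; the unit circle plays the role of infinity.\<close>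

lemma continuous_ball_extension:
  fixes f :: "complex \<Rightarrow> real"
  assumes f: "continuous_on UNIV f" and f0: "(f \<longlongrightarrow> 0) at_infinity"
  shows "continuous_on UNIV (\<lambda>v. if cmod v < 1 then f (v / of_real (1 - cmod v)) else 0)" (is "continuous_on _ ?F")
proof -
  have "isCont ?F v" for v
  proof (cases "cmod v < 1")
    case True
    have "continuous_on (ball 0 1) (\<lambda>v. f (v / of_real (1 - cmod v)))"
      by (rule continuous_on_compose2[OF f]) (auto intro!: continuous_intros simp: of_real_eq_1_iff simp del: of_real_diff)
    then have "continuous_on (ball 0 1) ?F"
      by (rule continuous_on_eq) auto
    then show ?thesis using True by (simp add: continuous_on_eq_continuous_at)
  next
    case False
    show ?thesis
      unfolding isCont_def
    proof (rule tendstoI)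
      fix e :: real assume e: "e > 0"
      have "\<forall>\<^sub>F z in at_infinity. dist (f z) 0 < e"
        using f0 e by (rule tendstoD)
      then obtain R where R: "\<And>z. cmod z \<ge> R \<Longrightarrow> \<bar>f z\<bar> < e"
        by (auto simp: eventually_at_infinity)
      define R' where "R' = max R 1"
      have "R' / (1 + R') < cmod v" using False by (auto simp: R'_def intro: less_le_trans[of _ 1])
      moreover have "((\<lambda>v. cmod v) \<longlongrightarrow> cmod v) (at v)" by (intro tendsto_intros)
      ultimately have "\<forall>\<^sub>F x in at v. R' / (1 + R') < cmod x" by (rule order_tendstoD(1)[rotated])
      then show "\<forall>\<^sub>F x in at v. dist (?F x) (?F v) < e"
      proof eventually_elim
        case (elim x)
        have "\<bar>f (x / of_real (1 - cmod x))\<bar> < e" if x: "cmod x < 1"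
        proof (rule R)
          have "R' > 0" by (simp add: R'_def)
          then have "R' \<le> cmod x / (1 - cmod x)"
            using elim x by (simp add: field_simps)
          moreover have "cmod (x / of_real (1 - cmod x)) = cmod x / (1 - cmod x)"
            using x by (simp add: norm_divide norm_of_real del: of_real_diff)
          ultimately show "R \<le> cmod (x / of_real (1 - cmod x))" by (simp add: R'_def)
        qed
        then show ?case using False e by simp
      qed
    qed
  qed
  then show ?thesis by (simp add: continuous_at_imp_continuous_on)
qed

text \<open>Roots are lifted to parameters in [0, 1] through the disc model of the plane and the
  square-filling curve. Helly's theorem gives a limit law of the parameters; pushing it forward and
  dropping what sits outside the open disc leaves mass at most 1. The loss accounts for roots
  running to infinity and for lists shorter than \<open>n k\<close>.\<close>

theorem root_measures_vague_compact:
  fixes zs :: "nat \<Rightarrow> complex list" and n :: "nat \<Rightarrow> nat"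
  assumes len: "\<And>k. length (zs k) \<le> n k" and pos: "\<And>k. n k > 0"
  obtains s :: "nat \<Rightarrow> nat" and \<Lambda> :: "complex measure" where
    "strict_mono s" "finite_measure \<Lambda>" "sets \<Lambda> = sets borel" "measure \<Lambda> UNIV \<le> 1"
    "\<And>f :: complex \<Rightarrow> real. continuous_on UNIV f \<Longrightarrow> (f \<longlongrightarrow> 0) at_infinity \<Longrightarrow>
       (\<lambda>k. (\<Sum>z\<leftarrow>zs (s k). f z) / real (n (s k))) \<longlonglongrightarrow> (\<integral>z. f z \<partial>\<Lambda>)"
proof -
  obtain \<gamma> :: "real \<Rightarrow> complex" where \<gamma>: "continuous_on UNIV \<gamma>"
    and surj: "\<And>z. \<bar>Re z\<bar> \<le> 1 \<Longrightarrow> \<bar>Im z\<bar> \<le> 1 \<Longrightarrow> \<exists>t\<in>{0..1}. \<gamma> t = z"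
    using square_filling_curve by blast
  define blow where "blow v = v / of_real (1 - cmod v)" for v :: complex
  have lift: "\<exists>t\<in>{0..1}. cmod (\<gamma> t) < 1 \<and> blow (\<gamma> t) = z" for z
  proof -
    define v where "v = z / of_real (1 + cmod z)"
    have nv: "cmod v = cmod z / (1 + cmod z)"
      unfolding v_def norm_divide norm_of_real by simp
    have "1 + cmod z > 0" by (simp add: add_pos_nonneg)
    then have v1: "cmod v < 1" unfolding nv by simp
    have "1 - cmod v = 1 / (1 + cmod z)"
      unfolding nv using \<open>1 + cmod z > 0\<close> by (simp add: field_simps)
    then have "blow v = v * of_real (1 + cmod z)"
      unfolding blow_def by (simp only: of_real_divide) simp
    also have "\<dots> = z" unfolding v_def using \<open>1 + cmod z > 0\<close>
      by (simp del: of_real_add)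
    finally have "blow v = z" .
    moreover obtain t where "t \<in> {0..1}" "\<gamma> t = v"
      using surj[of v] abs_Re_le_cmod[of v] abs_Im_le_cmod[of v] v1 by force
    ultimately show ?thesis using v1 by blast
  qed
  then obtain L where L: "\<And>z. L z \<in> {0..1}" "\<And>z. cmod (\<gamma> (L z)) < 1" "\<And>z. blow (\<gamma> (L z)) = z"
    by metis
  \<comment> \<open>A parameter representing infinity, as 1 lies on the unit circle. It fills the
    places beyond the end of a list shorter than \<open>n k\<close>.\<close>
  obtain tinf where tinf: "tinf \<in> {0..1}" "\<gamma> tinf = 1"
    using surj[of 1] by auto
  define t where "t k i = (if i < length (zs k) then L (zs k ! i) else tinf)" for k i
  have t01: "t k i \<in> {0..1}" for k i using L tinf by (auto simp: t_def)
  define M where "M k = distr (measure_pmf (map_pmf (t k) (pmf_of_set {..<n k}))) borel (\<lambda>x. x)" for k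
  have ne: "{..<n k} \<noteq> {}" for k using pos[of k] by auto
  have intM: "(\<integral>x. g x \<partial>M k) = (\<Sum>i<n k. g (t k i)) / real (n k)"
    if [measurable]: "g \<in> borel_measurable borel" for g :: "real \<Rightarrow> real" and k
    using ne[of k] by (simp add: M_def integral_distr integral_pmf_of_set)
  have RD: "real_distribution (M k)" for k
    unfolding M_def real_distribution_def real_distribution_axioms_def
    by (auto intro!: measure_pmf.prob_space_distr)
  have "tight M"
    unfolding tight_def
  proof (intro conjI allI impI RD)
    fix \<epsilon> :: real assume \<epsilon>: "\<epsilon> > 0"
    have "measure (M k) {-1<..1} = 1" for k
    proof -
      have "measure (M k) {-1<..1} = measure (measure_pmf (map_pmf (t k) (pmf_of_set {..<n k}))) {-1<..1}"
        by (simp add: M_def measure_distr)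
      also have "\<dots> = 1"
      proof -
        have "set_pmf (map_pmf (t k) (pmf_of_set {..<n k})) \<subseteq> {-1<..1}"
        proof
          fix x assume "x \<in> set_pmf (map_pmf (t k) (pmf_of_set {..<n k}))"
          then obtain i where "x = t k i" using ne[of k] by auto
          then show "x \<in> {-1<..1}" using t01[of k i] by auto
        qed
        then show ?thesis by (auto simp: measure_pmf.prob_eq_1 AE_measure_pmf_iff)
      qed
      finally show ?thesis .
    qed
    then show "\<exists>a b. a < b \<and> (\<forall>k. 1 - \<epsilon> < measure (M k) {a<..b})"
      using \<epsilon> by (intro exI[of _ "-1"] exI[of _ 1]) auto
  qed
  then obtain r M0 where r: "strict_mono r" and M0: "real_distribution M0"
    and conv: "weak_conv_m (M \<circ> id \<circ> r) M0"
    using tight_imp_convergent_subsubsequence[of M id] by (auto simp: strict_mono_id)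
  interpret M0: real_distribution M0 by (rule M0)
  \<comment> \<open>The parameters of finite points. \<open>A\<close> need not be a continuity set
    of \<open>M0\<close>: the test functions used below vanish off it.\<close>
  define A where "A = {x. cmod (\<gamma> x) < 1}"
  have [measurable]: "\<gamma> \<in> borel_measurable borel"
    by (rule borel_measurable_continuous_onI) fact
  have [measurable]: "A \<in> sets borel" unfolding A_def by measurable
  have [measurable]: "blow \<in> borel_measurable borel" unfolding blow_def by measurable
  define \<Lambda> where "\<Lambda> = distr (density M0 (\<lambda>x. ennreal (indicator A x))) borel (\<lambda>x. blow (\<gamma> x))"
  have em: "emeasure \<Lambda> UNIV = emeasure M0 A"
    by (simp add: \<Lambda>_def emeasure_distr emeasure_density ennreal_indicator)
  have fin: "finite_measure \<Lambda>"
    by (rule finite_measureI) (use em in \<open>simp add: \<Lambda>_def\<close>)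
  have mass: "measure \<Lambda> UNIV \<le> 1"
    using em M0.prob_le_1[of A] by (simp add: measure_def)
  have lim: "(\<lambda>k. (\<Sum>z\<leftarrow>zs (r k). f z) / real (n (r k))) \<longlonglongrightarrow> (\<integral>z. f z \<partial>\<Lambda>)"
    if f: "continuous_on UNIV f" "(f \<longlongrightarrow> 0) at_infinity" for f :: "complex \<Rightarrow> real"
  proof -
    define F where "F v = (if cmod v < 1 then f (blow v) else 0)" for v
    have [measurable]: "f \<in> borel_measurable borel"
      by (rule borel_measurable_continuous_onI) fact
    have F: "continuous_on UNIV F"
      unfolding F_def blow_def by (rule continuous_ball_extension[OF f])
    obtain B where B: "\<And>z. \<bar>f z\<bar> \<le> B" using bounded_if_vanishes_at_infinity[OF f] by blast
    then have B': "\<bar>F v\<bar> \<le> B" for v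
      using order_trans[OF abs_ge_zero B[of 0]] by (auto simp: F_def)
    have F\<gamma>: "continuous_on UNIV (\<lambda>x. F (\<gamma> x))"
      by (rule continuous_on_compose2[OF F \<gamma>]) auto
    have m: "(\<lambda>x. F (\<gamma> x)) \<in> borel_measurable borel"
      by (rule borel_measurable_continuous_onI) fact
    interpret RM: real_distribution "(M \<circ> id \<circ> r) k" for k using RD by simp
    have "(\<lambda>k. \<integral>x. F (\<gamma> x) \<partial>(M \<circ> id \<circ> r) k) \<longlonglongrightarrow> (\<integral>x. F (\<gamma> x) \<partial>M0)"
      by (rule weak_conv_imp_integral_bdd_continuous_conv[OF _ M0 conv, of _ B])
        (use RD F\<gamma> B' in \<open>auto simp: continuous_on_eq_continuous_at\<close>)
    moreover have "(\<integral>x. F (\<gamma> x) \<partial>M k) = (\<Sum>z\<leftarrow>zs k. f z) / real (n k)" for k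
    proof -
      have "(\<Sum>i<n k. F (\<gamma> (t k i))) = (\<Sum>i<length (zs k). F (\<gamma> (t k i)))"
        by (rule sum.mono_neutral_right) (use len tinf in \<open>auto simp: t_def F_def\<close>)
      also have "\<dots> = (\<Sum>i<length (zs k). f (zs k ! i))"
        by (rule sum.cong) (use L in \<open>auto simp: t_def F_def\<close>)
      also have "\<dots> = (\<Sum>z\<leftarrow>zs k. f z)"
        by (simp add: sum_list_sum_nth atLeast0LessThan)
      finally show ?thesis using intM[OF m, of k] by simp
    qed
    moreover have "(\<integral>x. F (\<gamma> x) \<partial>M0) = (\<integral>z. f z \<partial>\<Lambda>)"
      unfolding \<Lambda>_def
      by (subst integral_distr) (auto simp: integral_real_density A_def F_def indicator_def intro!: Bochner_Integration.integral_cong)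
    ultimately show ?thesis by simp
  qed
  show thesis
    by (rule that[OF r fin _ mass lim]) (simp_all add: \<Lambda>_def)
qed

section \<open>Positive definiteness of the chordal logarithmic kernel\<close>

text \<open>The squared modulus of the Hermitian product of the unit vectors along (z, 1) and (w,
  1), that is, the squared cosine of the angle between two complex lines.\<close>

definition sph_kernel :: "complex \<Rightarrow> complex \<Rightarrow> real" where
  "sph_kernel z w = (cmod (1 + z * cnj w))\<^sup>2 / ((1 + (cmod z)\<^sup>2) * (1 + (cmod w)\<^sup>2))"

lemma one_plus_norm_sq_pos: "1 + (cmod z)\<^sup>2 > 0"
  by (simp add: add_pos_nonneg)

lemma one_minus_sph_kernel:
  "1 - sph_kernel z w = (cmod (z - w))\<^sup>2 / ((1 + (cmod z)\<^sup>2) * (1 + (cmod w)\<^sup>2))"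
proof -
  have "(cmod (1 + z * cnj w))\<^sup>2 + (cmod (z - w))\<^sup>2 = (1 + (cmod z)\<^sup>2) * (1 + (cmod w)\<^sup>2)"
    by (simp add: cmod_power2) algebra
  then show ?thesis
    using one_plus_norm_sq_pos[of z] one_plus_norm_sq_pos[of w]
    by (simp add: sph_kernel_def divide_simps)
qed

lemma sph_kernel_nonneg [simp]: "sph_kernel z w \<ge> 0"
  by (simp add: sph_kernel_def)

lemma sph_kernel_le_1: "sph_kernel z w \<le> 1"
proof -
  have "1 - sph_kernel z w \<ge> 0" unfolding one_minus_sph_kernel by simp
  then show ?thesis by simp
qed

lemma sph_kernel_less_1: "z \<noteq> w \<Longrightarrow> sph_kernel z w < 1"
proof -
  assume "z \<noteq> w"
  then have "1 - sph_kernel z w > 0"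
    unfolding one_minus_sph_kernel using one_plus_norm_sq_pos[of z] one_plus_norm_sq_pos[of w] by simp
  then show ?thesis by simp
qed

lemma sph_kernel_self [simp]: "sph_kernel z z = 1"
  using one_minus_sph_kernel[of z z] by simp

lemma measurable_sph_kernel [measurable (raw)]:
  "f \<in> borel_measurable M \<Longrightarrow> g \<in> borel_measurable M \<Longrightarrow> (\<lambda>x. sph_kernel (f x) (g x)) \<in> borel_measurable M"
proof -
  assume [measurable]: "f \<in> borel_measurable M" "g \<in> borel_measurable M"
  have [measurable]: "(\<lambda>x. cnj (g x)) \<in> borel_measurable M"
    by (rule measurable_compose[of g _ borel cnj])
      (auto intro!: borel_measurable_continuous_onI continuous_intros)
  show ?thesis
    unfolding sph_kernel_def
    by (intro borel_measurable_divide borel_measurable_power borel_measurable_times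
      borel_measurable_add borel_measurable_const borel_measurable_norm) measurable
qed

text \<open>The expansion of \<open>- ln (1 - c)\<close> at \<open>c = sph_kernel z w\<close>. As a
  series of nonnegative terms it is infinite on the diagonal and can be integrated term by
  term.\<close>

definition log_kernel :: "complex \<Rightarrow> complex \<Rightarrow> ennreal" where
  "log_kernel z w = (\<Sum>k. ennreal (sph_kernel z w ^ Suc k / real (Suc k)))"

lemma measurable_log_kernel [measurable (raw)]:
  "f \<in> borel_measurable M \<Longrightarrow> g \<in> borel_measurable M \<Longrightarrow> (\<lambda>x. log_kernel (f x) (g x)) \<in> borel_measurable M"
  unfolding log_kernel_def
  by (intro borel_measurable_suminf_order measurable_compose[OF _ measurable_ennreal] borel_measurable_divide
    borel_measurable_power measurable_sph_kernel borel_measurable_const)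

lemma log_kernel_diag: "log_kernel z z = \<infinity>"
proof (rule ccontr)
  assume "log_kernel z z \<noteq> \<infinity>"
  then have "summable (\<lambda>k. 1 / real (Suc k))"
    unfolding log_kernel_def by (intro summable_suminf_not_top) auto
  then show False
    using not_summable_harmonic[where 'a=real] summable_Suc_iff[of "\<lambda>k. inverse (real k)"]
    by (simp add: inverse_eq_divide)
qed

lemma log_kernel_off_diag:
  assumes "z \<noteq> w"
  shows "log_kernel z w = ennreal (- ln (1 - sph_kernel z w))"
proof -
  define c where "c = sph_kernel z w"
  have c: "0 \<le> c" "c < 1" using sph_kernel_less_1[OF assms] by (simp_all add: c_def)
  have sm: "summable (\<lambda>k. c ^ Suc k / real (Suc k))"
  proof (rule summable_comparison_test')
    show "summable (\<lambda>k. c ^ k)" using c by (intro summable_geometric) auto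
    show "norm (c ^ Suc k / real (Suc k)) \<le> c ^ k" if "k \<ge> 0" for k
    proof -
      have "c ^ Suc k / real (Suc k) \<le> c ^ Suc k / 1"
        using c by (intro divide_left_mono) auto
      also have "c ^ Suc k / 1 = c ^ Suc k" by simp
      also have "\<dots> \<le> c ^ k" using c by (simp add: mult_left_le_one_le)
      finally show ?thesis using c by simp
    qed
  qed
  have "ln (1 - c) = (\<Sum>n. (-1) ^ n * (1 / real (n + 1)) * ((1 - c) - 1) ^ Suc n)"
    using c by (intro ln_series) auto
  also have "(\<lambda>n. (-1) ^ n * (1 / real (n + 1)) * ((1 - c) - 1) ^ Suc n) = (\<lambda>n. - (c ^ Suc n / real (Suc n)))"
  proof
    fix n
    have "((1 - c) - 1) ^ Suc n = (-1) ^ Suc n * c ^ Suc n"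
      by (subst power_mult_distrib[symmetric]) simp
    moreover have "(-1::real) ^ n * (-1) ^ Suc n = -1"
      by (simp flip: power_mult_distrib)
    ultimately show "(-1) ^ n * (1 / real (n + 1)) * ((1 - c) - 1) ^ Suc n = - (c ^ Suc n / real (Suc n))"
      by (simp only: mult.assoc mult.left_commute[of "(-1) ^ n"]) simp
  qed
  also have "(\<Sum>n. - (c ^ Suc n / real (Suc n))) = - (\<Sum>n. c ^ Suc n / real (Suc n))"
    by (rule suminf_minus[OF sm])
  finally show ?thesis
    unfolding log_kernel_def c_def[symmetric]
    by (subst suminf_ennreal2) (use c sm in auto)
qed

lemma log_kernel_sym: "log_kernel z w = log_kernel w z"
proof -
  have "sph_kernel z w = sph_kernel w z"
    using one_minus_sph_kernel[of z w] one_minus_sph_kernel[of w z]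
    by (simp add: norm_minus_commute mult.commute)
  then show ?thesis by (simp add: log_kernel_def)
qed

section \<open>Moments against spherical monomials\<close>

definition sph_mono :: "nat \<Rightarrow> nat \<Rightarrow> nat \<Rightarrow> complex \<Rightarrow> complex" where
  "sph_mono k a b z = z ^ a * cnj z ^ b / of_real ((1 + (cmod z)\<^sup>2) ^ k)"

lemma measurable_sph_mono [measurable]: "sph_mono k a b \<in> borel_measurable borel"
  unfolding sph_mono_def by (intro borel_measurable_continuous_onI continuous_intros) 
    (metis of_real_eq_0_iff one_plus_norm_sq_pos less_irrefl power_eq_0_iff)

lemma sph_mono_bound:
  assumes "a \<le> k" "b \<le> k"
  shows "cmod (sph_mono k a b z) \<le> 1"
proof -
  define m where "m = max 1 (cmod z)"
  have m: "m \<ge> 1" "cmod z \<le> m" by (auto simp: m_def)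
  have "cmod z ^ a * cmod z ^ b \<le> m ^ a * m ^ b"
    using m by (intro mult_mono power_mono) auto
  also have "\<dots> \<le> m ^ k * m ^ k"
    using m assms by (intro mult_mono power_increasing) auto
  also have "\<dots> = (m\<^sup>2) ^ k" by (simp add: power2_eq_square power_mult_distrib)
  also have "\<dots> \<le> (1 + (cmod z)\<^sup>2) ^ k"
    by (intro power_mono) (auto simp: m_def max_def)
  finally show ?thesis
    using one_plus_norm_sq_pos[of z]
    by (simp add: sph_mono_def norm_divide norm_mult norm_power divide_le_eq del: of_real_power)
qed

lemma integrable_sph_mono:
  assumes "finite_measure \<alpha>" "sets \<alpha> = sets borel" "a \<le> k" "b \<le> k"
  shows "integrable \<alpha> (sph_mono k a b)"
proof -
  interpret finite_measure \<alpha> by fact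
  note [measurable_cong] = assms(2)
  show ?thesis
    by (rule integrable_const_bound[of _ 1]) (use sph_mono_bound assms in auto)
qed

text \<open>Two binomial expansions, of \<open>1 + z * cnj w\<close> and of its conjugate, separate
  the variables with positive coefficients. This is why every power of the kernel is positive
  semidefinite.\<close>

lemma sph_kernel_power:
  "complex_of_real (sph_kernel z w ^ k) = (\<Sum>a\<le>k. \<Sum>b\<le>k. of_nat (k choose a) * of_nat (k choose b) *
     (sph_mono k a b z * cnj (sph_mono k a b w)))"
proof -
  have "complex_of_real ((cmod (1 + z * cnj w))\<^sup>2) = (1 + z * cnj w) * cnj (1 + z * cnj w)"
    by (rule complex_norm_square)
  then have "complex_of_real ((cmod (1 + z * cnj w))\<^sup>2) ^ k = (z * cnj w + 1) ^ k * (cnj z * w + 1) ^ k"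
    by (simp add: power_mult_distrib add.commute)
  also have "\<dots> = (\<Sum>a\<le>k. of_nat (k choose a) * (z * cnj w) ^ a) * (\<Sum>b\<le>k. of_nat (k choose b) * (cnj z * w) ^ b)"
    by (simp add: binomial_ring)
  also have "\<dots> = (\<Sum>a\<le>k. \<Sum>b\<le>k. of_nat (k choose a) * of_nat (k choose b) *
      ((z ^ a * cnj z ^ b) * cnj (w ^ a * cnj w ^ b)))"
    unfolding sum_product by (intro sum.cong refl) (simp add: power_mult_distrib mult_ac)
  finally have *: "complex_of_real ((cmod (1 + z * cnj w))\<^sup>2) ^ k = \<dots>" .
  have "complex_of_real (sph_kernel z w ^ k) = complex_of_real ((cmod (1 + z * cnj w))\<^sup>2) ^ k /
      (of_real ((1 + (cmod z)\<^sup>2) ^ k) * of_real ((1 + (cmod w)\<^sup>2) ^ k))"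
    by (simp add: sph_kernel_def power_divide power_mult_distrib)
  then show ?thesis
    unfolding * by (simp add: sum_divide_distrib sph_mono_def)
qed

definition sph_moment :: "complex measure \<Rightarrow> nat \<Rightarrow> nat \<Rightarrow> nat \<Rightarrow> complex" where
  "sph_moment \<alpha> k a b = (\<integral>z. sph_mono k a b z \<partial>\<alpha>)"

definition sph_energy :: "nat \<Rightarrow> complex measure \<Rightarrow> complex measure \<Rightarrow> real" where
  "sph_energy k \<alpha> \<beta> = (\<integral>z. (\<integral>w. sph_kernel z w ^ k \<partial>\<beta>) \<partial>\<alpha>)"

lemma sph_energy_moments:
  assumes "finite_measure \<alpha>" "sets \<alpha> = sets borel" "finite_measure \<beta>" "sets \<beta> = sets borel"
  shows "complex_of_real (sph_energy k \<alpha> \<beta>) = (\<Sum>a\<le>k. \<Sum>b\<le>k. of_nat (k choose a) * of_nat (k choose b) *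
     (sph_moment \<alpha> k a b * cnj (sph_moment \<beta> k a b)))"
proof -
  have "complex_of_real (\<integral>w. sph_kernel z w ^ k \<partial>\<beta>) = (\<Sum>a\<le>k. \<Sum>b\<le>k. of_nat (k choose a) * of_nat (k choose b) *
     (sph_mono k a b z * cnj (sph_moment \<beta> k a b)))" for z
  proof -
    have "complex_of_real (\<integral>w. sph_kernel z w ^ k \<partial>\<beta>) = (\<integral>w. complex_of_real (sph_kernel z w ^ k) \<partial>\<beta>)"
      by (rule integral_complex_of_real[symmetric])
    also have "\<dots> = (\<Sum>a\<le>k. \<Sum>b\<le>k. \<integral>w. of_nat (k choose a) * of_nat (k choose b) *
     (sph_mono k a b z * cnj (sph_mono k a b w)) \<partial>\<beta>)"
      unfolding sph_kernel_power
      by (subst Bochner_Integration.integral_sum; (subst Bochner_Integration.integral_sum)?)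
        (auto intro!: Bochner_Integration.integrable_sum integrable_mult_right integrable_cnj
          integrable_sph_mono assms sum.cong Bochner_Integration.integral_sum)
    finally show ?thesis
      by (simp add: sph_moment_def)
  qed
  then have "complex_of_real (sph_energy k \<alpha> \<beta>) = (\<integral>z. (\<Sum>a\<le>k. \<Sum>b\<le>k. of_nat (k choose a) * of_nat (k choose b) *
     (sph_mono k a b z * cnj (sph_moment \<beta> k a b))) \<partial>\<alpha>)"
    unfolding sph_energy_def by (subst integral_complex_of_real[symmetric]) simp
  also have "\<dots> = (\<Sum>a\<le>k. \<Sum>b\<le>k. \<integral>z. of_nat (k choose a) * of_nat (k choose b) *
     (sph_mono k a b z * cnj (sph_moment \<beta> k a b)) \<partial>\<alpha>)"
    by (subst Bochner_Integration.integral_sum; (subst Bochner_Integration.integral_sum)?)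
      (auto intro!: Bochner_Integration.integrable_sum integrable_mult_right integrable_mult_left
          integrable_sph_mono assms sum.cong Bochner_Integration.integral_sum)
  finally show ?thesis
    by (simp add: sph_moment_def)
qed

text \<open>Completing the square in the moments. The mixed energy is real, so it may be expanded in
  both orders, which supplies the two cross terms.\<close>

lemma sph_energy_diff:
  assumes "finite_measure \<alpha>" "sets \<alpha> = sets borel" "finite_measure \<beta>" "sets \<beta> = sets borel"
  shows "sph_energy k \<alpha> \<alpha> - 2 * sph_energy k \<alpha> \<beta> + sph_energy k \<beta> \<beta> =
    (\<Sum>a\<le>k. \<Sum>b\<le>k. real (k choose a) * real (k choose b) * (cmod (sph_moment \<alpha> k a b - sph_moment \<beta> k a b))\<^sup>2)"
proof -
  let ?C = "\<lambda>a b. complex_of_nat (k choose a) * of_nat (k choose b)"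
  let ?A = "sph_moment \<alpha> k" and ?B = "sph_moment \<beta> k"
  note E = sph_energy_moments
  have "complex_of_real (sph_energy k \<alpha> \<beta>) = cnj (complex_of_real (sph_energy k \<alpha> \<beta>))" by simp
  also have "\<dots> = (\<Sum>a\<le>k. \<Sum>b\<le>k. ?C a b * (?B a b * cnj (?A a b)))"
    unfolding E[OF assms] by (simp add: mult_ac)
  finally have E': "complex_of_real (sph_energy k \<alpha> \<beta>) = (\<Sum>a\<le>k. \<Sum>b\<le>k. ?C a b * (?B a b * cnj (?A a b)))" .
  have "complex_of_real (sph_energy k \<alpha> \<alpha> - 2 * sph_energy k \<alpha> \<beta> + sph_energy k \<beta> \<beta>) =
    complex_of_real (sph_energy k \<alpha> \<alpha>) - complex_of_real (sph_energy k \<alpha> \<beta>)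
     - complex_of_real (sph_energy k \<alpha> \<beta>) + complex_of_real (sph_energy k \<beta> \<beta>)" by simp
  also have "\<dots> = (\<Sum>a\<le>k. \<Sum>b\<le>k. ?C a b * (?A a b * cnj (?A a b)) - ?C a b * (?A a b * cnj (?B a b))
      - ?C a b * (?B a b * cnj (?A a b)) + ?C a b * (?B a b * cnj (?B a b)))"
    by (subst (2) E', subst E[OF assms], subst E[OF assms(1,2,1,2)], subst E[OF assms(3,4,3,4)])
       (simp only: sum_subtractf sum.distrib)
  also have "\<dots> = (\<Sum>a\<le>k. \<Sum>b\<le>k. ?C a b * ((?A a b - ?B a b) * cnj (?A a b - ?B a b)))"
    by (intro sum.cong refl) (simp add: algebra_simps)
  also have "\<dots> = complex_of_real (\<Sum>a\<le>k. \<Sum>b\<le>k. real (k choose a) * real (k choose b) * (cmod (?A a b - ?B a b))\<^sup>2)"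
    by (simp only: complex_norm_square[symmetric] of_real_sum of_real_mult of_real_of_nat_eq)
  finally show ?thesis by (simp only: of_real_eq_iff)
qed

text \<open>The span of the monomials of one level \<open>k\<close>. The level is recorded because
  equality of moments is given level by level.\<close>

inductive sph_poly :: "nat \<Rightarrow> (complex \<Rightarrow> complex) \<Rightarrow> bool" where
  mono: "a \<le> k \<Longrightarrow> b \<le> k \<Longrightarrow> sph_poly k (\<lambda>z. c * sph_mono k a b z)"
| add: "sph_poly k f \<Longrightarrow> sph_poly k g \<Longrightarrow> sph_poly k (\<lambda>z. f z + g z)"

lemma sph_mono_mult: "sph_mono k a b z * sph_mono l c d z = sph_mono (k + l) (a + c) (b + d) z"
  by (simp add: sph_mono_def power_add mult_ac)

lemma sph_poly_mult:
  assumes "sph_poly k f" "sph_poly l g"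
  shows "sph_poly (k + l) (\<lambda>z. f z * g z)"
  using assms(1)
proof induction
  case (mono a k b c)
  from assms(2) show ?case
  proof induction
    case (mono a' l b' c')
    have "sph_poly (k + l) (\<lambda>z. (c * c') * sph_mono (k + l) (a + a') (b + b') z)"
      using mono \<open>a \<le> k\<close> \<open>b \<le> k\<close> by (intro sph_poly.mono) auto
    then show ?case by (simp add: sph_mono_mult[symmetric] mult_ac)
  next
    case (add l f g)
    then show ?case using sph_poly.add by (fastforce simp: distrib_left)
  qed
next
  case (add k f g)
  then show ?case using sph_poly.add by (fastforce simp: distrib_right)
qed

text \<open>Dividing \<open>1 + z * cnj z\<close> by itself writes 1 as a sum of two monomials of
  level 1. Multiplying by it raises the level, so functions of different levels can be
  added.\<close>

lemma sph_poly_const: "sph_poly k (\<lambda>_. c)"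
proof -
  have "sph_poly k (\<lambda>_. 1)"
  proof (induction k)
    case 0
    show ?case using sph_poly.mono[of 0 0 0 1] by (simp add: sph_mono_def)
  next
    case (Suc k)
    have "sph_poly 1 (\<lambda>z. 1 * sph_mono 1 0 0 z + 1 * sph_mono 1 1 1 z)"
      by (intro sph_poly.add sph_poly.mono) auto
    also have "(\<lambda>z. 1 * sph_mono 1 0 0 z + 1 * sph_mono 1 1 1 z) = (\<lambda>_. 1)"
    proof
      fix z
      have "complex_of_real (1 + (cmod z)\<^sup>2) \<noteq> 0"
        using one_plus_norm_sq_pos[of z] by (metis less_irrefl of_real_eq_0_iff)
      moreover have "1 + z * cnj z = complex_of_real (1 + (cmod z)\<^sup>2)"
        by (simp only: of_real_add of_real_1 complex_norm_square)
      ultimately show "1 * sph_mono 1 0 0 z + 1 * sph_mono 1 1 1 z = 1"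
        by (simp add: sph_mono_def flip: add_divide_distrib del: of_real_add)
    qed
    finally show ?case using sph_poly_mult[OF _ Suc, of 1 "\<lambda>_. 1"] by simp
  qed
  moreover have "sph_poly 0 (\<lambda>_. c)"
    using sph_poly.mono[of 0 0 0 c] by (simp add: sph_mono_def)
  ultimately show ?thesis using sph_poly_mult[of 0 "\<lambda>_. c" k "\<lambda>_. 1"] by simp
qed

lemma sph_poly_raise: "sph_poly k f \<Longrightarrow> sph_poly (k + l) f"
  using sph_poly_mult[of k f l "\<lambda>_. 1"] sph_poly_const by simp

lemma sph_poly_integral:
  assumes "sph_poly k f"
    and \<alpha>: "finite_measure \<alpha>" "sets \<alpha> = sets borel" and \<beta>: "finite_measure \<beta>" "sets \<beta> = sets borel"
    and M: "\<And>a b. a \<le> k \<Longrightarrow> b \<le> k \<Longrightarrow> sph_moment \<alpha> k a b = sph_moment \<beta> k a b"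
  shows "integrable \<alpha> f \<and> integrable \<beta> f \<and> (\<integral>z. f z \<partial>\<alpha>) = (\<integral>z. f z \<partial>\<beta>)"
  using assms(1) M
proof induction
  case (mono a k b c)
  then show ?case
    using integrable_sph_mono[OF \<alpha>] integrable_sph_mono[OF \<beta>] by (simp add: sph_moment_def)
next
  case (add k f g)
  then show ?case by simp
qed

section \<open>Stereographic projection and determination of a measure by its moments\<close>

definition stereo :: "complex \<Rightarrow> complex \<times> real" where
  "stereo z = (z / of_real (1 + (cmod z)\<^sup>2), 1 / (1 + (cmod z)\<^sup>2))"

text \<open>The sphere of radius 1/2 about (0, 1/2). \<open>stereo\<close> misses only its point (0,
  0), which stands for infinity; with it the set is compact, as Stone-Weierstrass requires.\<close>

definition sphere_set :: "(complex \<times> real) set" where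
  "sphere_set = {p. (cmod (fst p))\<^sup>2 = snd p - (snd p)\<^sup>2}"

lemma continuous_stereo: "continuous_on A stereo"
  unfolding stereo_def
  by (intro continuous_intros) (metis of_real_eq_0_iff one_plus_norm_sq_pos less_irrefl)+

lemma stereo_in: "stereo z \<in> sphere_set"
proof -
  have "1 + (cmod z)\<^sup>2 \<noteq> 0" using one_plus_norm_sq_pos[of z] by simp
  moreover have "cmod (fst (stereo z)) = cmod z / (1 + (cmod z)\<^sup>2)"
    unfolding stereo_def fst_conv norm_divide norm_of_real by simp
  ultimately show ?thesis
    by (simp add: sphere_set_def stereo_def power_divide) (simp add: divide_simps power2_eq_square)
qed

lemma inj_stereo: "inj stereo"
proof
  fix z w assume "stereo z = stereo w"
  then have "1 / (1 + (cmod z)\<^sup>2) = 1 / (1 + (cmod w)\<^sup>2)"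
    and 2: "z / of_real (1 + (cmod z)\<^sup>2) = w / of_real (1 + (cmod w)\<^sup>2)"
    by (auto simp: stereo_def)
  then have "1 + (cmod z)\<^sup>2 = 1 + (cmod w)\<^sup>2"
    by (metis divide_divide_eq_right div_by_1 mult_1)
  moreover have "complex_of_real (1 + (cmod w)\<^sup>2) \<noteq> 0"
    using one_plus_norm_sq_pos[of w] by (metis less_irrefl of_real_eq_0_iff)
  ultimately show "z = w" using 2 by (simp del: of_real_add)
qed

lemma compact_sphere_set: "compact sphere_set"
proof -
  have "closed sphere_set"
    unfolding sphere_set_def by (intro closed_Collect_eq continuous_intros)
  moreover have "sphere_set \<subseteq> cball 0 1 \<times> cball 0 1"
  proof
    fix p assume "p \<in> sphere_set"
    then have p: "(cmod (fst p))\<^sup>2 = snd p - (snd p)\<^sup>2" by (simp add: sphere_set_def)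
    then have "snd p * (1 - snd p) \<ge> 0"
      by (metis zero_le_power2 power2_eq_square right_diff_distrib mult.right_neutral)
    then have s: "0 \<le> snd p" "snd p \<le> 1" by (auto simp: zero_le_mult_iff)
    then have "(cmod (fst p))\<^sup>2 \<le> 1\<^sup>2" using p by (smt (verit) one_power2 zero_le_power2)
    then have "cmod (fst p) \<le> 1" by (rule power2_le_imp_le) simp
    then show "p \<in> cball 0 1 \<times> cball 0 1" using s by (auto simp: mem_Times_iff)
  qed
  moreover have "compact (cball 0 1 \<times> cball 0 1 :: (complex \<times> real) set)"
    by (intro compact_Times compact_cball)
  ultimately show ?thesis
    by (metis compact_Int_closed inf.absorb_iff2 inf_commute)
qed

text \<open>On the sphere the spherical polynomials form a point-separating algebra, so
  Stone-Weierstrass extends equality of moments to continuous functions; functions of the distance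
  to a set then give compact sets, and these give all Borel sets. Only levels from 1 on are assumed,
  because the logarithmic series starts with the first power; constants reappear at level 1.\<close>

lemma sph_moments_determine_measure:
  assumes \<alpha>: "finite_measure \<alpha>" "sets \<alpha> = sets borel" and \<beta>: "finite_measure \<beta>" "sets \<beta> = sets borel"
    and M: "\<And>k a b. k \<ge> 1 \<Longrightarrow> a \<le> k \<Longrightarrow> b \<le> k \<Longrightarrow> sph_moment \<alpha> k a b = sph_moment \<beta> k a b"
  shows "\<alpha> = \<beta>"
proof -
  interpret A: finite_measure \<alpha> by fact
  interpret B: finite_measure \<beta> by fact
  note [measurable_cong] = \<alpha>(2) \<beta>(2)
  have sp: "space \<alpha> = UNIV" "space \<beta> = UNIV"
    using sets_eq_imp_space_eq[OF \<alpha>(2)] sets_eq_imp_space_eq[OF \<beta>(2)] by auto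
  define R where "R = {g :: complex \<times> real \<Rightarrow> real. continuous_on sphere_set g \<and>
     (\<exists>k\<ge>1. sph_poly k (\<lambda>z. of_real (g (stereo z))))}"
  have [measurable]: "stereo \<in> borel_measurable borel"
    by (rule borel_measurable_continuous_onI[OF continuous_stereo])
  have [simp]: "2 * x / (2 + 2 * y) = x / (1 + y)" for x y :: real
    using mult_divide_mult_cancel_left[of 2 x "1 + y"] by (simp add: distrib_left)
  have R1: "(\<lambda>p. snd p) \<in> R"
  proof -
    have "sph_poly 1 (\<lambda>z. 1 * sph_mono 1 0 0 z)" by (rule sph_poly.mono) auto
    then show ?thesis
      by (auto simp: R_def stereo_def sph_mono_def intro!: continuous_intros exI[of _ 1])
  qed
  have R2: "(\<lambda>p. Re (fst p)) \<in> R"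
  proof -
    have "sph_poly 1 (\<lambda>z. (1/2) * sph_mono 1 1 0 z + (1/2) * sph_mono 1 0 1 z)"
      by (intro sph_poly.add sph_poly.mono) auto
    also have "(\<lambda>z. (1/2) * sph_mono 1 1 0 z + (1/2) * sph_mono 1 0 1 z) = (\<lambda>z. of_real (Re (fst (stereo z))))"
      by (auto simp: fun_eq_iff sph_mono_def stereo_def complex_eq_iff Re_divide_of_real Im_divide_of_real
            simp del: of_real_add of_real_power simp flip: add_divide_distrib)
    finally show ?thesis
      by (auto simp: R_def intro!: continuous_intros exI[of _ 1])
  qed
  have R3: "(\<lambda>p. Im (fst p)) \<in> R"
  proof -
    have "sph_poly 1 (\<lambda>z. (-\<i>/2) * sph_mono 1 1 0 z + (\<i>/2) * sph_mono 1 0 1 z)"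
      by (intro sph_poly.add sph_poly.mono) auto
    also have "(\<lambda>z. (-\<i>/2) * sph_mono 1 1 0 z + (\<i>/2) * sph_mono 1 0 1 z) = (\<lambda>z. of_real (Im (fst (stereo z))))"
      by (auto simp: fun_eq_iff sph_mono_def stereo_def complex_eq_iff Re_divide_of_real Im_divide_of_real
            simp del: of_real_add of_real_power simp flip: add_divide_distrib)
    finally show ?thesis
      by (auto simp: R_def intro!: continuous_intros exI[of _ 1])
  qed
  interpret function_ring_on R sphere_set
  proof
    fix f g assume "f \<in> R" "g \<in> R"
    then obtain k l where f: "continuous_on sphere_set f" "k \<ge> 1" "sph_poly k (\<lambda>z. of_real (f (stereo z)))"
      and g: "continuous_on sphere_set g" "l \<ge> 1" "sph_poly l (\<lambda>z. of_real (g (stereo z)))"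
      by (auto simp: R_def)
    have "sph_poly (k + l) (\<lambda>z. of_real (f (stereo z)) * of_real (g (stereo z)))"
      by (rule sph_poly_mult[OF f(3) g(3)])
    then show "(\<lambda>x. f x * g x) \<in> R"
      using f g by (auto simp: R_def intro!: continuous_intros exI[of _ "k + l"])
    have "sph_poly (k + l) (\<lambda>z. of_real (f (stereo z)) + of_real (g (stereo z)))"
      using sph_poly_raise[OF f(3), of l] sph_poly_raise[OF g(3), of k]
      by (intro sph_poly.add) (auto simp: add.commute)
    then show "(\<lambda>x. f x + g x) \<in> R"
      using f g by (auto simp: R_def intro!: continuous_intros exI[of _ "k + l"])
  next
    fix x y :: "complex \<times> real" assume "x \<noteq> y"
    then have "snd x \<noteq> snd y \<or> Re (fst x) \<noteq> Re (fst y) \<or> Im (fst x) \<noteq> Im (fst y)"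
      by (auto simp: prod_eq_iff complex_eq_iff)
    then show "\<exists>f\<in>R. f x \<noteq> f y"
      by (elim disjE) (rule bexI[OF _ R1] bexI[OF _ R2] bexI[OF _ R3], assumption)+
  next
    fix c show "(\<lambda>_. c) \<in> R"
      using sph_poly_const[of 1] by (auto simp: R_def intro!: exI[of _ 1])
  qed (auto simp: R_def compact_sphere_set)
  have int_eq: "(\<integral>z. g (stereo z) \<partial>\<alpha>) = (\<integral>z. g (stereo z) \<partial>\<beta>)" if g: "continuous_on UNIV g" for g :: "complex \<times> real \<Rightarrow> real"
  proof (rule ccontr)
    assume ne: "\<not> ?thesis"
    have gS: "continuous_on sphere_set g" using g by (rule continuous_on_subset) auto
    have [measurable]: "g \<in> borel_measurable borel" by (rule borel_measurable_continuous_onI[OF g])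
    obtain C where C: "\<And>p. p \<in> sphere_set \<Longrightarrow> \<bar>g p\<bar> \<le> C"
      using compact_imp_bounded[OF compact_continuous_image[OF gS compact_sphere_set]]
      unfolding bounded_iff by (metis image_eqI real_norm_def)
    have ig: "integrable \<alpha> (\<lambda>z. g (stereo z))" "integrable \<beta> (\<lambda>z. g (stereo z))"
      by (auto intro!: A.integrable_const_bound[of _ C] B.integrable_const_bound[of _ C] C stereo_in)
    define d where "d = \<bar>(\<integral>z. g (stereo z) \<partial>\<alpha>) - (\<integral>z. g (stereo z) \<partial>\<beta>)\<bar>"
    \<comment> \<open>The summand 1 keeps \<open>m\<close> positive and makes the last estimate of
      the contradiction strict.\<close>
    define m where "m = measure \<alpha> UNIV + measure \<beta> UNIV + 1"
    have dm: "d > 0" "m > 0" using ne by (auto simp: d_def m_def add_nonneg_pos)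
    obtain f where f: "f \<in> R" "\<And>x. x \<in> sphere_set \<Longrightarrow> \<bar>g x - f x\<bar> < d / m"
      using Stone_Weierstrass_basic[OF gS, of "d / m"] dm by auto
    obtain k where k: "k \<ge> 1" "sph_poly k (\<lambda>z. of_real (f (stereo z)))"
      using f(1) by (auto simp: R_def)
    have "integrable \<alpha> (\<lambda>z. complex_of_real (f (stereo z))) \<and> integrable \<beta> (\<lambda>z. complex_of_real (f (stereo z)))
       \<and> (\<integral>z. complex_of_real (f (stereo z)) \<partial>\<alpha>) = (\<integral>z. complex_of_real (f (stereo z)) \<partial>\<beta>)"
      by (rule sph_poly_integral[OF k(2) \<alpha> \<beta>]) (use M k(1) in auto)
    then have if': "integrable \<alpha> (\<lambda>z. f (stereo z))" "integrable \<beta> (\<lambda>z. f (stereo z))"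
        "(\<integral>z. f (stereo z) \<partial>\<alpha>) = (\<integral>z. f (stereo z) \<partial>\<beta>)"
      by (auto simp: complex_of_real_integrable_eq)
    have bd: "\<bar>(\<integral>z. g (stereo z) \<partial>\<mu>) - (\<integral>z. f (stereo z) \<partial>\<mu>)\<bar> \<le> d / m * measure \<mu> UNIV"
      if i: "integrable \<mu> (\<lambda>z. g (stereo z))" "integrable \<mu> (\<lambda>z. f (stereo z))" and fm: "finite_measure \<mu>"
        and s: "space \<mu> = UNIV" for \<mu>
    proof -
      interpret finite_measure \<mu> by fact
      have "\<bar>(\<integral>z. g (stereo z) \<partial>\<mu>) - (\<integral>z. f (stereo z) \<partial>\<mu>)\<bar> = \<bar>\<integral>z. g (stereo z) - f (stereo z) \<partial>\<mu>\<bar>"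
        using i by simp
      also have "\<dots> \<le> (\<integral>z. \<bar>g (stereo z) - f (stereo z)\<bar> \<partial>\<mu>)" by (rule integral_abs_bound)
      also have "\<dots> \<le> (\<integral>z. d / m \<partial>\<mu>)"
        using i f(2)[OF stereo_in] by (intro integral_mono) (auto intro: less_imp_le)
      finally show ?thesis using s by (simp add: mult.commute)
    qed
    have "\<bar>(\<integral>z. g (stereo z) \<partial>\<alpha>) - (\<integral>z. g (stereo z) \<partial>\<beta>)\<bar> \<le> d / m * measure \<alpha> UNIV + d / m * measure \<beta> UNIV"
      using bd[OF ig(1) if'(1) \<alpha>(1) sp(1)] bd[OF ig(2) if'(2) \<beta>(1) sp(2)] if'(3) by linarith
    then have "d \<le> d / m * measure \<alpha> UNIV + d / m * measure \<beta> UNIV"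
      by (simp only: d_def[symmetric])
    also have "\<dots> = d / m * (m - 1)"
    proof -
      have "m - 1 = measure \<alpha> UNIV + measure \<beta> UNIV" by (simp add: m_def)
      then show ?thesis by (simp only: distrib_left)
    qed
    also have "\<dots> < d" using dm by (simp add: field_simps)
    finally show False by simp
  qed
  have cpt: "measure \<alpha> S = measure \<beta> S" if S: "compact S" for S
  proof (cases "S = {}")
    case False
    define T where "T = stereo ` S"
    have T: "closed T" "T \<noteq> {}"
      using False compact_imp_closed[OF compact_continuous_image[OF continuous_stereo S]] by (auto simp: T_def)
    define g where "g n p = max 0 (1 - real n * infdist p T)" for n p
    have gc: "continuous_on UNIV (g n)" for n
      unfolding g_def by (intro continuous_intros)
    have [measurable]: "g n \<in> borel_measurable borel" for n
      by (rule borel_measurable_continuous_onI[OF gc])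
    have [measurable]: "S \<in> sets borel" using S by (simp add: compact_imp_closed)
    have g01: "\<bar>g n p\<bar> \<le> 1" for n p by (auto simp: g_def infdist_nonneg)
    have lim: "(\<lambda>n. g n (stereo z)) \<longlonglongrightarrow> indicator S z" for z
    proof (cases "z \<in> S")
      case True
      then have "infdist (stereo z) T = 0" by (simp add: T_def)
      then show ?thesis using True by (simp add: g_def)
    next
      case False
      then have "stereo z \<notin> T" using inj_stereo by (auto simp: T_def inj_def)
      then have pos: "infdist (stereo z) T > 0" using T by (simp add: infdist_pos_not_in_closed)
      obtain N where N: "real N * infdist (stereo z) T > 1"
        using reals_Archimedean3[OF pos] by blast
      have "g n (stereo z) = 0" if "n \<ge> N" for n
      proof -
        have "real N * infdist (stereo z) T \<le> real n * infdist (stereo z) T"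
          using that pos by (intro mult_right_mono) auto
        then show ?thesis using N by (simp add: g_def)
      qed
      then have "\<forall>\<^sub>F n in sequentially. g n (stereo z) = 0"
        by (auto simp: eventually_sequentially)
      then show ?thesis using False by (simp add: tendsto_eventually)
    qed
    have "(\<lambda>n. \<integral>z. g n (stereo z) \<partial>\<alpha>) \<longlonglongrightarrow> (\<integral>z. indicator S z \<partial>\<alpha>)"
      by (rule integral_dominated_convergence[where w="\<lambda>_. 1"]) (use lim g01 in auto)
    moreover have "(\<lambda>n. \<integral>z. g n (stereo z) \<partial>\<beta>) \<longlonglongrightarrow> (\<integral>z. indicator S z \<partial>\<beta>)"
      by (rule integral_dominated_convergence[where w="\<lambda>_. 1"]) (use lim g01 in auto)
    ultimately have "(\<integral>z. indicator S z \<partial>\<alpha>) = (\<integral>z. indicator S z \<partial>\<beta> :: real)"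
      unfolding int_eq[OF gc] by (rule LIMSEQ_unique)
    then show ?thesis using sp by simp
  qed simp
  have clsd: "measure \<alpha> F = measure \<beta> F" if F: "closed F" for F
  proof -
    have U: "(\<Union>n::nat. F \<inter> cball 0 (real n)) = F"
      using real_arch_simple by (auto simp: mem_cball dist_norm)
    have inc: "incseq (\<lambda>n::nat. F \<inter> cball 0 (real n))"
      by (intro monoI) auto
    have rng: "range (\<lambda>n::nat. F \<inter> cball 0 (real n)) \<subseteq> sets borel"
      using F by auto
    have "(\<lambda>n::nat. measure \<alpha> (F \<inter> cball 0 (real n))) \<longlonglongrightarrow> measure \<alpha> F"
      using A.finite_Lim_measure_incseq[OF _ inc] rng \<alpha>(2) U by simp
    moreover have "(\<lambda>n::nat. measure \<beta> (F \<inter> cball 0 (real n))) \<longlonglongrightarrow> measure \<beta> F"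
      using B.finite_Lim_measure_incseq[OF _ inc] rng \<beta>(2) U by simp
    moreover have "measure \<alpha> (F \<inter> cball 0 (real n)) = measure \<beta> (F \<inter> cball 0 (real n))" for n
      using F by (intro cpt closed_Int_compact) auto
    ultimately show ?thesis using LIMSEQ_unique by auto
  qed
  show ?thesis
  proof (rule measure_eqI_generator_eq[where \<Omega>=UNIV and E="{F. closed F}" and A="\<lambda>_. UNIV"])
    show "emeasure \<alpha> X = emeasure \<beta> X" if "X \<in> {F. closed F}" for X
      using clsd that by (simp add: A.emeasure_eq_measure B.emeasure_eq_measure)
  qed (auto simp: Int_stable_def \<alpha>(2) \<beta>(2) borel_eq_closed)
qed

definition log_energy2 :: "complex measure \<Rightarrow> complex measure \<Rightarrow> ennreal" where
  "log_energy2 \<alpha> \<beta> = (\<integral>\<^sup>+z. (\<integral>\<^sup>+w. log_kernel z w \<partial>\<beta>) \<partial>\<alpha>)"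

text \<open>Tonelli for the series and both integrals. Finiteness turns the sum in
  \<open>ennreal\<close> into a convergent real series, so that such series can be combined with
  signs.\<close>

lemma log_energy2_sums:
  assumes \<alpha>: "finite_measure \<alpha>" "sets \<alpha> = sets borel" and \<beta>: "finite_measure \<beta>" "sets \<beta> = sets borel"
    and fin: "log_energy2 \<alpha> \<beta> < \<infinity>"
  shows "(\<lambda>k. sph_energy (Suc k) \<alpha> \<beta> / real (Suc k)) sums enn2real (log_energy2 \<alpha> \<beta>)"
proof -
  interpret A: finite_measure \<alpha> by fact
  interpret B: finite_measure \<beta> by fact
  note [measurable_cong] = \<alpha>(2) \<beta>(2)
  have pw: "sph_kernel z w ^ k \<le> 1" for z w k
    using power_le_one[OF sph_kernel_nonneg sph_kernel_le_1] .
  have i1: "integrable \<beta> (\<lambda>w. sph_kernel z w ^ k)" for z k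
    using pw by (intro B.integrable_const_bound[of _ 1]) auto
  have n1: "(\<integral>\<^sup>+w. ennreal (sph_kernel z w ^ Suc k / real (Suc k)) \<partial>\<beta>) =
      ennreal ((\<integral>w. sph_kernel z w ^ Suc k \<partial>\<beta>) / real (Suc k))" for z k
    using i1[of z "Suc k"] by (subst nn_integral_eq_integral) (auto simp del: power_Suc)
  have b: "0 \<le> (\<integral>w. sph_kernel z w ^ Suc k \<partial>\<beta>)" "(\<integral>w. sph_kernel z w ^ Suc k \<partial>\<beta>) \<le> measure \<beta> (space \<beta>)" for z k
    using integral_mono[OF i1[of z "Suc k"] B.integrable_const[of 1]] pw by (auto simp del: power_Suc)
  have i2: "integrable \<alpha> (\<lambda>z. \<integral>w. sph_kernel z w ^ Suc k \<partial>\<beta>)" for k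
    by (rule A.integrable_const_bound[of _ "measure \<beta> (space \<beta>)"]) (use b in \<open>auto simp del: power_Suc\<close>)
  have n2: "(\<integral>\<^sup>+z. ennreal ((\<integral>w. sph_kernel z w ^ Suc k \<partial>\<beta>) / real (Suc k)) \<partial>\<alpha>) =
      ennreal (sph_energy (Suc k) \<alpha> \<beta> / real (Suc k))" for k
    using i2[of k] b by (subst nn_integral_eq_integral) (auto simp: sph_energy_def simp del: power_Suc)
  have "log_energy2 \<alpha> \<beta> = (\<integral>\<^sup>+z. (\<Sum>k. \<integral>\<^sup>+w. ennreal (sph_kernel z w ^ Suc k / real (Suc k)) \<partial>\<beta>) \<partial>\<alpha>)"
    unfolding log_energy2_def log_kernel_def
    by (intro nn_integral_cong nn_integral_suminf) measurable
  also have "\<dots> = (\<Sum>k. \<integral>\<^sup>+z. ennreal ((\<integral>w. sph_kernel z w ^ Suc k \<partial>\<beta>) / real (Suc k)) \<partial>\<alpha>)"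
    unfolding n1 by (intro nn_integral_suminf) measurable
  also have "\<dots> = (\<Sum>k. ennreal (sph_energy (Suc k) \<alpha> \<beta> / real (Suc k)))"
    unfolding n2 ..
  finally have eq: "log_energy2 \<alpha> \<beta> = (\<Sum>k. ennreal (sph_energy (Suc k) \<alpha> \<beta> / real (Suc k)))" .
  have nn: "sph_energy (Suc k) \<alpha> \<beta> / real (Suc k) \<ge> 0" for k
    using b by (simp add: sph_energy_def integral_nonneg_AE del: power_Suc)
  have sm: "summable (\<lambda>k. sph_energy (Suc k) \<alpha> \<beta> / real (Suc k))"
    using fin nn by (intro summable_suminf_not_top) (auto simp: eq)
  then show ?thesis
    unfolding eq using nn suminf_nonneg[OF sm nn] by (subst suminf_ennreal2) (auto simp: sums_iff)
qed

text \<open>By \<open>sph_energy_diff\<close>, \<open>D\<close> is a series of weighted sums of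
  squares of moment differences; if it vanishes, all moments of level at least 1 agree. Finiteness
  matters because \<open>enn2real\<close> sends infinity to 0.\<close>

theorem log_energy2_positive_definite:
  assumes \<alpha>: "finite_measure \<alpha>" "sets \<alpha> = sets borel" and \<beta>: "finite_measure \<beta>" "sets \<beta> = sets borel"
    and fin: "log_energy2 \<alpha> \<alpha> < \<infinity>" "log_energy2 \<alpha> \<beta> < \<infinity>" "log_energy2 \<beta> \<beta> < \<infinity>"
  defines "D \<equiv> enn2real (log_energy2 \<alpha> \<alpha>) - 2 * enn2real (log_energy2 \<alpha> \<beta>) + enn2real (log_energy2 \<beta> \<beta>)"
  shows "D \<ge> 0" and "D = 0 \<Longrightarrow> \<alpha> = \<beta>"
proof -
  define d where "d k = (sph_energy (Suc k) \<alpha> \<alpha> - 2 * sph_energy (Suc k) \<alpha> \<beta> + sph_energy (Suc k) \<beta> \<beta>) / real (Suc k)" for k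
  have S: "d sums D"
  proof -
    have "(\<lambda>k. sph_energy (Suc k) \<alpha> \<alpha> / real (Suc k) - 2 * (sph_energy (Suc k) \<alpha> \<beta> / real (Suc k))
        + sph_energy (Suc k) \<beta> \<beta> / real (Suc k)) sums D"
      unfolding D_def by (intro sums_add sums_diff sums_mult log_energy2_sums \<alpha> \<beta> fin)
    then show ?thesis by (simp add: d_def[abs_def] add_divide_distrib diff_divide_distrib)
  qed
  have d0: "d k \<ge> 0" for k
    unfolding d_def sph_energy_diff[OF \<alpha> \<beta>] by (intro divide_nonneg_nonneg sum_nonneg) auto
  show "D \<ge> 0" using S d0 by (metis sums_iff suminf_nonneg)
  assume "D = 0"
  then have dz: "d k = 0" for k
    using S d0 suminf_eq_zero_iff[of d] by (auto simp: sums_iff)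
  show "\<alpha> = \<beta>"
  proof (rule sph_moments_determine_measure[OF \<alpha> \<beta>])
    fix k a b :: nat assume k: "k \<ge> 1" "a \<le> k" "b \<le> k"
    then obtain k' where k': "k = Suc k'" by (cases k) auto
    have "(\<Sum>a\<le>k. \<Sum>b\<le>k. real (k choose a) * real (k choose b) * (cmod (sph_moment \<alpha> k a b - sph_moment \<beta> k a b))\<^sup>2) = 0"
      using dz[of k'] sph_energy_diff[OF \<alpha> \<beta>, of k] by (simp add: d_def k')
    then have "(\<Sum>b\<le>k. real (k choose a) * real (k choose b) * (cmod (sph_moment \<alpha> k a b - sph_moment \<beta> k a b))\<^sup>2) = 0"
      using k by (subst (asm) sum_nonneg_eq_0_iff) (auto intro!: sum_nonneg)
    then have "real (k choose a) * real (k choose b) * (cmod (sph_moment \<alpha> k a b - sph_moment \<beta> k a b))\<^sup>2 = 0"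
      using k by (subst (asm) sum_nonneg_eq_0_iff) auto
    then show "sph_moment \<alpha> k a b = sph_moment \<beta> k a b"
      using k by (simp add: binomial_eq_0_iff)
  qed
qed

section \<open>The Green function of a regular compact set\<close>

text \<open>\<open>bernstein_walsh\<close> and \<open>V_approx\<close> are the two halves of the
  supremum defining the Green function. In exponential form they need no convention for the
  logarithm at zeros of \<open>p\<close>.\<close>

locale green_setup =
  fixes K :: "complex set" and V :: "complex \<Rightarrow> real"
  assumes compact_K: "compact K" and infinite_K: "infinite K"
    and continuous_V: "continuous_on UNIV V"
    and V_nonneg: "\<And>z. V z \<ge> 0"
    and bernstein_walsh: "\<And>A p z. 0 < A \<Longrightarrow> (\<And>w. w \<in> K \<Longrightarrow> cmod (poly p w) \<le> A) \<Longrightarrow>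
      cmod (poly p z) \<le> A * exp (real (degree p) * V z)"
    and V_approx: "\<And>\<epsilon> z. \<epsilon> > 0 \<Longrightarrow> \<exists>p. degree p > 0 \<and> (\<forall>w\<in>K. cmod (poly p w) \<le> 1) \<and>
      exp (real (degree p) * (V z - \<epsilon>)) \<le> cmod (poly p z)"

lemma ereal_elog_divide:
  assumes "d > 0"
  shows "elog x / ereal d = (if x = 0 then -\<infinity> else ereal (ln x / d))"
  using assms by (auto simp: elog_def divide_ereal_def divide_inverse)

lemma regular_set_green_setup:
  assumes K: "compact K" and reg: "regular_set K"
  shows "green_setup K (\<lambda>z. real_of_ereal (green_function K z))"
proof -
  define V where "V z = real_of_ereal (green_function K z)" for z
  have fin: "\<bar>green_function K z\<bar> \<noteq> \<infinity>" for z
    using reg by (auto simp: regular_set_def)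
  have G: "green_function K z = ereal (V z)" for z
    using fin[of z] by (simp add: V_def ereal_real')
  have le: "ln (cmod (poly p z)) \<le> real (degree p) * V z"
    if "degree p > 0" "\<And>w. w \<in> K \<Longrightarrow> cmod (poly p w) \<le> 1" "poly p z \<noteq> 0" for p z
  proof -
    have "elog (cmod (poly p z)) / ereal (real (degree p)) \<le> green_function K z"
      unfolding green_function_def by (rule SUP_upper) (use that in auto)
    then have "ln (cmod (poly p z)) / real (degree p) \<le> V z"
      using that by (simp add: G ereal_elog_divide)
    then show ?thesis using that by (simp add: divide_le_eq mult.commute)
  qed
  have cont: "continuous_on UNIV V"
  proof -
    have "continuous_on UNIV (green_function K)" using reg by (simp add: regular_set_def)
    then show ?thesis
      unfolding V_def by (rule continuous_on_compose2[OF continuous_on_real]) (auto simp: G)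
  qed
  \<comment> \<open>If \<open>K\<close> were finite, some nonzero polynomial would vanish on it, all
    multiples would be admissible, and the Green function would be infinite wherever that polynomial
    is nonzero.\<close>
  have infK: "infinite K"
  proof
    assume "finite K"
    then obtain z0 where z0: "z0 \<notin> K"
      using infinite_UNIV_char_0[where 'a=complex] by (metis UNIV_I finite_subset subsetI)
    \<comment> \<open>The extra linear factor equals -1 at \<open>z0\<close> and keeps the degree
      positive even for empty \<open>K\<close>.\<close>
    define p where "p = [:-(z0 + 1), 1:] * (\<Prod>w\<in>K. [:-w, 1:])"
    have dp: "degree p = card K + 1"
      unfolding p_def using \<open>finite K\<close>
      by (subst degree_mult_eq) (auto simp: degree_prod_eq_sum_degree)
    have "poly p z0 = - (\<Prod>w\<in>K. z0 - w)" unfolding p_def by (simp add: poly_prod algebra_simps)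
    then have p0: "poly p z0 \<noteq> 0" using z0 \<open>finite K\<close> by auto
    have pK: "poly p w = 0" if "w \<in> K" for w
    proof -
      have "(\<Prod>x\<in>K. w - x) = 0" using that \<open>finite K\<close> by (intro prod_zero) auto
      then show ?thesis by (simp add: p_def poly_prod)
    qed
    define c where "c = exp (real (degree p) * (V z0 + 1)) / cmod (poly p z0)"
    have c: "c > 0" using p0 by (simp add: c_def)
    have "ln (cmod (poly (smult (of_real c) p) z0)) \<le> real (degree (smult (complex_of_real c) p)) * V z0"
      by (rule le) (use dp pK p0 c in auto)
    moreover have "cmod (poly (smult (of_real c) p) z0) = exp (real (degree p) * (V z0 + 1))"
      using c by (simp only: poly_smult norm_mult norm_of_real abs_of_pos) (simp add: c_def p0)
    ultimately have "real (degree p) * (V z0 + 1) \<le> real (degree p) * V z0"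
      using c by simp
    then show False using dp by (simp add: algebra_simps)
  qed
  have neK: "K \<noteq> {}" using infK by auto
  have "green_setup K V"
  proof
    show "compact K" "infinite K" "continuous_on UNIV V" by fact+
    fix z
    show "V z \<ge> 0"
    proof (rule field_le_epsilon)
      fix e :: real assume e: "e > 0"
      obtain B where B: "B > 0" "\<And>w. w \<in> K \<Longrightarrow> cmod w \<le> B"
        using compact_imp_bounded[OF K] by (auto simp: bounded_pos)
      \<comment> \<open>Constants are not admissible in the supremum, so 1 is approximated by
        \<open>1 - \<eta> + \<eta> * w / B\<close>, which is bounded by 1 on \<open>K\<close>. This
        \<open>\<eta>\<close> makes the lower bound for the modulus at \<open>z\<close> equal to
        \<open>exp (- e)\<close>.\<close>
      define \<eta> where "\<eta> = (1 - exp (-e)) / (1 + cmod z / B)"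
      have pos: "1 + cmod z / B > 0" using B by (simp add: add_pos_nonneg)
      have "1 - exp (-e) < 1 * (1 + cmod z / B)" using B by (simp add: less_add_iff1 add_pos_nonneg order_less_le_trans[of _ 1])
      then have \<eta>: "0 < \<eta>" "\<eta> < 1" using e pos by (simp_all add: \<eta>_def field_simps)
      define p where "p = [:complex_of_real (1 - \<eta>), complex_of_real (\<eta> / B):]"
      have tri: "cmod u - cmod (v * z) \<le> cmod (poly [:u, v:] z)"
        "cmod (poly [:u, v:] z) \<le> cmod u + cmod (v * z)" for u v z :: complex
        using norm_diff_ineq[of u "v * z"] norm_triangle_ineq[of u "v * z"] by (simp_all add: mult.commute)
      have "cmod (complex_of_real (1 - \<eta>)) - cmod (complex_of_real (\<eta> / B) * z) \<le> cmod (poly p z)"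
        unfolding p_def by (rule tri)
      moreover have "cmod (complex_of_real (1 - \<eta>)) = 1 - \<eta>" using \<eta> by (simp only: norm_of_real)
      moreover have "cmod (complex_of_real (\<eta> / B) * z) = \<eta> / B * cmod z" using \<eta> B by (simp only: norm_mult norm_of_real) simp
      moreover have "1 - \<eta> - \<eta> / B * cmod z = 1 - \<eta> * (1 + cmod z / B)" by (simp add: algebra_simps)
      moreover have "\<eta> * (1 + cmod z / B) = 1 - exp (-e)" using pos by (simp add: \<eta>_def)
      ultimately have lo: "cmod (poly p z) \<ge> exp (-e)" by simp
      then have nz: "poly p z \<noteq> 0" by (metis exp_gt_zero norm_zero not_le)
      have "ln (cmod (poly p z)) \<le> real (degree p) * V z"
      proof (rule le[OF _ _ nz])
        show "degree p > 0" using \<eta> B by (simp add: p_def)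
        fix w assume w: "w \<in> K"
        have "cmod (poly p w) \<le> cmod (complex_of_real (1 - \<eta>)) + cmod (complex_of_real (\<eta> / B) * w)"
          unfolding p_def by (rule tri)
        also have "\<dots> = (1 - \<eta>) + \<eta> / B * cmod w" using \<eta> B by (simp only: norm_mult norm_of_real) simp
        also have "\<dots> \<le> (1 - \<eta>) + \<eta> / B * B" using \<eta> B w by (intro add_left_mono mult_left_mono) auto
        finally show "cmod (poly p w) \<le> 1" using B by simp
      qed
      moreover have "degree p = 1" using \<eta> B by (simp add: p_def)
      moreover have "ln (cmod (poly p z)) \<ge> ln (exp (-e))" using lo nz by (intro ln_mono) auto
      ultimately show "0 \<le> V z + e" by simp
    qed
  next
    fix A :: real and p z assume A: "0 < A" and pK: "\<And>w. w \<in> K \<Longrightarrow> cmod (poly p w) \<le> A"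
    show "cmod (poly p z) \<le> A * exp (real (degree p) * V z)"
    proof (cases "degree p = 0")
      case True
      then obtain c where "p = [:c:]" by (metis degree_eq_zeroE)
      then show ?thesis using pK neK by auto
    next
      case False
      show ?thesis
      proof (cases "poly p z = 0")
        case True then show ?thesis using A by simp
      next
        case nz: False
        define q where "q = smult (of_real (1 / A)) p"
        have "ln (cmod (poly q z)) \<le> real (degree q) * V z"
          by (rule le) (use False nz A pK in \<open>auto simp: q_def norm_divide norm_mult divide_le_eq\<close>)
        then have "ln (cmod (poly p z) / A) \<le> real (degree p) * V z"
          using A by (simp add: q_def norm_divide norm_mult)
        then have "cmod (poly p z) / A \<le> exp (real (degree p) * V z)"
        proof -
          assume "ln (cmod (poly p z) / A) \<le> real (degree p) * V z"
          then have "exp (ln (cmod (poly p z) / A)) \<le> exp (real (degree p) * V z)"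
            by (simp only: exp_le_cancel_iff)
          then show ?thesis using nz A by simp
        qed
        then show ?thesis using A by (simp add: divide_le_eq mult.commute)
      qed
    qed
  next
    fix \<epsilon> :: real and z assume "\<epsilon> > 0"
    then have "ereal (V z - \<epsilon>) < green_function K z" by (simp add: G)
    then obtain p where p: "degree p > 0" "\<forall>w\<in>K. cmod (poly p w) \<le> 1"
      and lt: "ereal (V z - \<epsilon>) < elog (cmod (poly p z)) / ereal (real (degree p))"
      unfolding green_function_def less_SUP_iff by auto
    have nz: "poly p z \<noteq> 0" using lt p by (auto simp: ereal_elog_divide)
    then have "V z - \<epsilon> < ln (cmod (poly p z)) / real (degree p)"
      using lt p by (simp add: ereal_elog_divide)
    then have "real (degree p) * (V z - \<epsilon>) < ln (cmod (poly p z))"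
      using p by (simp add: less_divide_eq mult.commute)
    then have "exp (real (degree p) * (V z - \<epsilon>)) \<le> cmod (poly p z)"
      using nz by (metis exp_le_cancel_iff exp_ln less_imp_le zero_less_norm_iff)
    then show "\<exists>p. degree p > 0 \<and> (\<forall>w\<in>K. cmod (poly p w) \<le> 1) \<and>
      exp (real (degree p) * (V z - \<epsilon>)) \<le> cmod (poly p z)" using p by blast
  qed
  then show ?thesis by (simp add: V_def[abs_def])
qed

context green_setup
begin

section \<open>Extremal points and extremal polynomials\<close>

lemma V_on_K: "z \<in> K \<Longrightarrow> V z = 0"
proof (rule antisym[OF field_le_epsilon V_nonneg])
  fix e :: real assume z: "z \<in> K" and e: "e > 0"
  obtain p where p: "degree p > 0" "\<forall>w\<in>K. cmod (poly p w) \<le> 1" "exp (real (degree p) * (V z - e)) \<le> cmod (poly p z)"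
    using V_approx[OF e] by blast
  then have "exp (real (degree p) * (V z - e)) \<le> exp 0" using z by (metis exp_zero order_trans)
  then have "real (degree p) * (V z - e) \<le> 0" by (simp only: exp_le_cancel_iff)
  then show "V z \<le> 0 + e" using p(1) by (simp add: mult_le_0_iff)
qed

lemma K_nonempty: "K \<noteq> {}"
  using infinite_K by auto

lemma poly_nonzero_on_K:
  assumes "p \<noteq> 0" shows "\<exists>w\<in>K. poly p w \<noteq> 0"
proof (rule ccontr)
  assume "\<not> ?thesis"
  then have "K \<subseteq> {z. poly p z = 0}" by auto
  then show False using infinite_K poly_roots_finite[OF assms] finite_subset by blast
qed

text \<open>Lower bounds for node polynomials hold away from the set carrying the nodes, but are
  needed on a dense set, while \<open>K\<close> may have interior. The nodes are therefore confined
  to a closed set without interior on which maxima of polynomials over \<open>K\<close> are still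
  attained.\<close>

definition fekete_domain :: "complex set" where
  "fekete_domain = K \<inter> frontier {z. V z = 0}"

lemma closed_V_zero: "closed {z. V z = 0}"
  by (intro closed_Collect_eq continuous_V continuous_intros)

lemma fekete_domain_closed: "closed fekete_domain"
  unfolding fekete_domain_def using compact_K compact_imp_closed by auto

lemma fekete_domain_interior: "closure (- fekete_domain) = UNIV"
proof -
  have "interior (frontier {z. V z = 0}) = {}"
  proof -
    have "interior (frontier {z. V z = 0}) \<subseteq> interior {z. V z = 0}"
      by (intro interior_mono frontier_subset_closed closed_V_zero)
    moreover have "interior (frontier {z. V z = 0}) \<inter> interior {z. V z = 0} = {}"
      using interior_subset[of "frontier {z. V z = 0}"] by (auto simp: frontier_def)
    ultimately show ?thesis by blast
  qed
  then have "interior fekete_domain = {}"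
    unfolding fekete_domain_def by (metis Int_lower2 interior_mono subset_empty)
  then show ?thesis by (simp add: closure_complement)
qed

text \<open>By Bernstein-Walsh a maximum over \<open>K\<close> is a maximum over the whole zero set
  of \<open>V\<close>. At an interior point of that set the maximum modulus principle would make
  \<open>p\<close> constant.\<close>

lemma max_on_fekete_domain:
  assumes "degree p > 0"
  shows "\<exists>w\<in>fekete_domain. \<forall>x\<in>K. cmod (poly p x) \<le> cmod (poly p w)"
proof -
  have "continuous_on K (\<lambda>x. cmod (poly p x))" by (intro continuous_intros)
  then obtain w where w: "w \<in> K" "\<forall>x\<in>K. cmod (poly p x) \<le> cmod (poly p w)"
    using continuous_attains_sup[OF compact_K K_nonempty] by blast
  have "p \<noteq> 0" using assms by auto
  then have A: "cmod (poly p w) > 0"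
    using poly_nonzero_on_K[of p] w by (meson less_le_trans zero_less_norm_iff)
  have Z: "cmod (poly p z) \<le> cmod (poly p w)" if "V z = 0" for z
    using bernstein_walsh[OF A, of p z] w that by simp
  have "w \<notin> interior {z. V z = 0}"
  proof
    assume wi: "w \<in> interior {z. V z = 0}"
    have "poly p constant_on UNIV"
    proof (rule maximum_modulus_principle[where U="interior {z. V z = 0}" and \<xi>=w])
      show "poly p holomorphic_on UNIV" by (intro holomorphic_intros)
      show "cmod (poly p z) \<le> cmod (poly p w)" if "z \<in> interior {z. V z = 0}" for z
        using Z that interior_subset by blast
    qed (use wi in auto)
    then obtain c where "\<And>x. poly p x = c" by (auto simp: constant_on_def)
    then have "p = [:c:]" by (intro poly_eqI_degree[of UNIV] poly_ext) simp
    then show False using assms by simp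
  qed
  then have "w \<in> frontier {z. V z = 0}"
    using V_on_K[OF w(1)] by (simp add: frontier_def closure_closed[OF closed_V_zero])
  then show ?thesis using w by (auto simp: fekete_domain_def)
qed

lemma bound_from_fekete_domain:
  assumes "\<And>x. x \<in> fekete_domain \<Longrightarrow> cmod (poly p x) \<le> A" "x \<in> K"
  shows "cmod (poly p x) \<le> A"
proof (cases "degree p > 0")
  case True
  then show ?thesis using max_on_fekete_domain assms by (meson order_trans)
next
  case False
  then obtain c where c: "p = [:c:]" by (metis degree_eq_zeroE gr0I)
  obtain w where "w \<in> fekete_domain" using max_on_fekete_domain[of "[:0, 1:]"] by auto
  then show ?thesis using assms(1)[of w] c by simp
qed

text \<open>Otherwise the polynomial with these zeros would be bounded by 0 on \<open>K\<close>,
  hence vanish on an infinite set.\<close>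

lemma infinite_fekete_domain: "infinite fekete_domain"
proof
  assume fin: "finite fekete_domain"
  define p where "p = (\<Prod>w\<in>fekete_domain. [:-w, 1:])"
  have "p \<noteq> 0" using fin by (simp add: p_def)
  moreover have "poly p x = 0" if "x \<in> K" for x
  proof -
    have "cmod (poly p x) \<le> 0"
      by (rule bound_from_fekete_domain[OF _ that]) (use fin in \<open>auto simp: p_def poly_prod\<close>)
    then show ?thesis by simp
  qed
  ultimately show False using poly_nonzero_on_K by blast
qed

text \<open>Over ordered pairs, so this is the square of the modulus of the Vandermonde determinant: points
  within a factor 4 of its supremum have Lagrange polynomials bounded by 2 on \<open>K\<close>.\<close>

definition vdm :: "complex set \<Rightarrow> real" where
  "vdm W = (\<Prod>a\<in>W. \<Prod>b\<in>W - {a}. cmod (a - b))"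

lemma vdm_insert:
  assumes "finite B" "x \<notin> B"
  shows "vdm (insert x B) = vdm B * (\<Prod>b\<in>B. cmod (x - b))\<^sup>2"
proof -
  have "(\<Prod>b\<in>insert x B - {a}. cmod (a - b)) = cmod (x - a) * (\<Prod>b\<in>B - {a}. cmod (a - b))" if "a \<in> B" for a
  proof -
    have "insert x B - {a} = insert x (B - {a})" using assms that by auto
    then show ?thesis using assms by (simp add: norm_minus_commute)
  qed
  moreover have "insert x B - {x} = B" using assms by auto
  ultimately show ?thesis
    using assms by (simp add: vdm_def prod.distrib power2_eq_square)
qed

lemma vdm_pos: "finite W \<Longrightarrow> vdm W > 0"
  unfolding vdm_def by (intro prod_pos) auto

lemma near_fekete_points:
  shows "\<exists>W\<subseteq>fekete_domain. finite W \<and> card W = n \<and>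
    (\<forall>a\<in>W. \<forall>x\<in>K. (\<Prod>b\<in>W - {a}. cmod (x - b)) \<le> 2 * (\<Prod>b\<in>W - {a}. cmod (a - b)))"
proof -
  obtain R where R: "R > 0" "\<And>x. x \<in> K \<Longrightarrow> cmod x \<le> R"
    using compact_imp_bounded[OF compact_K] by (auto simp: bounded_pos)
  define S where "S = {vdm W | W. W \<subseteq> fekete_domain \<and> finite W \<and> card W = n}"
  have "\<exists>W. finite W \<and> card W = n \<and> W \<subseteq> fekete_domain"
    by (rule infinite_arbitrarily_large[OF infinite_fekete_domain])
  then obtain W0 where W0: "finite W0" "card W0 = n" "W0 \<subseteq> fekete_domain" by blast
  have bdd: "bdd_above S"
  proof (rule bdd_aboveI)
    fix e assume "e \<in> S"
    then obtain W where W: "W \<subseteq> fekete_domain" "finite W" "card W = n" "e = vdm W" by (auto simp: S_def)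
    have "vdm W \<le> (\<Prod>a\<in>W. \<Prod>b\<in>W - {a}. 2 * R)"
      unfolding vdm_def
    proof (intro prod_mono conjI prod_nonneg)
      fix a b assume "a \<in> W" "b \<in> W - {a}"
      then have "a \<in> K" "b \<in> K" using W by (auto simp: fekete_domain_def)
      then show "cmod (a - b) \<le> 2 * R" using R(2)[of a] R(2)[of b] norm_triangle_ineq4[of a b] by simp
    qed auto
    also have "\<dots> = ((2 * R) ^ (n - 1)) ^ n" using W by simp
    finally show "e \<le> ((2 * R) ^ (n - 1)) ^ n" using W by simp
  qed
  have inS: "vdm W0 \<in> S" using W0 by (auto simp: S_def)
  have sup: "Sup S > 0" using cSup_upper[OF inS bdd] vdm_pos[OF W0(1)] by simp
  then have "Sup S / 4 < Sup S" by simp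
  then obtain e where "e \<in> S" "Sup S / 4 < e" using less_cSup_iff[OF _ bdd] inS by blast
  then obtain W where W: "W \<subseteq> fekete_domain" "finite W" "card W = n" "Sup S / 4 < vdm W" by (auto simp: S_def)
  have "(\<Prod>b\<in>W - {a}. cmod (x - b)) \<le> 2 * (\<Prod>b\<in>W - {a}. cmod (a - b))"
    if a: "a \<in> W" and x: "x \<in> fekete_domain" for a x
  proof (cases "x \<in> W - {a}")
    case True
    then have "(\<Prod>b\<in>W - {a}. cmod (x - b)) = 0" using W by (intro prod_zero) auto
    then show ?thesis by (simp add: prod_nonneg)
  next
    case False
    \<comment> \<open>Exchanging the node \<open>a\<close> for \<open>x\<close> multiplies
      \<open>vdm\<close> by the square of a ratio of products, so being within a factor 4 of the
      supremum gives the factor 2.\<close>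
    define B where "B = W - {a}"
    have B: "finite B" "a \<notin> B" "x \<notin> B" "W = insert a B" using W a False by (auto simp: B_def)
    have "card (insert x B) = n" using B W by (metis card_insert_disjoint)
    then have "vdm (insert x B) \<in> S" using W x B by (auto simp: S_def)
    then have "vdm (insert x B) \<le> Sup S" by (rule cSup_upper[OF _ bdd])
    also have "\<dots> \<le> 4 * vdm W" using W by simp
    finally have "vdm B * (\<Prod>b\<in>B. cmod (x - b))\<^sup>2 \<le> vdm B * (4 * (\<Prod>b\<in>B. cmod (a - b))\<^sup>2)"
      using B vdm_insert[of B x] vdm_insert[of B a] by (simp add: mult_ac)
    then have "(\<Prod>b\<in>B. cmod (x - b))\<^sup>2 \<le> (2 * (\<Prod>b\<in>B. cmod (a - b)))\<^sup>2"
      using vdm_pos[OF B(1)] by (simp add: power_mult_distrib)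
    then show ?thesis
      unfolding B_def[symmetric] by (rule power2_le_imp_le) (simp add: prod_nonneg)
  qed
  \<comment> \<open>For fixed \<open>a\<close> the left side is the modulus of a polynomial in
    \<open>x\<close>, so the bound passes from \<open>fekete_domain\<close> to
    \<open>K\<close>.\<close>
  then have "(\<Prod>b\<in>W - {a}. cmod (x - b)) \<le> 2 * (\<Prod>b\<in>W - {a}. cmod (a - b))"
    if a: "a \<in> W" and x: "x \<in> K" for a x
    using bound_from_fekete_domain[of "\<Prod>b\<in>W - {a}. [:-b, 1:]" "2 * (\<Prod>b\<in>W - {a}. cmod (a - b))" x] that
    by (simp add: poly_prod prod_norm)
  then show ?thesis using W by blast
qed

text \<open>The node polynomial is divided by its maximum over \<open>K\<close>, so Bernstein-Walsh
  gives the upper bound. For the lower one, Lagrange interpolation expresses \<open>p\<close>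
  through the quotients of the node polynomial by its linear factors; the loss is only linear in
  \<open>n\<close>.\<close>

lemma fekete_polynomial:
  assumes n: "n > 0"
  shows "\<exists>W c. W \<subseteq> fekete_domain \<and> finite W \<and> card W = n \<and> c \<noteq> 0 \<and>
    (\<forall>z. cmod (poly (smult c (\<Prod>b\<in>W. [:-b, 1:])) z) \<le> exp (real n * V z)) \<and>
    (\<forall>z p. z \<notin> fekete_domain \<longrightarrow> degree p < n \<longrightarrow> (\<forall>x\<in>K. cmod (poly p x) \<le> 1) \<longrightarrow>
      cmod (poly p z) \<le> real n * (2 * diameter K / infdist z fekete_domain) *
         cmod (poly (smult c (\<Prod>b\<in>W. [:-b, 1:])) z))"
proof -
  obtain W where W: "W \<subseteq> fekete_domain" "finite W" "card W = n"
    and L: "\<And>a x. a \<in> W \<Longrightarrow> x \<in> K \<Longrightarrow> (\<Prod>b\<in>W - {a}. cmod (x - b)) \<le> 2 * (\<Prod>b\<in>W - {a}. cmod (a - b))"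
    using near_fekete_points[of n] by blast
  define F where "F = (\<Prod>b\<in>W. [:-b, 1:])"
  have dF: "degree F = n" "F \<noteq> 0" unfolding F_def using W by (auto simp: degree_prod_eq_sum_degree)
  have "continuous_on K (\<lambda>x. cmod (poly F x))" by (intro continuous_intros)
  then obtain w where w: "w \<in> K" "\<forall>x\<in>K. cmod (poly F x) \<le> cmod (poly F w)"
    using continuous_attains_sup[OF compact_K K_nonempty] by blast
  define M where "M = cmod (poly F w)"
  have M: "M > 0" unfolding M_def
    using poly_nonzero_on_K[OF dF(2)] w by (meson less_le_trans zero_less_norm_iff)
  define P where "P a = (\<Prod>b\<in>W - {a}. [:-b, 1:])" for a
  have P: "cmod (poly (P a) x) = (\<Prod>b\<in>W - {a}. cmod (x - b))" for a x
    by (simp add: P_def poly_prod prod_norm)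
  have FP: "poly F x = (x - a) * poly (P a) x" if "a \<in> W" for a x
    using W that by (simp add: F_def P_def prod.remove[of W a] left_diff_distrib)
  \<comment> \<open>Evaluation at the maximum point \<open>w\<close>: the linear factor is at most
    the diameter, the quotient at most twice its value at the node.\<close>
  have Paa: "M \<le> 2 * diameter K * cmod (poly (P a) a)" "poly (P a) a \<noteq> 0" if "a \<in> W" for a
  proof -
    have aK: "a \<in> K" using W that by (auto simp: fekete_domain_def)
    have "M = cmod (w - a) * cmod (poly (P a) w)" unfolding M_def FP[OF that] by (simp add: norm_mult)
    also have "\<dots> \<le> diameter K * (2 * cmod (poly (P a) a))"
      using L[OF that w(1)] diameter_bounded_bound[OF compact_imp_bounded[OF compact_K] w(1) aK]
      by (intro mult_mono)
        (auto simp: P dist_norm prod_nonneg diameter_ge_0[OF compact_imp_bounded[OF compact_K]])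
    finally show "M \<le> 2 * diameter K * cmod (poly (P a) a)" by (simp add: mult_ac)
    show "poly (P a) a \<noteq> 0" unfolding P_def using W by (auto simp: poly_prod)
  qed
  let ?c = "complex_of_real (1 / M)"
  have "cmod (poly (smult ?c F) z) \<le> exp (real n * V z)" for z
    using bernstein_walsh[OF M, of F z] w M by (simp add: M_def[symmetric] norm_mult norm_divide divide_le_eq mult.commute dF)
  moreover have "cmod (poly p z) \<le> real n * (2 * diameter K / infdist z fekete_domain) * cmod (poly (smult ?c F) z)"
    if z: "z \<notin> fekete_domain" and p: "degree p < n" and pK: "\<forall>x\<in>K. cmod (poly p x) \<le> 1" for z p
  proof -
    let ?\<delta> = "infdist z fekete_domain"
    have \<delta>: "?\<delta> > 0"
      using z fekete_domain_closed infinite_fekete_domain by (intro infdist_pos_not_in_closed) auto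
    have "p = (\<Sum>a\<in>W. smult (poly p a / poly (P a) a) (P a))"
    proof (rule poly_eqI_degree[of W])
      fix x assume x: "x \<in> W"
      have "poly (\<Sum>a\<in>W. smult (poly p a / poly (P a) a) (P a)) x = (\<Sum>a\<in>W. poly p a / poly (P a) a * poly (P a) x)"
        by (simp add: poly_sum)
      also have "\<dots> = (\<Sum>a\<in>W. if a = x then poly p x else 0)"
      proof (rule sum.cong[OF refl])
        fix a assume a: "a \<in> W"
        show "poly p a / poly (P a) a * poly (P a) x = (if a = x then poly p x else 0)"
        proof (cases "a = x")
          case False
          then have "poly (P a) x = 0" using x W by (auto simp: P_def poly_prod)
          then show ?thesis using False by simp
        qed (use Paa(2)[OF a] in simp)
      qed
      also have "\<dots> = poly p x" using x W by simp
      finally show "poly p x = poly (\<Sum>a\<in>W. smult (poly p a / poly (P a) a) (P a)) x" by simp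
    next
      have "degree (P a) = n - 1" if "a \<in> W" for a
        unfolding P_def using W that by (simp add: degree_prod_eq_sum_degree)
      then have "degree (\<Sum>a\<in>W. smult (poly p a / poly (P a) a) (P a)) \<le> n - 1"
        using W by (intro degree_sum_le order_trans[OF degree_smult_le]) auto
      then show "degree (\<Sum>a\<in>W. smult (poly p a / poly (P a) a) (P a)) < card W"
        using n W by simp
    qed (use p W in simp)
    then have "poly p z = (\<Sum>a\<in>W. poly p a / poly (P a) a * poly (P a) z)"
      by (metis (no_types, lifting) poly_smult poly_sum sum.cong)
    then have "cmod (poly p z) \<le> (\<Sum>a\<in>W. cmod (poly p a / poly (P a) a * poly (P a) z))"
      by (simp add: norm_sum)
    also have "\<dots> \<le> (\<Sum>a\<in>W. (2 * diameter K / ?\<delta>) * cmod (poly (smult ?c F) z))"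
    proof (rule sum_mono)
      fix a assume a: "a \<in> W"
      have aF: "a \<in> fekete_domain" "a \<in> K" using W a by (auto simp: fekete_domain_def)
      have d: "?\<delta> \<le> cmod (z - a)" using infdist_le[OF aF(1), of z] by (simp add: dist_norm)
      have "cmod (poly p a / poly (P a) a * poly (P a) z) \<le> 1 * (cmod (poly (P a) z) / cmod (poly (P a) a))"
        unfolding norm_mult norm_divide using pK aF
        by (simp add: divide_right_mono mult_left_le_one_le)
      also have "cmod (poly (P a) z) / cmod (poly (P a) a) \<le> (cmod (poly F z) / ?\<delta>) * (2 * diameter K / M)"
      proof -
        have "cmod (poly (P a) z) * ?\<delta> \<le> cmod (poly F z)"
          unfolding FP[OF a] norm_mult using d by (simp add: mult.commute mult_right_mono)
        then have 1: "cmod (poly (P a) z) \<le> cmod (poly F z) / ?\<delta>" using \<delta> by (simp add: le_divide_eq)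
        have 2: "1 / cmod (poly (P a) a) \<le> 2 * diameter K / M"
          using Paa[OF a] M by (simp add: divide_simps mult_ac)
        have "cmod (poly (P a) z) * (1 / cmod (poly (P a) a)) \<le> (cmod (poly F z) / ?\<delta>) * (2 * diameter K / M)"
          using \<delta> by (intro mult_mono 1 2) auto
        then show ?thesis by simp
      qed
      finally show "cmod (poly p a / poly (P a) a * poly (P a) z) \<le> (2 * diameter K / ?\<delta>) * cmod (poly (smult ?c F) z)"
        using M by (simp add: norm_mult norm_divide mult_ac)
    qed
    finally show ?thesis using W by (simp add: mult_ac)
  qed
  ultimately show ?thesis
    using W M by (intro exI[of _ W] exI[of _ ?c]) (auto simp: F_def)
qed

text \<open>A polynomial \<open>p\<close> nearly extremal at \<open>z\<close> is raised to the power
  \<open>n div degree p\<close> and inserted into the lower bound of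
  \<open>fekete_polynomial\<close>. The rounding of the exponent and the factor linear in
  \<open>n\<close> are subexponential and absorbed by half of \<open>\<epsilon>\<close>.\<close>

theorem fekete_sequence:
  obtains W :: "nat \<Rightarrow> complex set" and c :: "nat \<Rightarrow> complex" where
    "\<And>n. W n \<subseteq> fekete_domain" "\<And>n. finite (W n)" "\<And>n. card (W n) = Suc n" "\<And>n. c n \<noteq> 0"
    "\<And>n z. cmod (poly (smult (c n) (\<Prod>b\<in>W n. [:-b, 1:])) z) \<le> exp (real (Suc n) * V z)"
    "\<And>z \<epsilon>. z \<notin> fekete_domain \<Longrightarrow> \<epsilon> > 0 \<Longrightarrow>
       \<forall>\<^sub>F n in sequentially. exp (real (Suc n) * (V z - \<epsilon>)) \<le> cmod (poly (smult (c n) (\<Prod>b\<in>W n. [:-b, 1:])) z)"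
proof -
  have "\<forall>n. \<exists>W c. W \<subseteq> fekete_domain \<and> finite W \<and> card W = Suc n \<and> c \<noteq> 0 \<and>
    (\<forall>z. cmod (poly (smult c (\<Prod>b\<in>W. [:-b, 1:])) z) \<le> exp (real (Suc n) * V z)) \<and>
    (\<forall>z p. z \<notin> fekete_domain \<longrightarrow> degree p < Suc n \<longrightarrow> (\<forall>x\<in>K. cmod (poly p x) \<le> 1) \<longrightarrow>
      cmod (poly p z) \<le> real (Suc n) * (2 * diameter K / infdist z fekete_domain) *
         cmod (poly (smult c (\<Prod>b\<in>W. [:-b, 1:])) z))"
    using fekete_polynomial by blast
  then obtain W c where W: "\<And>n. W n \<subseteq> fekete_domain" "\<And>n. finite (W n)" "\<And>n. card (W n) = Suc n" "\<And>n. c n \<noteq> 0"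
    and up: "\<And>n z. cmod (poly (smult (c n) (\<Prod>b\<in>W n. [:-b, 1:])) z) \<le> exp (real (Suc n) * V z)"
    and lo: "\<And>n z p. z \<notin> fekete_domain \<Longrightarrow> degree p < Suc n \<Longrightarrow> (\<forall>x\<in>K. cmod (poly p x) \<le> 1) \<Longrightarrow>
      cmod (poly p z) \<le> real (Suc n) * (2 * diameter K / infdist z fekete_domain) *
         cmod (poly (smult (c n) (\<Prod>b\<in>W n. [:-b, 1:])) z)"
    by metis
  have "\<forall>\<^sub>F n in sequentially. exp (real (Suc n) * (V z - \<epsilon>)) \<le> cmod (poly (smult (c n) (\<Prod>b\<in>W n. [:-b, 1:])) z)"
    if z: "z \<notin> fekete_domain" and \<epsilon>: "\<epsilon> > 0" for z \<epsilon>
  proof -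
    obtain p where p: "degree p > 0" "\<forall>w\<in>K. cmod (poly p w) \<le> 1" "exp (real (degree p) * (V z - \<epsilon>/2)) \<le> cmod (poly p z)"
      using V_approx[of "\<epsilon>/2" z] \<epsilon> by auto
    define d where "d = degree p"
    define C where "C = 2 * diameter K / infdist z fekete_domain + 1"
    have "C > 0" unfolding C_def
      by (intro add_nonneg_pos divide_nonneg_nonneg mult_nonneg_nonneg infdist_nonneg diameter_ge_0
          compact_imp_bounded compact_K) auto
    \<comment> \<open>Bounds the effect of rounding: \<open>Suc n\<close> and \<open>l * d\<close>
      differ by at most \<open>d\<close>.\<close>
    define c0 where "c0 = real d * \<bar>V z - \<epsilon>/2\<bar>"
    have "filterlim (\<lambda>x::real. exp (x * \<epsilon> / 2 - c0) / (x * C)) at_top at_top"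
      using \<open>C > 0\<close> \<epsilon> by real_asymp
    moreover have "filterlim (\<lambda>n. real (Suc n)) at_top sequentially"
      using filterlim_compose[OF filterlim_real_sequentially filterlim_Suc] .
    ultimately have "filterlim (\<lambda>n. exp (real (Suc n) * \<epsilon> / 2 - c0) / (real (Suc n) * C)) at_top sequentially"
      by (rule filterlim_compose)
    then have "\<forall>\<^sub>F n in sequentially. 1 \<le> exp (real (Suc n) * \<epsilon> / 2 - c0) / (real (Suc n) * C)"
      by (simp add: filterlim_at_top)
    then show ?thesis
    proof eventually_elim
      case (elim n)
      define l where "l = n div d"
      let ?G = "cmod (poly (smult (c n) (\<Prod>b\<in>W n. [:-b, 1:])) z)"
      have ld: "l * d \<le> n" "n < l * d + d"
        using p(1) by (auto simp: l_def d_def) (metis add.commute dividend_less_div_times)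
      have dl: "degree (p ^ l) < Suc n" using degree_power_le[of p l] ld by (simp add: d_def mult.commute)
      have "\<forall>x\<in>K. cmod (poly (p ^ l) x) \<le> 1" using p(2) by (auto simp: norm_power power_le_one)
      from lo[OF z dl this] have 1: "cmod (poly p z) ^ l \<le> real (Suc n) * (2 * diameter K / infdist z fekete_domain) * ?G"
        by (simp add: norm_power)
      also have "\<dots> \<le> real (Suc n) * C * ?G"
        by (intro mult_right_mono mult_left_mono) (auto simp: C_def)
      finally have 1: "cmod (poly p z) ^ l \<le> real (Suc n) * C * ?G" .
      have "real (Suc n) * (V z - \<epsilon>/2) - c0 \<le> real (l * d) * (V z - \<epsilon>/2)"
      proof -
        have "(real (Suc n) - real (l * d)) * (V z - \<epsilon>/2) \<le> \<bar>(real (Suc n) - real (l * d)) * (V z - \<epsilon>/2)\<bar>" by (rule abs_ge_self)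
        also have "\<dots> = \<bar>real (Suc n) - real (l * d)\<bar> * \<bar>V z - \<epsilon>/2\<bar>" by (rule abs_mult)
        also have "\<dots> \<le> real d * \<bar>V z - \<epsilon>/2\<bar>"
        proof (rule mult_right_mono)
          have "real (l * d) \<le> real n" "real (Suc n) \<le> real (l * d + d)"
            using ld by (simp_all only: of_nat_le_iff Suc_le_eq)
          then show "\<bar>real (Suc n) - real (l * d)\<bar> \<le> real d" by auto
        qed simp
        finally show ?thesis by (simp add: c0_def algebra_simps)
      qed
      then have "exp (real (Suc n) * (V z - \<epsilon>/2) - c0) \<le> exp (real (l * d) * (V z - \<epsilon>/2))" by simp
      also have "\<dots> = exp (real d * (V z - \<epsilon>/2)) ^ l" by (simp add: exp_of_nat_mult[symmetric] mult_ac)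
      also have "\<dots> \<le> cmod (poly p z) ^ l" using p(3) by (intro power_mono) (auto simp: d_def)
      also note 1
      finally have 2: "exp (real (Suc n) * (V z - \<epsilon>/2) - c0) \<le> real (Suc n) * C * ?G" .
      have pos: "real (Suc n) * C > 0" using \<open>C > 0\<close> by simp
      have "exp (real (Suc n) * (V z - \<epsilon>)) * 1 \<le> exp (real (Suc n) * (V z - \<epsilon>)) * (exp (real (Suc n) * \<epsilon> / 2 - c0) / (real (Suc n) * C))"
        by (intro mult_left_mono elim) simp
      also have "\<dots> = exp (real (Suc n) * (V z - \<epsilon>/2) - c0) / (real (Suc n) * C)"
        by (simp add: exp_add[symmetric] algebra_simps)
      also have "\<dots> \<le> ?G" using 2 pos by (simp add: divide_le_eq mult_ac)
      finally show ?case by simp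
    qed
  qed
  then show thesis using that[OF W up] by blast
qed

end

section \<open>Limits of root measures\<close>

lemma poly_proots:
  fixes p :: "complex poly"
  assumes "p \<noteq> 0"
  shows "poly p z = lead_coeff p * (\<Prod>w\<in>#proots p. z - w)"
proof -
  have "poly p z = poly (smult (lead_coeff p) (\<Prod>x\<in>#proots p. [:-x, 1:])) z"
    by (simp only: complex_poly_decompose_multiset)
  also have "poly (\<Prod>x\<in>#A. [:-x, 1:]) z = (\<Prod>w\<in>#A. z - w)" for A :: "complex multiset"
    by (induction A) (auto simp: left_diff_distrib)
  ultimately show ?thesis by simp
qed

lemma ln_norm_prod_mset:
  fixes A :: "complex multiset"
  assumes "z \<notin># A"
  shows "(\<Prod>w\<in>#A. z - w) \<noteq> 0 \<and> ln (cmod (\<Prod>w\<in>#A. z - w)) = (\<Sum>w\<in>#A. ln (cmod (z - w)))"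
  using assms by (induction A) (auto simp: norm_mult ln_mult)

lemma ln_norm_poly:
  fixes p :: "complex poly"
  assumes "poly p z \<noteq> 0"
  shows "ln (cmod (poly p z)) = ln (cmod (lead_coeff p)) + (\<Sum>w\<in>#proots p. ln (cmod (z - w)))"
proof -
  have p: "p \<noteq> 0" using assms by auto
  then have "z \<notin># proots p" using assms by (auto simp: set_count_proots)
  from ln_norm_prod_mset[OF this] show ?thesis
    unfolding poly_proots[OF p] using p by (simp add: norm_mult ln_mult)
qed

lemma circle_mean_log_mset:
  fixes A :: "complex multiset"
  assumes r: "r > 0"
  shows "integrable unit_interval (\<lambda>t. \<Sum>w\<in>#A. ln (cmod (circle_point a r t - w))) \<and>
    (\<integral>t. (\<Sum>w\<in>#A. ln (cmod (circle_point a r t - w))) \<partial>unit_interval) = (\<Sum>w\<in>#A. ln (max r (cmod (w - a)))) \<and>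
    (AE t in unit_interval. circle_point a r t \<notin># A)"
proof (induction A)
  case (add x A)
  then show ?case
    using circle_mean_log[OF r, of a x] by (auto elim: eventually_elim2)
qed simp

text \<open>Dividing by \<open>sqrt (1 + |w|\<^sup>2)\<close> makes the logarithmic kernel vanish as \<open>w\<close> tends to infinity,
  so that roots escaping to infinity do no harm.\<close>

definition trunc_kernel :: "real \<Rightarrow> complex \<Rightarrow> complex \<Rightarrow> real" where
  "trunc_kernel \<rho> z w = ln (max \<rho> (cmod (z - w) / sqrt (1 + (cmod w)\<^sup>2)))"

text \<open>By Jensen's formula, the mean of ln |z - w| over z on the circle of radius
  \<open>r\<close> about \<open>a\<close>, with the same normalisation in \<open>w\<close>.\<close>

definition circle_kernel :: "complex \<Rightarrow> real \<Rightarrow> complex \<Rightarrow> real" where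
  "circle_kernel a r w = ln (max r (cmod (w - a)) / sqrt (1 + (cmod w)\<^sup>2))"

lemma sqrt_one_plus_pos: "sqrt (1 + (cmod w)\<^sup>2) > 0"
  by (simp add: add_pos_nonneg)

lemma norm_diff_le_sqrt: "cmod (z - w) \<le> sqrt (1 + (cmod z)\<^sup>2) * sqrt (1 + (cmod w)\<^sup>2)"
proof (rule power2_le_imp_le)
  have "1 - sph_kernel z w \<le> 1" by simp
  then have "(cmod (z - w))\<^sup>2 \<le> (1 + (cmod z)\<^sup>2) * (1 + (cmod w)\<^sup>2)"
    unfolding one_minus_sph_kernel using one_plus_norm_sq_pos[of z] one_plus_norm_sq_pos[of w]
    by (simp add: divide_le_eq)
  then show "(cmod (z - w))\<^sup>2 \<le> (sqrt (1 + (cmod z)\<^sup>2) * sqrt (1 + (cmod w)\<^sup>2))\<^sup>2"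
    by (simp add: power_mult_distrib add_nonneg_nonneg)
qed simp

lemma tendsto_ratio_at_infinity:
  "((\<lambda>w. cmod (w - a) / sqrt (1 + (cmod w)\<^sup>2)) \<longlongrightarrow> 1) at_infinity"
proof -
  have n: "filterlim (\<lambda>w::complex. cmod w) at_top at_infinity" by (rule filterlim_norm_at_top)
  have 1: "((\<lambda>x::real. (x + b) / sqrt (1 + x\<^sup>2)) \<longlongrightarrow> 1) at_top" for b :: real
    by real_asymp
  have 2: "((\<lambda>x::real. (x - b) / sqrt (1 + x\<^sup>2)) \<longlongrightarrow> 1) at_top" for b :: real
    by real_asymp
  show ?thesis
  proof (rule tendsto_sandwich[OF _ _ filterlim_compose[OF 2[of "cmod a"] n] filterlim_compose[OF 1[of "cmod a"] n]])
    show "\<forall>\<^sub>F w in at_infinity. (cmod w - cmod a) / sqrt (1 + (cmod w)\<^sup>2) \<le> cmod (w - a) / sqrt (1 + (cmod w)\<^sup>2)"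
      using sqrt_one_plus_pos by (intro always_eventually allI divide_right_mono norm_triangle_ineq2) (auto intro: less_imp_le)
    show "\<forall>\<^sub>F w in at_infinity. cmod (w - a) / sqrt (1 + (cmod w)\<^sup>2) \<le> (cmod w + cmod a) / sqrt (1 + (cmod w)\<^sup>2)"
      using sqrt_one_plus_pos by (intro always_eventually allI divide_right_mono norm_triangle_ineq4) (auto intro: less_imp_le)
  qed
qed

lemma continuous_trunc_kernel:
  assumes "\<rho> > 0"
  shows "continuous_on UNIV (\<lambda>w. trunc_kernel \<rho> z w)" "continuous_on UNIV (\<lambda>z. trunc_kernel \<rho> z w)"
proof -
  have ne: "sqrt (1 + (cmod w)\<^sup>2) \<noteq> 0" for w using sqrt_one_plus_pos[of w] by linarith
  have ne': "max \<rho> x \<noteq> 0" for x :: real using assms by (simp add: max_def)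
  show "continuous_on UNIV (\<lambda>w. trunc_kernel \<rho> z w)" "continuous_on UNIV (\<lambda>z. trunc_kernel \<rho> z w)"
    unfolding trunc_kernel_def by (intro continuous_intros ballI ne ne')+
qed

lemma trunc_kernel_vanishes:
  assumes "0 < \<rho>" "\<rho> \<le> 1"
  shows "((\<lambda>w. trunc_kernel \<rho> z w) \<longlongrightarrow> 0) at_infinity"
proof -
  have "((\<lambda>w. ln (max \<rho> (cmod (w - z) / sqrt (1 + (cmod w)\<^sup>2)))) \<longlongrightarrow> ln (max \<rho> 1)) at_infinity"
    using assms by (intro tendsto_intros tendsto_max tendsto_ratio_at_infinity) auto
  then show ?thesis using assms by (simp add: trunc_kernel_def norm_minus_commute max_def)
qed

lemma trunc_kernel_bounds:
  assumes "0 < \<rho>" "\<rho> \<le> 1"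
  shows "ln \<rho> \<le> trunc_kernel \<rho> z w" "trunc_kernel \<rho> z w \<le> ln (sqrt (1 + (cmod z)\<^sup>2))"
proof -
  show "ln \<rho> \<le> trunc_kernel \<rho> z w" unfolding trunc_kernel_def using assms by (intro ln_mono) auto
  have "1 \<le> sqrt (1 + (cmod z)\<^sup>2)" by simp
  then have "max \<rho> (cmod (z - w) / sqrt (1 + (cmod w)\<^sup>2)) \<le> sqrt (1 + (cmod z)\<^sup>2)"
    using norm_diff_le_sqrt[of z w] sqrt_one_plus_pos[of w] order_trans[OF assms(2)]
    by (simp add: divide_le_eq)
  then show "trunc_kernel \<rho> z w \<le> ln (sqrt (1 + (cmod z)\<^sup>2))"
    unfolding trunc_kernel_def using assms by (intro ln_mono) (auto simp: max_def)
qed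

lemma continuous_circle_kernel:
  assumes "r > 0" shows "continuous_on UNIV (circle_kernel a r)"
proof -
  have ne: "sqrt (1 + (cmod w)\<^sup>2) \<noteq> 0" for w using sqrt_one_plus_pos[of w] by linarith
  have ne': "max r (cmod (w - a)) / sqrt (1 + (cmod w)\<^sup>2) \<noteq> 0" for w
  proof -
    have "max r (cmod (w - a)) > 0" using assms by (simp add: less_max_iff_disj)
    then show ?thesis using ne[of w] by simp
  qed
  show ?thesis
    unfolding circle_kernel_def[abs_def] by (intro continuous_intros ballI ne ne')
qed

lemma circle_kernel_vanishes:
  assumes "r > 0" shows "(circle_kernel a r \<longlongrightarrow> 0) at_infinity"
proof -
  have "((\<lambda>w. ln (cmod (w - a) / sqrt (1 + (cmod w)\<^sup>2))) \<longlongrightarrow> ln 1) at_infinity"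
    by (intro tendsto_intros tendsto_ratio_at_infinity) auto
  moreover have "\<forall>\<^sub>F w in at_infinity. ln (cmod (w - a) / sqrt (1 + (cmod w)\<^sup>2)) = circle_kernel a r w"
    unfolding eventually_at_infinity
  proof (intro exI[of _ "r + cmod a"] allI impI)
    fix w :: complex assume "r + cmod a \<le> cmod w"
    then have "r \<le> cmod (w - a)" using norm_triangle_ineq2[of w a] by simp
    then show "ln (cmod (w - a) / sqrt (1 + (cmod w)\<^sup>2)) = circle_kernel a r w"
      by (simp add: circle_kernel_def max_def)
  qed
  ultimately show ?thesis by (simp add: filterlim_cong)
qed

lemma log_kernel_eq_ln:
  assumes "z \<noteq> w"
  shows "log_kernel z w = ennreal (ln (1 + (cmod z)\<^sup>2) - 2 * ln (cmod (z - w) / sqrt (1 + (cmod w)\<^sup>2)))"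
proof -
  define A B d where "A = 1 + (cmod z)\<^sup>2" and "B = 1 + (cmod w)\<^sup>2" and "d = cmod (z - w)"
  have pos: "A > 0" "B > 0" "d > 0"
    using one_plus_norm_sq_pos assms by (auto simp: A_def B_def d_def)
  have "ln (d\<^sup>2 / (A * B)) = 2 * ln d - (ln A + ln B)"
    using pos by (simp add: ln_div ln_mult ln_realpow)
  moreover have "ln (d / sqrt B) = ln d - ln B / 2"
    using pos by (simp add: ln_div ln_sqrt)
  ultimately have "- ln (d\<^sup>2 / (A * B)) = ln A - 2 * ln (d / sqrt B)" by simp
  then show ?thesis
    unfolding log_kernel_off_diag[OF assms] one_minus_sph_kernel by (simp add: A_def B_def d_def)
qed

lemma log_kernel_ge_circle:
  assumes "r > 0"
  shows "ennreal (ln (1 + (cmod a)\<^sup>2) - 2 * circle_kernel a r w) \<le> log_kernel a w"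
proof (cases "a = w")
  case False
  have "ln (cmod (a - w) / sqrt (1 + (cmod w)\<^sup>2)) \<le> circle_kernel a r w"
    unfolding circle_kernel_def
  proof (rule ln_mono)
    show "cmod (a - w) / sqrt (1 + (cmod w)\<^sup>2) \<le> max r (cmod (w - a)) / sqrt (1 + (cmod w)\<^sup>2)"
      by (intro divide_right_mono) (auto simp: norm_minus_commute)
    show "0 < cmod (a - w) / sqrt (1 + (cmod w)\<^sup>2)" using False sqrt_one_plus_pos[of w] by simp
  qed
  then show ?thesis using False by (simp add: log_kernel_eq_ln ennreal_leI)
qed (simp add: log_kernel_diag)

lemma trunc_kernel_SUP:
  "(SUP n. ennreal (ln (1 + (cmod z)\<^sup>2) - 2 * trunc_kernel (exp (- real n)) z w)) = log_kernel z w"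
proof (cases "z = w")
  case False
  define x where "x = cmod (z - w) / sqrt (1 + (cmod w)\<^sup>2)"
  have x: "x > 0" using False sqrt_one_plus_pos[of w] by (simp add: x_def)
  show ?thesis
  proof (rule antisym)
    show "(SUP n. ennreal (ln (1 + (cmod z)\<^sup>2) - 2 * trunc_kernel (exp (- real n)) z w)) \<le> log_kernel z w"
    proof (rule SUP_least)
      fix n
      have "ln x \<le> trunc_kernel (exp (- real n)) z w"
        unfolding trunc_kernel_def x_def[symmetric] using x by (intro ln_mono) auto
      then show "ennreal (ln (1 + (cmod z)\<^sup>2) - 2 * trunc_kernel (exp (- real n)) z w) \<le> log_kernel z w"
        unfolding log_kernel_eq_ln[OF False] x_def[symmetric] by (intro ennreal_leI) simp
    qed
    obtain n :: nat where n: "- ln x \<le> real n" using real_arch_simple by blast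
    then have "exp (- real n) \<le> exp (ln x)" by (intro exp_le_cancel_iff[THEN iffD2]) simp
    then have "trunc_kernel (exp (- real n)) z w = ln x"
      unfolding trunc_kernel_def x_def[symmetric] using x by (simp add: max_def)
    then have "log_kernel z w = ennreal (ln (1 + (cmod z)\<^sup>2) - 2 * trunc_kernel (exp (- real n)) z w)"
      unfolding log_kernel_eq_ln[OF False] x_def[symmetric] by simp
    also have "\<dots> \<le> (SUP n. ennreal (ln (1 + (cmod z)\<^sup>2) - 2 * trunc_kernel (exp (- real n)) z w))"
      by (rule SUP_upper) simp
    finally show "log_kernel z w \<le> (SUP n. ennreal (ln (1 + (cmod z)\<^sup>2) - 2 * trunc_kernel (exp (- real n)) z w))" .
  qed
next
  case True
  have eq: "trunc_kernel (exp (- real n)) z w = - real n" for n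
    using True by (simp add: trunc_kernel_def max_def)
  have "(SUP n. ennreal (ln (1 + (cmod z)\<^sup>2) - 2 * trunc_kernel (exp (- real n)) z w)) = top"
    unfolding SUP_eq_top_iff
  proof (intro allI impI)
    fix e :: ennreal assume "e < top"
    then obtain r where r: "e = ennreal r" "r \<ge> 0" by (cases e) auto
    obtain n :: nat where n: "r < real n" using reals_Archimedean2 by blast
    have "e < ennreal (ln (1 + (cmod z)\<^sup>2) - 2 * trunc_kernel (exp (- real n)) z w)"
    proof -
      have "0 \<le> ln (1 + (cmod z)\<^sup>2)" by simp
      then show ?thesis unfolding eq r(1) using n r(2) by (intro ennreal_lessI) linarith+
    qed
    then show "\<exists>i\<in>UNIV. e < ennreal (ln (1 + (cmod z)\<^sup>2) - 2 * trunc_kernel (exp (- real i)) z w)" by blast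
  qed
  then show ?thesis using True by (simp add: log_kernel_diag)
qed

text \<open>The conclusion says that \<open>V\<close> is, up to an additive constant, the logarithmic potential of the limit.\<close>

theorem root_measures_potential:
  fixes P :: "nat \<Rightarrow> complex poly" and n :: "nat \<Rightarrow> nat" and V :: "complex \<Rightarrow> real"
  assumes V: "continuous_on UNIV V"
    and D: "closure D = UNIV"
    and P: "\<And>k. P k \<noteq> 0" and n: "\<And>k. n k > 0"
    and upper: "\<And>k z. cmod (poly (P k) z) \<le> exp (real (n k) * (V z + \<epsilon> k))" and \<epsilon>: "\<epsilon> \<longlonglongrightarrow> 0"
    and lower: "\<And>z \<delta>. z \<in> D \<Longrightarrow> \<delta> > 0 \<Longrightarrow>
        \<forall>\<^sub>F k in sequentially. exp (real (n k) * (V z - \<delta>)) \<le> cmod (poly (P k) z)"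
    and \<Lambda>: "finite_measure \<Lambda>" "sets \<Lambda> = sets borel"
    and vague: "\<And>f :: complex \<Rightarrow> real. continuous_on UNIV f \<Longrightarrow> (f \<longlongrightarrow> 0) at_infinity \<Longrightarrow>
       (\<lambda>k. (\<Sum>z\<in>#proots (P k). f z) / real (n k)) \<longlonglongrightarrow> (\<integral>z. f z \<partial>\<Lambda>)"
  shows "\<exists>C. \<forall>z. 0 \<le> 2 * C - 2 * V z + measure \<Lambda> UNIV * ln (1 + (cmod z)\<^sup>2) \<and>
     (\<integral>\<^sup>+w. log_kernel z w \<partial>\<Lambda>) = ennreal (2 * C - 2 * V z + measure \<Lambda> UNIV * ln (1 + (cmod z)\<^sup>2))"
proof -
  interpret finite_measure \<Lambda> by fact
  note [measurable_cong] = \<Lambda>(2)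
  have sp: "space \<Lambda> = UNIV" using sets_eq_imp_space_eq[OF \<Lambda>(2)] by simp
  define q where "q w = ln (sqrt (1 + (cmod w)\<^sup>2))" for w
  \<comment> \<open>The spherical normalisation moves part of the sum over the roots into this
    constant. Nothing bounds it a priori; it is eliminated between \<open>up\<close> and
    \<open>low\<close>.\<close>
  define C where "C k = (ln (cmod (lead_coeff (P k))) + (\<Sum>w\<in>#proots (P k). q w)) / real (n k)" for k
  define avg where "avg a r = (\<integral>t. V (circle_point a r t) \<partial>unit_interval)" for a r
  have Vc: "continuous_on A (\<lambda>t. V (circle_point a r t))" for A a r
    by (rule continuous_on_compose2[OF V continuous_circle_point]) auto
  have [measurable]: "(\<lambda>t. V (circle_point a r t)) \<in> borel_measurable borel" for a r
    by (rule borel_measurable_continuous_onI[OF Vc])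
  have Vi: "integrable unit_interval (\<lambda>t. V (circle_point a r t))" for a r
    by (rule integral_unit_interval(2)[OF Vc]) measurable
  \<comment> \<open>Averaging the upper bound over a circle replaces the singular kernel by a
    continuous one vanishing at infinity, to which vague convergence applies.\<close>
  have up: "C k + (\<Sum>w\<in>#proots (P k). circle_kernel a r w) / real (n k) \<le> avg a r + \<epsilon> k" if r: "r > 0" for k a r
  proof -
    note J = circle_mean_log_mset[OF r, of a "proots (P k)"]
    let ?S = "\<lambda>t. \<Sum>w\<in>#proots (P k). ln (cmod (circle_point a r t - w))"
    have "ln (cmod (lead_coeff (P k))) + (\<Sum>w\<in>#proots (P k). ln (max r (cmod (w - a)))) =
        (\<integral>t. ln (cmod (lead_coeff (P k))) + ?S t \<partial>unit_interval)"
      using J by (simp add: unit_interval.prob_space)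
    also have "\<dots> \<le> (\<integral>t. real (n k) * (V (circle_point a r t) + \<epsilon> k) \<partial>unit_interval)"
    proof (rule integral_mono_AE)
      show "AE t in unit_interval. ln (cmod (lead_coeff (P k))) + ?S t \<le> real (n k) * (V (circle_point a r t) + \<epsilon> k)"
        using J[THEN conjunct2, THEN conjunct2]
      proof eventually_elim
        case (elim t)
        then have nz: "poly (P k) (circle_point a r t) \<noteq> 0" using P by (simp add: set_count_proots)
        have "ln (cmod (poly (P k) (circle_point a r t))) \<le> ln (exp (real (n k) * (V (circle_point a r t) + \<epsilon> k)))"
          using nz upper by (intro ln_mono) auto
        then show ?case using ln_norm_poly[OF nz] by simp
      qed
    qed (use J Vi in auto)
    also have "\<dots> = real (n k) * (avg a r + \<epsilon> k)"
      using Vi by (simp add: avg_def unit_interval.prob_space)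
    finally have "ln (cmod (lead_coeff (P k))) + (\<Sum>w\<in>#proots (P k). ln (max r (cmod (w - a)))) \<le> real (n k) * (avg a r + \<epsilon> k)" .
    moreover have "(\<Sum>w\<in>#proots (P k). ln (max r (cmod (w - a)))) =
        (\<Sum>w\<in>#proots (P k). q w) + (\<Sum>w\<in>#proots (P k). circle_kernel a r w)"
      unfolding sum_mset.distrib[symmetric]
    proof (intro arg_cong[of _ _ sum_mset] image_mset_cong)
      fix w
      have "max r (cmod (w - a)) > 0" using r by (simp add: less_max_iff_disj)
      then show "ln (max r (cmod (w - a))) = q w + circle_kernel a r w"
        using sqrt_one_plus_pos[of w] by (simp add: q_def circle_kernel_def ln_div)
    qed
    ultimately show ?thesis
      using n[of k] by (simp add: C_def field_simps)
  qed
  \<comment> \<open>Truncating the kernel from below only increases the sum, so the pointwise lower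
    bound survives with a continuous kernel.\<close>
  have low: "\<forall>\<^sub>F k in sequentially. V z - \<delta> \<le> C k + (\<Sum>w\<in>#proots (P k). trunc_kernel \<rho> z w) / real (n k)"
    if z: "z \<in> D" and \<delta>: "\<delta> > 0" and \<rho>: "\<rho> > 0" for z \<delta> \<rho>
    using lower[OF z \<delta>]
  proof eventually_elim
    case (elim k)
    then have nz: "poly (P k) z \<noteq> 0" by (metis exp_gt_zero norm_zero not_le)
    have "real (n k) * (V z - \<delta>) = ln (exp (real (n k) * (V z - \<delta>)))" by simp
    also have "\<dots> \<le> ln (cmod (poly (P k) z))" using elim nz by (intro ln_mono) auto
    also have "\<dots> = ln (cmod (lead_coeff (P k))) + (\<Sum>w\<in>#proots (P k). ln (cmod (z - w)))"
      by (rule ln_norm_poly[OF nz])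
    also have "(\<Sum>w\<in>#proots (P k). ln (cmod (z - w))) \<le> (\<Sum>w\<in>#proots (P k). q w + trunc_kernel \<rho> z w)"
    proof (rule sum_mset_mono)
      fix w assume "w \<in># proots (P k)"
      then have "cmod (z - w) > 0" using nz P by (auto simp: set_count_proots)
      then have "ln (cmod (z - w)) = q w + ln (cmod (z - w) / sqrt (1 + (cmod w)\<^sup>2))"
        using sqrt_one_plus_pos[of w] by (simp add: q_def ln_div)
      also have "ln (cmod (z - w) / sqrt (1 + (cmod w)\<^sup>2)) \<le> trunc_kernel \<rho> z w"
        unfolding trunc_kernel_def using \<open>cmod (z - w) > 0\<close> sqrt_one_plus_pos[of w] by (intro ln_mono) auto
      finally show "ln (cmod (z - w)) \<le> q w + trunc_kernel \<rho> z w" by simp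
    qed
    finally show ?case
      using n[of k] by (simp add: C_def sum_mset.distrib field_simps)
  qed
  have ic: "integrable \<Lambda> (circle_kernel a r)" if r: "r > 0" for a r
  proof -
    obtain B where "\<And>w. \<bar>circle_kernel a r w\<bar> \<le> B"
      using bounded_if_vanishes_at_infinity[OF continuous_circle_kernel[OF r] circle_kernel_vanishes[OF r]] by blast
    moreover have "circle_kernel a r \<in> borel_measurable borel"
      by (rule borel_measurable_continuous_onI[OF continuous_circle_kernel[OF r]])
    ultimately show ?thesis by (intro integrable_const_bound[of _ B]) auto
  qed
  have it: "integrable \<Lambda> (trunc_kernel \<rho> z)" if \<rho>: "0 < \<rho>" "\<rho> \<le> 1" for \<rho> z
  proof (rule integrable_const_bound[of _ "max (- ln \<rho>) (ln (sqrt (1 + (cmod z)\<^sup>2)))"])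
    show "trunc_kernel \<rho> z \<in> borel_measurable \<Lambda>"
      using borel_measurable_continuous_onI[OF continuous_trunc_kernel(1)[OF \<rho>(1)]] by measurable
    show "AE w in \<Lambda>. norm (trunc_kernel \<rho> z w) \<le> max (- ln \<rho>) (ln (sqrt (1 + (cmod z)\<^sup>2)))"
    proof (intro AE_I2)
      fix w
      show "norm (trunc_kernel \<rho> z w) \<le> max (- ln \<rho>) (ln (sqrt (1 + (cmod z)\<^sup>2)))"
        using trunc_kernel_bounds[OF \<rho>, of z w] by (simp only: real_norm_def)
    qed
  qed
  \<comment> \<open>Both bounds hold for the same \<open>k\<close>, so \<open>C k\<close> cancels
    before the limit is taken.\<close>
  have cross: "V z - (\<integral>w. trunc_kernel \<rho> z w \<partial>\<Lambda>) \<le> avg a r - (\<integral>w. circle_kernel a r w \<partial>\<Lambda>)"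
    if z: "z \<in> D" and \<rho>: "0 < \<rho>" "\<rho> \<le> 1" and r: "r > 0" for z \<rho> a r
  proof (rule field_le_epsilon)
    fix e :: real assume e: "e > 0"
    have "V z - e - (\<integral>w. trunc_kernel \<rho> z w \<partial>\<Lambda>) \<le> avg a r + 0 - (\<integral>w. circle_kernel a r w \<partial>\<Lambda>)"
    proof (rule tendsto_le[OF sequentially_bot])
      show "(\<lambda>k. avg a r + \<epsilon> k - (\<Sum>w\<in>#proots (P k). circle_kernel a r w) / real (n k))
          \<longlonglongrightarrow> avg a r + 0 - (\<integral>w. circle_kernel a r w \<partial>\<Lambda>)"
        by (intro tendsto_intros \<epsilon> vague continuous_circle_kernel circle_kernel_vanishes r)
      show "(\<lambda>k. V z - e - (\<Sum>w\<in>#proots (P k). trunc_kernel \<rho> z w) / real (n k))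
          \<longlonglongrightarrow> V z - e - (\<integral>w. trunc_kernel \<rho> z w \<partial>\<Lambda>)"
        by (intro tendsto_intros vague continuous_trunc_kernel trunc_kernel_vanishes \<rho>)
      show "\<forall>\<^sub>F k in sequentially. V z - e - (\<Sum>w\<in>#proots (P k). trunc_kernel \<rho> z w) / real (n k)
          \<le> avg a r + \<epsilon> k - (\<Sum>w\<in>#proots (P k). circle_kernel a r w) / real (n k)"
        using low[OF z e \<rho>(1)]
      proof eventually_elim
        case (elim k)
        then show ?case using up[OF r, of k a] by simp
      qed
    qed
    then show "V z - (\<integral>w. trunc_kernel \<rho> z w \<partial>\<Lambda>) \<le> avg a r - (\<integral>w. circle_kernel a r w \<partial>\<Lambda>) + e" by simp
  qed
  obtain z0 where z0: "z0 \<in> D" using D by (metis closure_empty empty_not_UNIV ex_in_conv)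
  \<comment> \<open>Any number between the two sides of \<open>cross\<close> can serve as the
    limiting constant; the infimum over all circles is one.\<close>
  define Cinf where "Cinf = (INF p\<in>UNIV \<times> {0<..}. avg (fst p) (snd p) - (\<integral>w. circle_kernel (fst p) (snd p) w \<partial>\<Lambda>))"
  have bdd: "bdd_below ((\<lambda>p. avg (fst p) (snd p) - (\<integral>w. circle_kernel (fst p) (snd p) w \<partial>\<Lambda>)) ` (UNIV \<times> {0<..}))"
    using cross[OF z0, of 1] by (intro bdd_belowI2[of _ "V z0 - (\<integral>w. trunc_kernel 1 z0 w \<partial>\<Lambda>)"]) auto
  have C1: "Cinf \<le> avg a r - (\<integral>w. circle_kernel a r w \<partial>\<Lambda>)" if "r > 0" for a r
    unfolding Cinf_def using cINF_lower[OF bdd, of "(a, r)"] that by simp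
  have C2: "V z - (\<integral>w. trunc_kernel \<rho> z w \<partial>\<Lambda>) \<le> Cinf" if "z \<in> D" "0 < \<rho>" "\<rho> \<le> 1" for z \<rho>
    unfolding Cinf_def using cross[OF that] by (intro cINF_greatest) (auto intro!: exI[of _ 1])
  \<comment> \<open>Extension from the dense set \<open>D\<close> to all points, by continuity in
    \<open>z\<close> of \<open>V\<close> and of the truncated potential.\<close>
  have C2': "V z - (\<integral>w. trunc_kernel \<rho> z w \<partial>\<Lambda>) \<le> Cinf" if \<rho>: "0 < \<rho>" "\<rho> \<le> 1" for z \<rho>
  proof -
    have "z \<in> closure D" using D by simp
    then obtain x where x: "\<And>k. x k \<in> D" "x \<longlonglongrightarrow> z" unfolding closure_sequential by blast
    have "(\<lambda>k. V (x k) - (\<integral>w. trunc_kernel \<rho> (x k) w \<partial>\<Lambda>)) \<longlonglongrightarrow> V z - (\<integral>w. trunc_kernel \<rho> z w \<partial>\<Lambda>)"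
    proof (intro tendsto_diff)
      show "(\<lambda>k. V (x k)) \<longlonglongrightarrow> V z"
        using V x(2) by (simp add: continuous_on_eq_continuous_at isCont_tendsto_compose)
      obtain R where R: "\<And>k. cmod (x k) \<le> R"
        using convergent_imp_Bseq[of x] x(2) by (auto simp: convergent_def Bseq_def)
      define B where "B = max (- ln \<rho>) (ln (sqrt (1 + R\<^sup>2)))"
      show "(\<lambda>k. \<integral>w. trunc_kernel \<rho> (x k) w \<partial>\<Lambda>) \<longlonglongrightarrow> (\<integral>w. trunc_kernel \<rho> z w \<partial>\<Lambda>)"
      proof (rule integral_dominated_convergence[where w="\<lambda>_. B"])
        show "AE w in \<Lambda>. (\<lambda>k. trunc_kernel \<rho> (x k) w) \<longlonglongrightarrow> trunc_kernel \<rho> z w"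
          using continuous_trunc_kernel(2)[OF \<rho>(1)] x(2)
          by (intro AE_I2 isCont_tendsto_compose[of z "\<lambda>z. trunc_kernel \<rho> z _"])
            (auto simp: continuous_on_eq_continuous_at)
        show "AE w in \<Lambda>. norm (trunc_kernel \<rho> (x k) w) \<le> B" for k
        proof (intro AE_I2)
          fix w
          have "(cmod (x k))\<^sup>2 \<le> R\<^sup>2" using R[of k] by (intro power_mono) auto
          then have "ln (sqrt (1 + (cmod (x k))\<^sup>2)) \<le> ln (sqrt (1 + R\<^sup>2))"
            using one_plus_norm_sq_pos[of "x k"] by (intro ln_mono real_sqrt_le_mono) auto
          then show "norm (trunc_kernel \<rho> (x k) w) \<le> B"
            using trunc_kernel_bounds[OF \<rho>, of "x k" w] by (auto simp: B_def)
        qed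
      qed (use it[OF \<rho>] in auto)
    qed
    then show ?thesis
      by (rule LIMSEQ_le_const2) (use C2[OF x(1) \<rho>] in auto)
  qed
  define m where "m = measure \<Lambda> UNIV"
  define g where "g z = ln (1 + (cmod z)\<^sup>2)" for z
  show ?thesis
  proof (intro exI[of _ Cinf] allI)
    fix z
    \<comment> \<open>As the truncation level decreases, monotone convergence recovers the full
      kernel.\<close>
    have le: "(\<integral>\<^sup>+w. log_kernel z w \<partial>\<Lambda>) \<le> ennreal (2 * Cinf - 2 * V z + m * g z)"
    proof -
      have nn: "0 \<le> g z - 2 * trunc_kernel (exp (- real k)) z w" for k w
        using trunc_kernel_bounds(2)[of "exp (- real k)" z w] one_plus_norm_sq_pos[of z] by (simp add: g_def ln_sqrt)
      have "(\<integral>\<^sup>+w. log_kernel z w \<partial>\<Lambda>) = (SUP k. \<integral>\<^sup>+w. ennreal (g z - 2 * trunc_kernel (exp (- real k)) z w) \<partial>\<Lambda>)"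
        unfolding trunc_kernel_SUP[symmetric] g_def
      proof (rule nn_integral_monotone_convergence_SUP)
        show "incseq (\<lambda>k w. ennreal (ln (1 + (cmod z)\<^sup>2) - 2 * trunc_kernel (exp (- real k)) z w))"
        proof (intro incseq_SucI le_funI ennreal_leI diff_left_mono mult_left_mono)
          fix k w
          show "trunc_kernel (exp (- real (Suc k))) z w \<le> trunc_kernel (exp (- real k)) z w"
            unfolding trunc_kernel_def by (intro ln_mono max.mono) (auto simp: less_max_iff_disj)
        qed auto
        show "(\<lambda>w. ennreal (ln (1 + (cmod z)\<^sup>2) - 2 * trunc_kernel (exp (- real k)) z w)) \<in> borel_measurable \<Lambda>" for k
          using it[of "exp (- real k)" z] by auto
      qed
      also have "\<dots> \<le> ennreal (2 * Cinf - 2 * V z + m * g z)"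
      proof (rule SUP_least)
        fix k
        have "(\<integral>\<^sup>+w. ennreal (g z - 2 * trunc_kernel (exp (- real k)) z w) \<partial>\<Lambda>) =
          ennreal (\<integral>w. g z - 2 * trunc_kernel (exp (- real k)) z w \<partial>\<Lambda>)"
          using it[of "exp (- real k)" z] nn by (intro nn_integral_eq_integral) auto
        also have "(\<integral>w. g z - 2 * trunc_kernel (exp (- real k)) z w \<partial>\<Lambda>) = m * g z - 2 * (\<integral>w. trunc_kernel (exp (- real k)) z w \<partial>\<Lambda>)"
          using it[of "exp (- real k)" z] sp by (simp add: m_def)
        also have "ennreal \<dots> \<le> ennreal (2 * Cinf - 2 * V z + m * g z)"
          using C2'[of "exp (- real k)" z] by (intro ennreal_leI) simp
        finally show "(\<integral>\<^sup>+w. ennreal (g z - 2 * trunc_kernel (exp (- real k)) z w) \<partial>\<Lambda>) \<le> ennreal (2 * Cinf - 2 * V z + m * g z)" .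
      qed
      finally show ?thesis .
    qed
    \<comment> \<open>The circle version of the kernel stays below it. The reverse inequality
      follows as the radius tends to 0, where continuity of \<open>V\<close> makes its circle means
      converge.\<close>
    have ge: "ennreal (m * g z + 2 * Cinf - 2 * avg z r) \<le> (\<integral>\<^sup>+w. log_kernel z w \<partial>\<Lambda>)" if r: "r > 0" for r
    proof -
      have i: "integrable \<Lambda> (\<lambda>w. g z - 2 * circle_kernel z r w)" using ic[OF r, of z] by auto
      have "ennreal (m * g z + 2 * Cinf - 2 * avg z r) \<le> ennreal (\<integral>w. g z - 2 * circle_kernel z r w \<partial>\<Lambda>)"
        using C1[OF r, of z] ic[OF r, of z] sp by (intro ennreal_leI) (simp add: m_def)
      also have "\<dots> \<le> ennreal (\<integral>w. max 0 (g z - 2 * circle_kernel z r w) \<partial>\<Lambda>)"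
        using i by (intro ennreal_leI integral_mono) auto
      also have "\<dots> = (\<integral>\<^sup>+w. ennreal (max 0 (g z - 2 * circle_kernel z r w)) \<partial>\<Lambda>)"
        using i by (intro nn_integral_eq_integral[symmetric]) auto
      also have "\<dots> \<le> (\<integral>\<^sup>+w. log_kernel z w \<partial>\<Lambda>)"
        using log_kernel_ge_circle[OF r, of z] by (intro nn_integral_mono) (auto simp: max_def g_def)
      finally show ?thesis .
    qed
    have avg_lim: "(\<lambda>k. avg z (1 / real (Suc k))) \<longlonglongrightarrow> V z"
    proof (rule LIMSEQ_I)
      fix e :: real assume e: "e > 0"
      have "isCont V z" using V by (simp add: continuous_on_eq_continuous_at)
      then obtain d where d: "d > 0" "\<And>y. dist y z < d \<Longrightarrow> dist (V y) (V z) < e / 2"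
        unfolding continuous_at_eps_delta using e by (metis half_gt_zero)
      obtain N where N: "1 / real (Suc N) < d" using d(1) nat_approx_posE by metis
      have "norm (avg z (1 / real (Suc k)) - V z) < e" if k: "k \<ge> N" for k
      proof -
        define r where "r = 1 / real (Suc k)"
        have "1 / real (Suc k) \<le> 1 / real (Suc N)" using k by (intro divide_left_mono) auto
        then have r: "r > 0" "r < d" using N by (simp_all add: r_def)
        have "avg z r - V z = (\<integral>t. V (circle_point z r t) - V z \<partial>unit_interval)"
          using Vi by (simp add: avg_def unit_interval.prob_space)
        also have "norm \<dots> \<le> (\<integral>t. norm (V (circle_point z r t) - V z) \<partial>unit_interval)"
          by (rule integral_norm_bound)
        also have "\<dots> \<le> (\<integral>t. e / 2 \<partial>unit_interval)"
        proof (rule integral_mono)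
          fix t
          have "dist (circle_point z r t) z < d" using dist_circle_point[of r z t] r by simp
          then have "dist (V (circle_point z r t)) (V z) < e / 2" by (rule d(2))
          then show "norm (V (circle_point z r t) - V z) \<le> e / 2" by (simp add: dist_norm)
        qed (use Vi in auto)
        also have "\<dots> < e" using e by (simp add: unit_interval.prob_space)
        finally show ?thesis by (simp add: r_def)
      qed
      then show "\<exists>no. \<forall>k\<ge>no. norm (avg z (1 / real (Suc k)) - V z) < e" by blast
    qed
    have fin: "(\<integral>\<^sup>+w. log_kernel z w \<partial>\<Lambda>) \<noteq> \<infinity>" using le by (auto simp: top_unique)
    define I where "I = enn2real (\<integral>\<^sup>+w. log_kernel z w \<partial>\<Lambda>)"
    have I: "(\<integral>\<^sup>+w. log_kernel z w \<partial>\<Lambda>) = ennreal I" "I \<ge> 0"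
      using fin by (auto simp: I_def less_top)
    have "m * g z + 2 * Cinf - 2 * avg z (1 / real (Suc k)) \<le> I" for k
      using ge[of "1 / real (Suc k)"] I by (simp add: ennreal_le_iff)
    moreover have "(\<lambda>k. m * g z + 2 * Cinf - 2 * avg z (1 / real (Suc k))) \<longlonglongrightarrow> m * g z + 2 * Cinf - 2 * V z"
      by (intro tendsto_intros avg_lim)
    ultimately have 1: "m * g z + 2 * Cinf - 2 * V z \<le> I" by (intro LIMSEQ_le_const2) auto
    \<comment> \<open>Needed to read \<open>le\<close> as an inequality between reals, since
      \<open>ennreal\<close> sends negative numbers to 0. Truncation at level 1 provides it.\<close>
    have nonneg: "0 \<le> 2 * Cinf - 2 * V z + m * g z"
    proof -
      have "trunc_kernel 1 z w \<le> g z / 2" for w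
        using trunc_kernel_bounds(2)[of 1 z w] one_plus_norm_sq_pos[of z] by (simp add: g_def ln_sqrt)
      then have "(\<integral>w. trunc_kernel 1 z w \<partial>\<Lambda>) \<le> (\<integral>w. g z / 2 \<partial>\<Lambda>)"
        using it[of 1 z] by (intro integral_mono) auto
      then show ?thesis using C2'[of 1 z] sp by (simp add: m_def)
    qed
    then have 2: "I \<le> 2 * Cinf - 2 * V z + m * g z" using le I by (simp add: ennreal_le_iff)
    have "I = 2 * Cinf - 2 * V z + m * g z" using 1 2 by simp
    then show "0 \<le> 2 * Cinf - 2 * V z + measure \<Lambda> UNIV * ln (1 + (cmod z)\<^sup>2) \<and>
     (\<integral>\<^sup>+w. log_kernel z w \<partial>\<Lambda>) = ennreal (2 * Cinf - 2 * V z + measure \<Lambda> UNIV * ln (1 + (cmod z)\<^sup>2))"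
      using I nonneg by (simp add: m_def g_def)
  qed
qed

section \<open>The equilibrium measure\<close>

lemma log_energy2_sym:
  assumes "finite_measure \<alpha>" "sets \<alpha> = sets borel" "finite_measure \<beta>" "sets \<beta> = sets borel"
  shows "log_energy2 \<alpha> \<beta> = log_energy2 \<beta> \<alpha>"
proof -
  interpret A: finite_measure \<alpha> by fact
  interpret B: finite_measure \<beta> by fact
  interpret pair_sigma_finite \<alpha> \<beta> ..
  note [measurable_cong] = assms(2,4)
  have m: "(\<lambda>(z, w). log_kernel z w) \<in> borel_measurable (\<alpha> \<Otimes>\<^sub>M \<beta>)" by measurable
  have "(\<integral>\<^sup>+w. (\<integral>\<^sup>+z. log_kernel z w \<partial>\<alpha>) \<partial>\<beta>) = (\<integral>\<^sup>+z. (\<integral>\<^sup>+w. log_kernel z w \<partial>\<beta>) \<partial>\<alpha>)"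
    using Fubini'[OF m] .
  then show ?thesis by (simp add: log_energy2_def log_kernel_sym)
qed

text \<open>Turns a known potential of one measure into its mixed energy with any other. Only finite
  signed quantities remain, so the symmetry of the mixed energy becomes an equation between
  reals.\<close>

lemma log_energy2_of_potential:
  assumes \<alpha>: "finite_measure \<alpha>" "sets \<alpha> = sets borel"
    and p: "\<And>z. (\<integral>\<^sup>+w. log_kernel z w \<partial>\<beta>) = ennreal (c + b z)"
    and pos: "AE z in \<alpha>. c + b z \<ge> 0" and i: "integrable \<alpha> b"
  shows "log_energy2 \<alpha> \<beta> = ennreal (measure \<alpha> UNIV * c + (\<integral>z. b z \<partial>\<alpha>))"
    "0 \<le> measure \<alpha> UNIV * c + (\<integral>z. b z \<partial>\<alpha>)"
proof -
  interpret finite_measure \<alpha> by fact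
  have sp: "space \<alpha> = UNIV" using sets_eq_imp_space_eq[OF \<alpha>(2)] by simp
  have eq: "(\<integral>z. c + b z \<partial>\<alpha>) = measure \<alpha> UNIV * c + (\<integral>z. b z \<partial>\<alpha>)"
    using i sp by simp
  have "log_energy2 \<alpha> \<beta> = ennreal (\<integral>z. c + b z \<partial>\<alpha>)"
    unfolding log_energy2_def p using i pos by (intro nn_integral_eq_integral) auto
  then show "log_energy2 \<alpha> \<beta> = ennreal (measure \<alpha> UNIV * c + (\<integral>z. b z \<partial>\<alpha>))" unfolding eq .
  show "0 \<le> measure \<alpha> UNIV * c + (\<integral>z. b z \<partial>\<alpha>)"
    unfolding eq[symmetric] using pos by (rule integral_nonneg_AE)
qed

lemma sum_mset_singletons:
  "finite W \<Longrightarrow> (\<Sum>z\<in>#(\<Sum>x\<in>W. {#x#}). f z) = (\<Sum>z\<in>W. f z :: real)"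
  by (induction W rule: finite_induct) auto

lemma infdist_vanishes_at_infinity:
  fixes K :: "complex set"
  assumes "compact K" "K \<noteq> {}" "t > 0"
  shows "((\<lambda>z. max 0 (1 - t * infdist z K)) \<longlongrightarrow> 0) at_infinity"
proof -
  obtain R where R: "\<And>x. x \<in> K \<Longrightarrow> cmod x \<le> R"
    using compact_imp_bounded[OF assms(1)] by (auto simp: bounded_iff)
  have "\<forall>\<^sub>F z in at_infinity. max 0 (1 - t * infdist z K) = 0"
    unfolding eventually_at_infinity
  proof (intro exI[of _ "R + 1 / t"] allI impI)
    fix z :: complex assume z: "R + 1 / t \<le> cmod z"
    obtain x where x: "x \<in> K" "infdist z K = dist z x"
      using infdist_attains_inf[OF compact_imp_closed[OF assms(1)] assms(2), of z] by auto
    have "1 / t \<le> dist z x"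
      using z R[OF x(1)] norm_triangle_ineq2[of z x] by (simp add: dist_norm)
    then have "1 \<le> t * dist z x" using assms(3) by (simp add: divide_le_eq mult.commute)
    then show "max 0 (1 - t * infdist z K) = 0" using x by simp
  qed
  then show ?thesis by (rule tendsto_eventually)
qed

context green_setup
begin

text \<open>Up to a constant, the potential of the equilibrium measure for
  \<open>log_kernel\<close>. On \<open>K\<close>, where \<open>V\<close> vanishes, only the
  spherical weight is left.\<close>

definition potential_gap :: "complex \<Rightarrow> real" where
  "potential_gap z = ln (1 + (cmod z)\<^sup>2) - 2 * V z"

text \<open>Bernstein-Walsh for a linear polynomial vanishing at a point of \<open>K\<close>:
  \<open>V\<close> grows at least like ln |z|.\<close>

lemma potential_gap_upper: "\<exists>B. \<forall>z. potential_gap z \<le> B"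
proof -
  obtain a where a: "a \<in> K" using K_nonempty by auto
  obtain R where R: "R > 0" "\<And>x. x \<in> K \<Longrightarrow> cmod x \<le> R"
    using compact_imp_bounded[OF compact_K] by (auto simp: bounded_pos)
  define B where "B = 1 + 2 * (cmod a)\<^sup>2 + 8 * R\<^sup>2"
  have "potential_gap z \<le> ln B" for z
  proof -
    have "cmod (poly [:-a, 1:] z) \<le> (2 * R) * exp (real (degree [:-a, 1:]) * V z)"
    proof (rule bernstein_walsh)
      fix w assume "w \<in> K"
      then show "cmod (poly [:-a, 1:] w) \<le> 2 * R"
        using R(2)[of w] R(2)[OF a] norm_triangle_ineq4[of w a] by simp
    qed (use R in auto)
    then have za: "cmod (z - a) \<le> 2 * R * exp (V z)" by simp
    have "(cmod z)\<^sup>2 \<le> (cmod (z - a) + cmod a)\<^sup>2"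
      using norm_triangle_ineq[of "z - a" a] by (intro power_mono) auto
    also have "\<dots> \<le> 2 * (cmod (z - a))\<^sup>2 + 2 * (cmod a)\<^sup>2"
      using sum_squares_bound[of "cmod (z - a)" "cmod a"] by (simp add: power2_sum)
    also have "(cmod (z - a))\<^sup>2 \<le> (2 * R * exp (V z))\<^sup>2"
      using za by (intro power_mono) auto
    finally have "1 + (cmod z)\<^sup>2 \<le> (1 + 2 * (cmod a)\<^sup>2) * 1 + 8 * R\<^sup>2 * exp (2 * V z)"
      by (simp add: power_mult_distrib exp_double)
    also have "\<dots> \<le> (1 + 2 * (cmod a)\<^sup>2) * exp (2 * V z) + 8 * R\<^sup>2 * exp (2 * V z)"
      using V_nonneg[of z] by (intro add_mono mult_left_mono) auto
    also have "\<dots> = B * exp (2 * V z)" by (simp add: B_def algebra_simps)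
    finally have "ln (1 + (cmod z)\<^sup>2) \<le> ln (B * exp (2 * V z))"
      using one_plus_norm_sq_pos[of z] by (intro ln_mono) auto
    also have "\<dots> = ln B + 2 * V z"
    proof -
      have "B > 0" unfolding B_def by (intro add_pos_nonneg) auto
      then show ?thesis by (simp add: ln_mult)
    qed
    finally show ?thesis by (simp add: potential_gap_def)
  qed
  then show ?thesis by blast
qed

lemma measurable_potential_gap [measurable]: "potential_gap \<in> borel_measurable borel"
proof -
  have "1 + (cmod z)\<^sup>2 \<noteq> 0" for z using one_plus_norm_sq_pos[of z] by simp
  then show ?thesis
    unfolding potential_gap_def[abs_def]
    by (intro borel_measurable_continuous_onI continuous_intros continuous_V ballI) auto
qed

lemma integrable_potential_gap:
  assumes "finite_measure \<alpha>" "sets \<alpha> = sets borel" "\<And>z. 0 \<le> c + potential_gap z"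
  shows "integrable \<alpha> potential_gap"
proof -
  interpret finite_measure \<alpha> by fact
  note [measurable_cong] = assms(2)
  obtain B where B: "\<And>z. potential_gap z \<le> B" using potential_gap_upper by blast
  have "\<bar>potential_gap z\<bar> \<le> \<bar>B\<bar> + \<bar>c\<bar>" for z
    using B[of z] assms(3)[of z] by linarith
  then show ?thesis by (intro integrable_const_bound[of _ "\<bar>B\<bar> + \<bar>c\<bar>"]) auto
qed

text \<open>A vague limit of the normalised counting measures of near-Fekete points. No mass is
  lost, because all points lie in the compact set \<open>K\<close>.\<close>

theorem green_measure_exists:
  "\<exists>\<mu> C. prob_space \<mu> \<and> sets \<mu> = sets borel \<and> emeasure \<mu> (- K) = 0 \<and>
     (\<forall>z. 0 \<le> C + potential_gap z \<and> (\<integral>\<^sup>+w. log_kernel z w \<partial>\<mu>) = ennreal (C + potential_gap z))"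
proof -
  obtain W :: "nat \<Rightarrow> complex set" and c :: "nat \<Rightarrow> complex" where
    W: "\<And>n. W n \<subseteq> fekete_domain" "\<And>n. finite (W n)" "\<And>n. card (W n) = Suc n" and c: "\<And>n. c n \<noteq> 0"
    and up: "\<And>n z. cmod (poly (smult (c n) (\<Prod>b\<in>W n. [:-b, 1:])) z) \<le> exp (real (Suc n) * V z)"
    and lo: "\<And>z \<epsilon>. z \<notin> fekete_domain \<Longrightarrow> \<epsilon> > 0 \<Longrightarrow>
       \<forall>\<^sub>F n in sequentially. exp (real (Suc n) * (V z - \<epsilon>)) \<le> cmod (poly (smult (c n) (\<Prod>b\<in>W n. [:-b, 1:])) z)"
    using fekete_sequence by blast
  define F where "F n = smult (c n) (\<Prod>b\<in>W n. [:-b, 1:])" for n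
  obtain zs where zs: "\<And>n. set (zs n) = W n" "\<And>n. distinct (zs n)"
    using finite_distinct_list[OF W(2)] by metis
  have len: "length (zs n) \<le> Suc n" for n using distinct_card[OF zs(2)[of n]] zs(1) W(3) by simp
  have sumzs: "(\<Sum>z\<leftarrow>zs n. f z) = (\<Sum>z\<in>W n. f z :: real)" for f n
    using sum_list_distinct_conv_sum_set[OF zs(2)[of n]] zs(1) by simp
  obtain s \<Lambda> where s: "strict_mono s" and \<Lambda>: "finite_measure \<Lambda>" "sets \<Lambda> = sets borel" "measure \<Lambda> UNIV \<le> 1"
    and vague: "\<And>f :: complex \<Rightarrow> real. continuous_on UNIV f \<Longrightarrow> (f \<longlongrightarrow> 0) at_infinity \<Longrightarrow>
       (\<lambda>k. (\<Sum>z\<leftarrow>zs (s k). f z) / real (Suc (s k))) \<longlonglongrightarrow> (\<integral>z. f z \<partial>\<Lambda>)"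
    by (rule root_measures_vague_compact[of zs Suc, OF len zero_less_Suc]) (rule that; assumption)
  interpret L: finite_measure \<Lambda> by fact
  note [measurable_cong] = \<Lambda>(2)
  have sp: "space \<Lambda> = UNIV" using sets_eq_imp_space_eq[OF \<Lambda>(2)] by simp
  have WK: "W n \<subseteq> K" for n using W(1)[of n] by (auto simp: fekete_domain_def)
  \<comment> \<open>Test functions equal to 1 on \<open>K\<close> see the whole mass of every
    counting measure. As they shrink to the indicator of \<open>K\<close>, the limit is seen to have
    mass 1 on \<open>K\<close>.\<close>
  have "(\<integral>z. max 0 (1 - real (Suc k) * infdist z K) \<partial>\<Lambda>) = 1" for k
  proof (rule LIMSEQ_unique)
    let ?f = "\<lambda>z. max 0 (1 - real (Suc k) * infdist z K)"
    show "(\<lambda>k. (\<Sum>z\<leftarrow>zs (s k). ?f z) / real (Suc (s k))) \<longlonglongrightarrow> (\<integral>z. ?f z \<partial>\<Lambda>)"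
      by (intro vague continuous_intros infdist_vanishes_at_infinity compact_K K_nonempty) auto
    have "(\<Sum>z\<leftarrow>zs (s k). ?f z) = real (Suc (s k))" for k
    proof -
      have "infdist z K = 0" if "z \<in> W (s k)" for z using WK[of "s k"] that by auto
      then have "(\<Sum>z\<in>W (s k). ?f z) = (\<Sum>z\<in>W (s k). 1)"
        by (intro sum.cong) auto
      then show ?thesis unfolding sumzs using W(3) by simp
    qed
    then show "(\<lambda>k. (\<Sum>z\<leftarrow>zs (s k). ?f z) / real (Suc (s k))) \<longlonglongrightarrow> 1" by simp
  qed
  moreover have "(\<lambda>k. \<integral>z. max 0 (1 - real (Suc k) * infdist z K) \<partial>\<Lambda>) \<longlonglongrightarrow> (\<integral>z. indicator K z \<partial>\<Lambda>)"
  proof (rule integral_dominated_convergence[where w="\<lambda>_. 1"])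
    show "indicator K \<in> borel_measurable \<Lambda>"
      using compact_imp_closed[OF compact_K] by (intro borel_measurable_indicator) (simp add: \<Lambda>(2))
    show "AE z in \<Lambda>. (\<lambda>k. max 0 (1 - real (Suc k) * infdist z K)) \<longlonglongrightarrow> indicator K z"
    proof (rule AE_I2)
      fix z
      show "(\<lambda>k. max 0 (1 - real (Suc k) * infdist z K)) \<longlonglongrightarrow> indicator K z"
      proof (cases "z \<in> K")
        case False
        then have pos: "infdist z K > 0"
          using compact_imp_closed[OF compact_K] K_nonempty by (simp add: infdist_pos_not_in_closed)
        obtain N where N: "real N * infdist z K > 1" using reals_Archimedean3[OF pos] by blast
        have "max 0 (1 - real (Suc k) * infdist z K) = 0" if "k \<ge> N" for k
        proof -
          have "real N * infdist z K \<le> real (Suc k) * infdist z K"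
            using that pos by (intro mult_right_mono) auto
          then show ?thesis using N by simp
        qed
        then have "\<forall>\<^sub>F k in sequentially. max 0 (1 - real (Suc k) * infdist z K) = 0"
          by (auto simp: eventually_sequentially)
        then show ?thesis using False by (simp add: tendsto_eventually)
      qed simp
    qed
    show "(\<lambda>z. max 0 (1 - real (Suc k) * infdist z K)) \<in> borel_measurable \<Lambda>" for k
    proof -
      have "(\<lambda>z. max 0 (1 - real (Suc k) * infdist z K)) \<in> borel_measurable borel"
        by (intro borel_measurable_continuous_onI continuous_intros)
      then show ?thesis by measurable
    qed
  qed (auto simp: infdist_nonneg)
  ultimately have "(\<lambda>k::nat. 1) \<longlonglongrightarrow> (\<integral>z. indicator K z \<partial>\<Lambda> :: real)" by simp
  then have K1: "measure \<Lambda> K = 1"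
    using LIMSEQ_unique[OF tendsto_const] sp by (simp add: LIMSEQ_const_iff)
  have KS: "K \<in> sets \<Lambda>" using compact_imp_closed[OF compact_K] by (simp add: \<Lambda>(2))
  have U1: "measure \<Lambda> UNIV = 1"
    using \<Lambda>(3) K1 L.finite_measure_mono[of K UNIV] KS by (simp add: \<Lambda>(2))
  have prob: "prob_space \<Lambda>"
    by (rule prob_spaceI) (use U1 sp in \<open>simp add: L.emeasure_eq_measure\<close>)
  have "measure \<Lambda> (- K) = measure \<Lambda> UNIV - measure \<Lambda> K"
    using L.finite_measure_compl[OF KS] sp by (simp add: Compl_eq_Diff_UNIV)
  then have nullK: "emeasure \<Lambda> (- K) = 0" using U1 K1 by (simp add: L.emeasure_eq_measure)
  have pr: "proots (F n) = (\<Sum>x\<in>W n. {#x#})" for n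
    unfolding F_def using c[of n] W(2)[of n] by (simp add: proots_prod)
  have "\<exists>C. \<forall>z. 0 \<le> 2 * C - 2 * V z + measure \<Lambda> UNIV * ln (1 + (cmod z)\<^sup>2) \<and>
     (\<integral>\<^sup>+w. log_kernel z w \<partial>\<Lambda>) = ennreal (2 * C - 2 * V z + measure \<Lambda> UNIV * ln (1 + (cmod z)\<^sup>2))"
  proof (rule root_measures_potential[where P="\<lambda>k. F (s k)" and n="\<lambda>k. Suc (s k)" and \<epsilon>="\<lambda>_. 0" and D="- fekete_domain"])
    show "F (s k) \<noteq> 0" for k unfolding F_def using c W(2) by simp
    show "cmod (poly (F (s k)) z) \<le> exp (real (Suc (s k)) * (V z + 0))" for k z
      using up[of "s k" z] by (simp add: F_def)
    show "\<forall>\<^sub>F k in sequentially. exp (real (Suc (s k)) * (V z - \<delta>)) \<le> cmod (poly (F (s k)) z)"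
      if "z \<in> - fekete_domain" "\<delta> > 0" for z \<delta>
      using eventually_compose_filterlim[OF lo[of z \<delta>] filterlim_subseq[OF s]] that by (simp add: F_def)
    show "(\<lambda>k. (\<Sum>z\<in>#proots (F (s k)). f z) / real (Suc (s k))) \<longlonglongrightarrow> (\<integral>z. f z \<partial>\<Lambda>)"
      if "continuous_on UNIV f" "(f \<longlongrightarrow> 0) at_infinity" for f :: "complex \<Rightarrow> real"
      using vague[OF that] unfolding pr sumzs sum_mset_singletons[OF W(2)] .
  qed (use continuous_V fekete_domain_interior \<Lambda> in auto)
  then obtain C where C: "\<And>z. 0 \<le> 2 * C + potential_gap z \<and> (\<integral>\<^sup>+w. log_kernel z w \<partial>\<Lambda>) = ennreal (2 * C + potential_gap z)"
    unfolding U1 potential_gap_def by (auto simp: algebra_simps)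
  then show ?thesis using prob \<Lambda>(2) nullK by blast
qed

definition green_measure :: "complex measure" where
  "green_measure = (SOME \<mu>. \<exists>C. prob_space \<mu> \<and> sets \<mu> = sets borel \<and> emeasure \<mu> (- K) = 0 \<and>
     (\<forall>z. 0 \<le> C + potential_gap z \<and> (\<integral>\<^sup>+w. log_kernel z w \<partial>\<mu>) = ennreal (C + potential_gap z)))"

definition green_const :: real where
  "green_const = (SOME C. \<forall>z. 0 \<le> C + potential_gap z \<and>
     (\<integral>\<^sup>+w. log_kernel z w \<partial>green_measure) = ennreal (C + potential_gap z))"

lemma green_measure:
  shows "prob_space green_measure" "sets green_measure = sets borel" "emeasure green_measure (- K) = 0"
    "0 \<le> green_const + potential_gap z"
    "(\<integral>\<^sup>+w. log_kernel z w \<partial>green_measure) = ennreal (green_const + potential_gap z)"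
proof -
  have *: "\<exists>C. prob_space green_measure \<and> sets green_measure = sets borel \<and> emeasure green_measure (- K) = 0 \<and>
     (\<forall>z. 0 \<le> C + potential_gap z \<and> (\<integral>\<^sup>+w. log_kernel z w \<partial>green_measure) = ennreal (C + potential_gap z))"
    unfolding green_measure_def using green_measure_exists by (rule someI_ex)
  then show "prob_space green_measure" "sets green_measure = sets borel" "emeasure green_measure (- K) = 0"
    by blast+
  from * have "\<exists>C. \<forall>z. 0 \<le> C + potential_gap z \<and> (\<integral>\<^sup>+w. log_kernel z w \<partial>green_measure) = ennreal (C + potential_gap z)"
    by blast
  then have "\<forall>z. 0 \<le> green_const + potential_gap z \<and> (\<integral>\<^sup>+w. log_kernel z w \<partial>green_measure) = ennreal (green_const + potential_gap z)"
    unfolding green_const_def by (rule someI_ex)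
  then show "0 \<le> green_const + potential_gap z"
    "(\<integral>\<^sup>+w. log_kernel z w \<partial>green_measure) = ennreal (green_const + potential_gap z)" by auto
qed

lemma finite_green_measure: "finite_measure green_measure"
  using green_measure(1) by (simp add: prob_space_def)

lemma measure_green_UNIV: "measure green_measure UNIV = 1"
  using prob_space.prob_space[OF green_measure(1)] sets_eq_imp_space_eq[OF green_measure(2)] by simp

text \<open>The potential stays nonnegative while \<open>V\<close> grows at least like ln |z|, which
  forces total mass 1. The mixed energy can then be computed from either potential; its symmetry
  makes the quadratic form of the difference vanish.\<close>

theorem green_measure_unique:
  assumes \<Lambda>: "finite_measure \<Lambda>" "sets \<Lambda> = sets borel" "measure \<Lambda> UNIV \<le> 1"
    and p: "\<And>z. 0 \<le> C - 2 * V z + measure \<Lambda> UNIV * ln (1 + (cmod z)\<^sup>2)"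
      "\<And>z. (\<integral>\<^sup>+w. log_kernel z w \<partial>\<Lambda>) = ennreal (C - 2 * V z + measure \<Lambda> UNIV * ln (1 + (cmod z)\<^sup>2))"
  shows "\<Lambda> = green_measure"
proof -
  define m where "m = measure \<Lambda> UNIV"
  obtain B where B: "\<And>z. potential_gap z \<le> B" using potential_gap_upper by blast
  have m1: "m = 1"
  proof (rule ccontr)
    assume "m \<noteq> 1"
    then have d: "1 - m > 0" using \<Lambda>(3) by (simp add: m_def)
    have bd: "(1 - m) * ln (1 + (cmod z)\<^sup>2) \<le> C + B" for z
      using p(1)[of z] B[of z] by (simp add: potential_gap_def m_def algebra_simps)
    have "filterlim (\<lambda>x::real. (1 - m) * ln (1 + x\<^sup>2)) at_top at_top"
      using d by real_asymp
    then have "\<forall>\<^sub>F x in at_top. (1 - m) * ln (1 + x\<^sup>2) > C + B"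
      by (simp add: filterlim_at_top_dense)
    then obtain x0 where x0: "\<And>x. x \<ge> x0 \<Longrightarrow> (1 - m) * ln (1 + x\<^sup>2) > C + B"
      by (auto simp: eventually_at_top_linorder)
    from x0[of x0] bd[of "complex_of_real x0"] show False by simp
  qed
  have p': "0 \<le> C + potential_gap z" "(\<integral>\<^sup>+w. log_kernel z w \<partial>\<Lambda>) = ennreal (C + potential_gap z)" for z
    using p[of z] m1 by (simp_all add: potential_gap_def m_def algebra_simps)
  let ?\<mu> = green_measure and ?c = green_const
  note \<mu> = finite_green_measure green_measure(2)
  note i\<Lambda> = integrable_potential_gap[OF \<Lambda>(1,2) p'(1)]
  note i\<mu> = integrable_potential_gap[OF \<mu> p'(1)]
  have ELL: "log_energy2 \<Lambda> \<Lambda> = ennreal (C + (\<integral>z. potential_gap z \<partial>\<Lambda>))" "0 \<le> C + (\<integral>z. potential_gap z \<partial>\<Lambda>)"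
    using log_energy2_of_potential[OF \<Lambda>(1,2) p'(2) _ i\<Lambda>] p'(1) m1 by (auto simp: m_def)
  have ELG: "log_energy2 \<Lambda> ?\<mu> = ennreal (?c + (\<integral>z. potential_gap z \<partial>\<Lambda>))" "0 \<le> ?c + (\<integral>z. potential_gap z \<partial>\<Lambda>)"
    using log_energy2_of_potential[OF \<Lambda>(1,2) green_measure(5) _ i\<Lambda>] green_measure(4) m1 by (auto simp: m_def)
  have EGL: "log_energy2 ?\<mu> \<Lambda> = ennreal (C + (\<integral>z. potential_gap z \<partial>?\<mu>))" "0 \<le> C + (\<integral>z. potential_gap z \<partial>?\<mu>)"
    using log_energy2_of_potential[OF \<mu> p'(2) _ i\<mu>] p'(1) measure_green_UNIV by auto
  have EGG: "log_energy2 ?\<mu> ?\<mu> = ennreal (?c + (\<integral>z. potential_gap z \<partial>?\<mu>))" "0 \<le> ?c + (\<integral>z. potential_gap z \<partial>?\<mu>)"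
    using log_energy2_of_potential[OF \<mu> green_measure(5) _ i\<mu>] green_measure(4) measure_green_UNIV by auto
  have "log_energy2 \<Lambda> ?\<mu> = log_energy2 ?\<mu> \<Lambda>"
    by (rule log_energy2_sym[OF \<Lambda>(1,2) \<mu>])
  then have "?c + (\<integral>z. potential_gap z \<partial>\<Lambda>) = C + (\<integral>z. potential_gap z \<partial>?\<mu>)"
    using ELG EGL by simp
  then show ?thesis
    using ELL ELG EGG
    by (intro log_energy2_positive_definite(2)[OF \<Lambda>(1,2) \<mu>]) auto
qed

end

section \<open>Identification of the energy minimizer\<close>

lemma measurable_elog [measurable]: "elog \<in> borel_measurable borel"
  unfolding elog_def[abs_def] by measurable

text \<open>Relates the chordal to the Euclidean logarithm. Positive and negative parts are placed
  on opposite sides, so that no subtraction in \<open>ennreal\<close> occurs and both sides are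
  infinite on the diagonal.\<close>

lemma log_kernel_split:
  "log_kernel z t + 2 * e2ennreal (elog (cmod (z - t))) =
    2 * e2ennreal (- elog (cmod (z - t))) + ennreal (ln (1 + (cmod z)\<^sup>2)) + ennreal (ln (1 + (cmod t)\<^sup>2))"
proof (cases "z = t")
  case True
  have [simp]: "2 * (top::ennreal) = top" by (simp add: ennreal_mult_top)
  then show ?thesis using True by (simp add: log_kernel_diag elog_def e2ennreal_infty top_add)
next
  case False
  define l where "l = ln (cmod (z - t))"
  have el: "elog (cmod (z - t)) = ereal l" using False by (simp add: elog_def l_def)
  define A B where "A = ln (1 + (cmod z)\<^sup>2)" and "B = ln (1 + (cmod t)\<^sup>2)"
  have AB: "A \<ge> 0" "B \<ge> 0" by (simp_all add: A_def B_def)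
  have pos: "1 + (cmod z)\<^sup>2 > 0" "1 + (cmod t)\<^sup>2 > 0" "cmod (z - t) > 0"
    using one_plus_norm_sq_pos False by auto
  have "ln (1 - sph_kernel z t) = 2 * l - (A + B)"
    unfolding one_minus_sph_kernel using pos by (simp add: ln_div ln_mult ln_realpow l_def A_def B_def)
  then have k: "log_kernel z t = ennreal (A + B - 2 * l)"
    unfolding log_kernel_off_diag[OF False] by simp
  have "1 - sph_kernel z t \<le> 1" "1 - sph_kernel z t > 0" using sph_kernel_less_1[OF False] by simp_all
  then have k0: "A + B - 2 * l \<ge> 0" using \<open>ln (1 - sph_kernel z t) = _\<close> ln_le_zero_iff[of "1 - sph_kernel z t"] by simp
  have 2: "2 * ennreal x = ennreal (2 * x)" for x
    by (metis ennreal_mult' ennreal_numeral zero_le_numeral)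
  show ?thesis
  proof (cases "l \<ge> 0")
    case True
    then show ?thesis
      unfolding el k A_def[symmetric] B_def[symmetric] using AB k0
      by (simp add: e2ennreal_ereal ennreal_neg 2 flip: ennreal_plus)
  next
    case False
    then show ?thesis
      unfolding el k A_def[symmetric] B_def[symmetric] using AB k0
      by (simp add: e2ennreal_ereal ennreal_neg 2 flip: ennreal_plus)
  qed
qed

text \<open>Integrating \<open>log_kernel_split\<close> twice shows that the chordal energy is twice
  the logarithmic energy plus twice the integral \<open>G\<close> of the spherical weight.\<close>

lemma log_energy_eq_log_energy2:
  assumes K: "compact K" and \<nu>: "prob_space \<nu>" "borel_measure_on K \<nu>"
  defines "G \<equiv> (\<integral>z. ln (1 + (cmod z)\<^sup>2) \<partial>\<nu>)"
  shows "log_energy2 \<nu> \<nu> = \<infinity> \<Longrightarrow> log_energy \<nu> = \<infinity>"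
    and "log_energy2 \<nu> \<nu> < \<infinity> \<Longrightarrow> log_energy \<nu> = ereal (enn2real (log_energy2 \<nu> \<nu>) / 2 - G)"
    and "integrable \<nu> (\<lambda>z. ln (1 + (cmod z)\<^sup>2))"
proof -
  interpret prob_space \<nu> by fact
  have s: "sets \<nu> = sets borel" and nullK: "emeasure \<nu> (- K) = 0"
    using \<nu>(2) by (auto simp: borel_measure_on_def)
  note [measurable_cong] = s
  have AEK: "AE z in \<nu>. z \<in> K"
  proof (rule AE_I)
    show "{z \<in> space \<nu>. \<not> z \<in> K} \<subseteq> - K" by auto
    show "emeasure \<nu> (- K) = 0" by fact
    show "- K \<in> sets \<nu>" using compact_imp_closed[OF K] by (auto simp: s)
  qed
  obtain R where R: "R > 0" "\<And>x. x \<in> K \<Longrightarrow> cmod x \<le> R"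
    using compact_imp_bounded[OF K] by (auto simp: bounded_pos)
  define g where "g z = ln (1 + (cmod z)\<^sup>2)" for z :: complex
  have [measurable]: "g \<in> borel_measurable borel" unfolding g_def by measurable
  have g0: "g z \<ge> 0" for z by (simp add: g_def)
  have gR: "g z \<le> ln (1 + R\<^sup>2)" if "z \<in> K" for z
    unfolding g_def using R that one_plus_norm_sq_pos[of z] by (intro ln_mono) (auto intro: power_mono)
  have ig: "integrable \<nu> g"
    by (rule integrable_const_bound[of _ "ln (1 + R\<^sup>2)"]) (use AEK gR g0 in auto)
  then show "integrable \<nu> (\<lambda>z. ln (1 + (cmod z)\<^sup>2))" by (simp add: g_def[abs_def])
  have G0: "G \<ge> 0" unfolding G_def using g0 by (intro integral_nonneg_AE) (auto simp: g_def)
  have gG: "(\<integral>\<^sup>+z. ennreal (g z) \<partial>\<nu>) = ennreal G"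
  proof -
    have "G = (\<integral>z. g z \<partial>\<nu>)" by (simp add: G_def g_def)
    then show ?thesis using ig g0 by (simp add: nn_integral_eq_integral)
  qed
  define P where "P = (\<integral>\<^sup>+z. (\<integral>\<^sup>+t. e2ennreal (- elog (cmod (z - t))) \<partial>\<nu>) \<partial>\<nu>)"
  define Q where "Q = (\<integral>\<^sup>+z. (\<integral>\<^sup>+t. e2ennreal (elog (cmod (z - t))) \<partial>\<nu>) \<partial>\<nu>)"
  have E: "log_energy \<nu> = enn2ereal P - enn2ereal Q" by (simp add: log_energy_def P_def Q_def)
  have mP1: "(\<lambda>t. e2ennreal (- elog (cmod (z - t)))) \<in> borel_measurable \<nu>"
    and mQ1: "(\<lambda>t. e2ennreal (elog (cmod (z - t)))) \<in> borel_measurable \<nu>"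
    and mK1: "log_kernel z \<in> borel_measurable \<nu>" for z
    by measurable
  have mP2: "(\<lambda>z. \<integral>\<^sup>+t. e2ennreal (- elog (cmod (z - t))) \<partial>\<nu>) \<in> borel_measurable \<nu>"
    and mQ2: "(\<lambda>z. \<integral>\<^sup>+t. e2ennreal (elog (cmod (z - t))) \<partial>\<nu>) \<in> borel_measurable \<nu>"
    and mK2: "(\<lambda>z. \<integral>\<^sup>+t. log_kernel z t \<partial>\<nu>) \<in> borel_measurable \<nu>"
    by measurable
  have "log_energy2 \<nu> \<nu> + 2 * Q = (\<integral>\<^sup>+z. (\<integral>\<^sup>+t. log_kernel z t + 2 * e2ennreal (elog (cmod (z - t))) \<partial>\<nu>) \<partial>\<nu>)"
    unfolding log_energy2_def Q_def using mQ1 mQ2 mK1 mK2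
    by (simp add: nn_integral_add nn_integral_cmult)
  also have "\<dots> = (\<integral>\<^sup>+z. (\<integral>\<^sup>+t. 2 * e2ennreal (- elog (cmod (z - t))) + ennreal (g z) + ennreal (g t) \<partial>\<nu>) \<partial>\<nu>)"
    unfolding log_kernel_split g_def ..
  also have "\<dots> = (\<integral>\<^sup>+z. (2 * (\<integral>\<^sup>+t. e2ennreal (- elog (cmod (z - t))) \<partial>\<nu>) + ennreal (g z) + ennreal G) \<partial>\<nu>)"
    using mP1 by (simp add: nn_integral_add nn_integral_cmult gG emeasure_space_1)
  also have "\<dots> = 2 * P + ennreal G + ennreal G"
    unfolding P_def using mP2 by (simp add: nn_integral_add nn_integral_cmult gG emeasure_space_1)
  finally have main: "log_energy2 \<nu> \<nu> + 2 * Q = 2 * P + ennreal G + ennreal G" .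
  \<comment> \<open>Distances within \<open>K\<close> are bounded, so only \<open>P\<close> can be
    infinite and no difference of infinities arises.\<close>
  have Qfin: "Q \<noteq> \<infinity>"
  proof -
    have b: "e2ennreal (elog (cmod (z - t))) \<le> ennreal (2 * R)" if "z \<in> K" "t \<in> K" for z t
    proof (cases "z = t")
      case False
      have "ln (cmod (z - t)) \<le> cmod (z - t)" using False ln_le_minus_one[of "cmod (z - t)"] by simp
      also have "\<dots> \<le> 2 * R" using R(2)[OF that(1)] R(2)[OF that(2)] norm_triangle_ineq4[of z t] by simp
      finally show ?thesis using False by (simp add: elog_def e2ennreal_ereal ennreal_leI)
    qed (simp add: elog_def e2ennreal_neg)
    have "Q \<le> (\<integral>\<^sup>+z. (\<integral>\<^sup>+t. ennreal (2 * R) \<partial>\<nu>) \<partial>\<nu>)"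
      unfolding Q_def
    proof (rule nn_integral_mono_AE)
      show "AE z in \<nu>. (\<integral>\<^sup>+t. e2ennreal (elog (cmod (z - t))) \<partial>\<nu>) \<le> (\<integral>\<^sup>+t. ennreal (2 * R) \<partial>\<nu>)"
        using AEK
      proof eventually_elim
        case (elim z)
        show ?case
          by (rule nn_integral_mono_AE) (use AEK in eventually_elim, use b elim in auto)
      qed
    qed
    also have "\<dots> = ennreal (2 * R)" by (simp add: emeasure_space_1)
    finally show ?thesis by (auto simp: top_unique)
  qed
  obtain q where q: "Q = ennreal q" "q \<ge> 0" using Qfin by (cases Q) auto
  {
    assume "log_energy2 \<nu> \<nu> = \<infinity>"
    then have "2 * P + ennreal G + ennreal G = \<infinity>" using main by simp
    then have "P = \<infinity>" by (cases P) (auto simp: ennreal_mult_eq_top_iff)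
    then show "log_energy \<nu> = \<infinity>" unfolding E q by simp
  next
    assume "log_energy2 \<nu> \<nu> < \<infinity>"
    then obtain i where i: "log_energy2 \<nu> \<nu> = ennreal i" "i \<ge> 0" by (cases "log_energy2 \<nu> \<nu>") auto
    have two: "2 * ennreal x = ennreal (2 * x)" for x
      by (metis ennreal_mult' ennreal_numeral zero_le_numeral)
    have e1: "2 * P + ennreal G + ennreal G = ennreal (i + 2 * q)"
      unfolding main[symmetric] i q two using i q by (simp flip: ennreal_plus)
    then have "P \<noteq> \<infinity>" by (auto simp: ennreal_mult_top)
    then obtain p where p: "P = ennreal p" "p \<ge> 0" by (cases P) auto
    have e2: "2 * P + ennreal G + ennreal G = ennreal (2 * p + G + G)"
      unfolding p two using p G0 by (simp flip: ennreal_plus)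
    have "ennreal (2 * p + G + G) = ennreal (i + 2 * q)" by (rule e2[symmetric, THEN trans, OF e1])
    then have "2 * p + G + G = i + 2 * q"
      by (rule ennreal_inj[THEN iffD1, rotated 2]) (use p G0 i q in auto)
    then show "log_energy \<nu> = ereal (enn2real (log_energy2 \<nu> \<nu>) / 2 - G)"
      unfolding E p q i using p q i by (simp add: field_simps)
  }
qed

context green_setup
begin

text \<open>Since \<open>V\<close> vanishes on \<open>K\<close>, the mixed energy of
  \<open>\<nu>\<close> with \<open>green_measure\<close> is \<open>green_const\<close> plus the
  weight integral of \<open>\<nu>\<close>. Hence, when finite, the energy of \<open>\<nu>\<close>
  exceeds that of \<open>green_measure\<close> by half the quadratic form, which is positive unless
  the measures agree.\<close>

theorem equilibrium_measure_eq: "equilibrium_measure K = green_measure"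
proof -
  let ?\<mu> = green_measure and ?c = green_const
  define G where "G \<nu> = (\<integral>z. ln (1 + (cmod z)\<^sup>2) \<partial>\<nu>)" for \<nu> :: "complex measure"
  note \<mu> = finite_green_measure green_measure(2)
  have \<mu>K: "borel_measure_on K ?\<mu>" using green_measure by (simp add: borel_measure_on_def)
  have I\<mu>: "log_energy2 \<nu> ?\<mu> = ennreal (?c + G \<nu>) \<and> 0 \<le> ?c + G \<nu>"
    if \<nu>: "prob_space \<nu>" "borel_measure_on K \<nu>" for \<nu>
  proof -
    interpret prob_space \<nu> by fact
    have s: "sets \<nu> = sets borel" and nullK: "emeasure \<nu> (- K) = 0"
      using \<nu>(2) by (auto simp: borel_measure_on_def)
    have sp: "space \<nu> = UNIV" using sets_eq_imp_space_eq[OF s] by simp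
    have AEK: "AE z in \<nu>. z \<in> K"
      by (rule AE_I[of _ _ "- K"]) (use nullK compact_imp_closed[OF compact_K] s in auto)
    have eq: "(\<integral>z. potential_gap z \<partial>\<nu>) = G \<nu>"
      unfolding G_def
    proof (rule integral_cong_AE)
      show "AE z in \<nu>. potential_gap z = ln (1 + (cmod z)\<^sup>2)"
        using AEK by eventually_elim (simp add: potential_gap_def V_on_K)
      show "potential_gap \<in> borel_measurable \<nu>" using measurable_potential_gap s by measurable
      show "(\<lambda>z. ln (1 + (cmod z)\<^sup>2)) \<in> borel_measurable \<nu>" using s by measurable
    qed
    show ?thesis
      using log_energy2_of_potential[OF finite_measure_axioms s green_measure(5) _
          integrable_potential_gap[OF finite_measure_axioms s green_measure(4)]] green_measure(4) eq
        prob_space sp by auto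
  qed
  have II: "log_energy2 ?\<mu> ?\<mu> = ennreal (?c + G ?\<mu>)" "0 \<le> ?c + G ?\<mu>"
    using I\<mu>[OF green_measure(1) \<mu>K] by auto
  have E\<mu>: "log_energy ?\<mu> = ereal ((?c + G ?\<mu>) / 2 - G ?\<mu>)"
    using log_energy_eq_log_energy2(2)[OF compact_K green_measure(1) \<mu>K] II by (simp add: G_def)
  have main: "log_energy ?\<mu> \<le> log_energy \<nu> \<and> (log_energy \<nu> \<le> log_energy ?\<mu> \<longrightarrow> \<nu> = ?\<mu>)"
    if \<nu>: "prob_space \<nu>" "borel_measure_on K \<nu>" for \<nu>
  proof (cases "log_energy2 \<nu> \<nu> = \<infinity>")
    case True
    then show ?thesis using log_energy_eq_log_energy2(1)[OF compact_K \<nu>] E\<mu> by simp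
  next
    case False
    then have fin: "log_energy2 \<nu> \<nu> < \<infinity>" by (simp add: less_top)
    have f\<nu>: "finite_measure \<nu>" "sets \<nu> = sets borel"
      using \<nu> by (auto simp: prob_space_def borel_measure_on_def)
    note E\<nu> = log_energy_eq_log_energy2(2)[OF compact_K \<nu> fin, folded G_def]
    note pd = log_energy2_positive_definite[OF f\<nu> \<mu> fin]
    have D: "enn2real (log_energy2 \<nu> \<nu>) - 2 * enn2real (log_energy2 \<nu> ?\<mu>) + enn2real (log_energy2 ?\<mu> ?\<mu>)
       = enn2real (log_energy2 \<nu> \<nu>) - 2 * (?c + G \<nu>) + (?c + G ?\<mu>)"
      using I\<mu>[OF \<nu>] II by simp
    have "0 \<le> enn2real (log_energy2 \<nu> \<nu>) - 2 * (?c + G \<nu>) + (?c + G ?\<mu>)"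
      using pd(1) I\<mu>[OF \<nu>] II unfolding D by simp
    moreover have "\<nu> = ?\<mu>" if "enn2real (log_energy2 \<nu> \<nu>) - 2 * (?c + G \<nu>) + (?c + G ?\<mu>) = 0"
      using pd(2) I\<mu>[OF \<nu>] II that unfolding D by simp
    ultimately show ?thesis unfolding E\<nu> E\<mu> by (auto simp: field_simps)
  qed
  have "energy_minimizer K ?\<mu>"
    unfolding energy_minimizer_def using main green_measure(1) \<mu>K by blast
  moreover have "\<nu> = ?\<mu>" if "energy_minimizer K \<nu>" for \<nu>
    using that main green_measure(1) \<mu>K unfolding energy_minimizer_def by blast
  ultimately show ?thesis unfolding equilibrium_measure_def by (rule the_equality)
qed

end

section \<open>Weak* convergence of zero measures\<close>

lemma sum_mset_eq_sum_count:
  fixes f :: "'a \<Rightarrow> real"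
  assumes "finite S" "set_mset A \<subseteq> S"
  shows "(\<Sum>z\<in>#A. f z) = (\<Sum>z\<in>S. real (count A z) * f z)"
  using assms(2)
proof (induction A)
  case (add x A)
  have "(\<Sum>z\<in>S. real (count (add_mset x A) z) * f z) = (\<Sum>z\<in>S. real (count A z) * f z + (if z = x then f x else 0))"
    by (intro sum.cong refl) (simp add: algebra_simps)
  also have "\<dots> = (\<Sum>z\<in>S. real (count A z) * f z) + f x"
    using add.prems assms(1) by (simp add: sum.distrib)
  finally show ?case using add by simp
qed simp

lemma zero_measure_props:
  assumes "p \<noteq> 0"
  shows "finite_measure (zero_measure n p)" "sets (zero_measure n p) = sets borel"
    and "f \<in> borel_measurable borel \<Longrightarrow> (\<integral>z. f z \<partial>zero_measure n p) = (\<Sum>z\<in>#proots p. f z) / real n"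
proof -
  let ?Z = "{z. poly p z = 0}"
  have fin: "finite ?Z" by (rule poly_roots_finite[OF assms])
  have zm: "zero_measure n p = distr (point_measure ?Z (\<lambda>z. ennreal (real (order z p) / real n))) borel (\<lambda>z. z)"
    using assms by (simp add: zero_measure_def)
  show "sets (zero_measure n p) = sets borel" by (simp add: zm)
  have "emeasure (point_measure ?Z (\<lambda>z. ennreal (real (order z p) / real n))) ?Z \<noteq> \<infinity>"
    using fin by (subst emeasure_point_measure_finite) auto
  then show "finite_measure (zero_measure n p)"
    unfolding zm by (intro finite_measure.finite_measure_distr finite_measureI) (auto simp: space_point_measure)
  assume "f \<in> borel_measurable borel"
  then have "(\<integral>z. f z \<partial>zero_measure n p) = (\<Sum>z\<in>?Z. real (order z p) / real n * f z)"
    unfolding zm by (subst integral_distr) (auto simp: lebesgue_integral_point_measure_finite fin)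
  also have "\<dots> = (\<Sum>z\<in>?Z. real (count (proots p) z) * f z) / real n"
    using assms by (simp add: sum_divide_distrib)
  also have "(\<Sum>z\<in>?Z. real (count (proots p) z) * f z) = (\<Sum>z\<in>#proots p. f z)"
    using fin assms by (intro sum_mset_eq_sum_count[symmetric]) auto
  finally show "(\<integral>z. f z \<partial>zero_measure n p) = (\<Sum>z\<in>#proots p. f z) / real n" .
qed

text \<open>For a generating set the claim is convergence of a single integral; intersections and
  unions follow by induction over the generated topology.\<close>

lemma eventually_in_weak_star_open:
  assumes U: "openin weak_star_topology U" "\<mu> \<in> U"
    and \<nu>: "\<And>k. finite_measure (\<nu> k)" "\<And>k. sets (\<nu> k) = sets borel"
    and conv: "\<And>f :: complex \<Rightarrow> real. continuous_on UNIV f \<Longrightarrow> bounded (range f) \<Longrightarrow>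
       ((\<lambda>k. \<integral>z. f z \<partial>\<nu> k) \<longlongrightarrow> (\<integral>z. f z \<partial>\<mu>)) F"
  shows "\<forall>\<^sub>F k in F. \<nu> k \<in> U"
proof -
  define S where "S = {{\<mu>. finite_measure \<mu> \<and> sets \<mu> = sets borel \<and> (\<integral>z. f z \<partial>\<mu>) \<in> V} | f V.
        continuous_on UNIV (f :: complex \<Rightarrow> real) \<and> bounded (range f) \<and> open (V :: real set)}"
  have "generate_topology_on S U"
    using U(1) unfolding weak_star_topology_def S_def[symmetric] openin_topology_generated_by_iff .
  then show ?thesis
    using U(2)
  proof induction
    case (Int a b)
    then show ?case by (auto intro: eventually_conj elim: eventually_elim2)
  next
    case (UN K)
    then obtain k where "k \<in> K" "\<mu> \<in> k" by blast
    with UN have "\<forall>\<^sub>F x in F. \<nu> x \<in> k" by blast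
    then show ?case by eventually_elim (use \<open>k \<in> K\<close> in blast)
  next
    case (Basis s)
    then obtain f :: "complex \<Rightarrow> real" and V where f: "continuous_on UNIV f" "bounded (range f)" "open V"
      and s: "s = {\<mu>. finite_measure \<mu> \<and> sets \<mu> = sets borel \<and> (\<integral>z. f z \<partial>\<mu>) \<in> V}"
      unfolding S_def mem_Collect_eq by (elim exE conjE) (rule that; assumption)
    have "\<forall>\<^sub>F k in F. (\<integral>z. f z \<partial>\<nu> k) \<in> V"
      using Basis(2) s by (intro topological_tendstoD[OF conv[OF f(1,2)] f(3)]) auto
    then show ?case by eventually_elim (use \<nu> s in auto)
  qed simp
qed

context green_setup
begin

text \<open>Passes from test functions vanishing at infinity to bounded ones. A cutoff equal to 1 on
  \<open>K\<close> captures mass tending to 1, while \<open>degree (P k) \<le> n k\<close> limits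
  the total mass to 1; so what lies outside the cutoff is negligible.\<close>

lemma zero_measures_converge:
  fixes f :: "complex \<Rightarrow> real"
  assumes P: "\<And>k. P k \<noteq> 0" "\<And>k. degree (P k) \<le> n k" "\<And>k. n k > 0"
    and vague: "\<And>f :: complex \<Rightarrow> real. continuous_on UNIV f \<Longrightarrow> (f \<longlongrightarrow> 0) at_infinity \<Longrightarrow>
       (\<lambda>k. (\<Sum>z\<in>#proots (P k). f z) / real (n k)) \<longlonglongrightarrow> (\<integral>z. f z \<partial>green_measure)"
    and f: "continuous_on UNIV f" "bounded (range f)"
  shows "(\<lambda>k. \<integral>z. f z \<partial>zero_measure (n k) (P k)) \<longlonglongrightarrow> (\<integral>z. f z \<partial>green_measure)"
proof -
  interpret G: prob_space green_measure by (rule green_measure(1))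
  define cutoff where "cutoff z = max 0 (1 - 1 * infdist z K)" for z
  have cutoff: "continuous_on UNIV cutoff" "(cutoff \<longlongrightarrow> 0) at_infinity"
    unfolding cutoff_def[abs_def] using infdist_vanishes_at_infinity[OF compact_K K_nonempty, of 1]
    by (auto intro!: continuous_intros)
  have cut_01: "0 \<le> cutoff z" "cutoff z \<le> 1" for z by (auto simp: cutoff_def infdist_nonneg)
  have cut_K: "cutoff z = 1" if "z \<in> K" for z using that by (simp add: cutoff_def)
  obtain B where B: "\<And>z. \<bar>f z\<bar> \<le> B" "B > 0"
    using f(2) unfolding bounded_pos by auto
  have [measurable]: "f \<in> borel_measurable borel" by (rule borel_measurable_continuous_onI[OF f(1)])
  have [measurable]: "cutoff \<in> borel_measurable borel" by (rule borel_measurable_continuous_onI[OF cutoff(1)])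
  have AEK: "AE z in green_measure. z \<in> K"
    by (rule AE_I[of _ _ "- K"])
      (use green_measure(3) compact_imp_closed[OF compact_K] green_measure(2) in auto)
  note [measurable_cong] = green_measure(2)
  have "(\<integral>z. cutoff z \<partial>green_measure) = (\<integral>z. 1 \<partial>green_measure)"
    by (rule integral_cong_AE) (use AEK cut_K in auto)
  then have i1: "(\<integral>z. cutoff z \<partial>green_measure) = 1" by (simp add: G.prob_space)
  have i2: "(\<integral>z. f z * cutoff z \<partial>green_measure) = (\<integral>z. f z \<partial>green_measure)"
    by (rule integral_cong_AE) (use AEK cut_K in auto)
  have cut_f0: "((\<lambda>z. f z * cutoff z) \<longlongrightarrow> 0) at_infinity"
  proof (rule Lim_null_comparison)
    show "\<forall>\<^sub>F z in at_infinity. norm (f z * cutoff z) \<le> B * cutoff z"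
      using B cut_01 by (intro always_eventually) (auto simp: abs_mult intro!: mult_mono)
    show "((\<lambda>z. B * cutoff z) \<longlongrightarrow> 0) at_infinity" using tendsto_mult_right_zero[OF cutoff(2)] by simp
  qed
  define S where "S k h = (\<Sum>z\<in>#proots (P k). h z) / real (n k)" for k and h :: "complex \<Rightarrow> real"
  have l1: "(\<lambda>k. S k cutoff) \<longlonglongrightarrow> 1" using vague[OF cutoff] i1 by (simp add: S_def)
  have l2: "(\<lambda>k. S k (\<lambda>z. f z * cutoff z)) \<longlonglongrightarrow> (\<integral>z. f z \<partial>green_measure)"
    using vague[OF continuous_on_mult[OF f(1) cutoff(1)] cut_f0] i2 by (simp add: S_def)
  have bd: "\<bar>S k f - S k (\<lambda>z. f z * cutoff z)\<bar> \<le> B * (1 - S k cutoff)" for k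
  proof -
    have aux: "\<bar>(\<Sum>z\<in>#A. f z) - (\<Sum>z\<in>#A. f z * cutoff z)\<bar> \<le> B * (real (size A) - (\<Sum>z\<in>#A. cutoff z))" for A
    proof (induction A)
      case (add x A)
      have "\<bar>f x - f x * cutoff x\<bar> = \<bar>f x\<bar> * (1 - cutoff x)"
        using cut_01[of x] by (simp add: abs_mult right_diff_distrib[symmetric, of "f x" 1 "cutoff x", simplified])
      also have "\<dots> \<le> B * (1 - cutoff x)" using cut_01[of x] B(1) by (intro mult_right_mono) auto
      finally show ?case using add by (simp add: algebra_simps)
    qed simp
    have "\<bar>S k f - S k (\<lambda>z. f z * cutoff z)\<bar> = \<bar>(\<Sum>z\<in>#proots (P k). f z) - (\<Sum>z\<in>#proots (P k). f z * cutoff z)\<bar> / real (n k)"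
      using P(3)[of k] by (simp add: S_def diff_divide_distrib[symmetric] abs_divide)
    also have "\<dots> \<le> B * (real (size (proots (P k))) - (\<Sum>z\<in>#proots (P k). cutoff z)) / real (n k)"
      by (intro divide_right_mono aux) auto
    also have "\<dots> \<le> B * (real (n k) - (\<Sum>z\<in>#proots (P k). cutoff z)) / real (n k)"
      using B(2) P(2)[of k] size_proots_complex[of "P k"] by (intro divide_right_mono mult_left_mono) auto
    also have "\<dots> = B * (1 - S k cutoff)" using P(3)[of k] by (simp add: S_def field_simps)
    finally show ?thesis .
  qed
  have "(\<lambda>k. S k f - S k (\<lambda>z. f z * cutoff z)) \<longlonglongrightarrow> 0"
  proof (rule Lim_null_comparison)
    show "\<forall>\<^sub>F k in sequentially. norm (S k f - S k (\<lambda>z. f z * cutoff z)) \<le> B * (1 - S k cutoff)"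
      using bd by simp
    have "(\<lambda>k. B * (1 - S k cutoff)) \<longlonglongrightarrow> B * (1 - 1)" by (intro tendsto_intros l1)
    then show "(\<lambda>k. B * (1 - S k cutoff)) \<longlonglongrightarrow> 0" by simp
  qed
  from tendsto_add[OF this l2] have "(\<lambda>k. S k f) \<longlonglongrightarrow> (\<integral>z. f z \<partial>green_measure)" by simp
  then show ?thesis by (simp add: S_def zero_measure_props(3)[OF P(1)])
qed

text \<open>A compactness argument by contradiction: it replaces a statement about limits by
  finitely many inequalities and one uniform bound for a single polynomial, with \<open>N\<close>
  and \<open>\<delta>\<close> independent of \<open>n\<close>. In this form probabilistic estimates
  at fixed \<open>n\<close> can be inserted.\<close>

theorem zero_measure_near_equilibrium:
  fixes z :: "nat \<Rightarrow> complex"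
  assumes U: "openin weak_star_topology U" "equilibrium_measure K \<in> U"
    and z: "closure (range z) = UNIV"
  shows "\<exists>N \<delta> n0. \<delta> > 0 \<and> (\<forall>n\<ge>n0. \<forall>P. degree P \<le> n \<longrightarrow>
     (\<forall>w. cmod (poly P w) \<le> exp (real n * (V w + \<delta>))) \<longrightarrow>
     (\<forall>i<N. exp (real n * (V (z i) - \<delta>)) \<le> cmod (poly P (z i))) \<longrightarrow> zero_measure n P \<in> U)"
proof (rule ccontr)
  assume "\<not> ?thesis"
  then have "\<forall>k::nat. \<exists>n P. n \<ge> Suc k \<and> degree P \<le> n \<and>
     (\<forall>w. cmod (poly P w) \<le> exp (real n * (V w + 1 / real (Suc k)))) \<and>
     (\<forall>i<Suc k. exp (real n * (V (z i) - 1 / real (Suc k))) \<le> cmod (poly P (z i))) \<and> zero_measure n P \<notin> U"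
    by (metis zero_less_divide_1_iff of_nat_0_less_iff zero_less_Suc)
  then obtain n P where n: "\<And>k. n k \<ge> Suc k" and deg: "\<And>k. degree (P k) \<le> n k"
    and up: "\<And>k w. cmod (poly (P k) w) \<le> exp (real (n k) * (V w + 1 / real (Suc k)))"
    and lo: "\<And>k i. i < Suc k \<Longrightarrow> exp (real (n k) * (V (z i) - 1 / real (Suc k))) \<le> cmod (poly (P k) (z i))"
    and notU: "\<And>k. zero_measure (n k) (P k) \<notin> U"
    by metis
  have P0: "P k \<noteq> 0" for k using lo[of 0 k] by (metis exp_gt_zero norm_zero not_le poly_0 zero_less_Suc)
  have npos: "n k > 0" for k using n[of k] by simp
  have "\<forall>k. \<exists>xs. mset xs = proots (P k)" by (simp add: ex_mset)
  then obtain zs where zs: "\<And>k. mset (zs k) = proots (P k)" by metis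
  have sumzs: "(\<Sum>w\<leftarrow>zs k. f w) = (\<Sum>w\<in>#proots (P k). f w)" for f :: "complex \<Rightarrow> real" and k
    by (simp flip: zs sum_mset_sum_list)
  have len: "length (zs k) \<le> n k" for k
    using deg[of k] size_proots_complex[of "P k"] by (metis size_mset zs)
  obtain s \<Lambda> where s: "strict_mono s" and \<Lambda>: "finite_measure \<Lambda>" "sets \<Lambda> = sets borel" "measure \<Lambda> UNIV \<le> 1"
    and vague: "\<And>f :: complex \<Rightarrow> real. continuous_on UNIV f \<Longrightarrow> (f \<longlongrightarrow> 0) at_infinity \<Longrightarrow>
       (\<lambda>k. (\<Sum>w\<leftarrow>zs (s k). f w) / real (n (s k))) \<longlonglongrightarrow> (\<integral>w. f w \<partial>\<Lambda>)"
    by (rule root_measures_vague_compact[of zs n, OF len npos]) (rule that; assumption)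
  note vague' = vague[unfolded sumzs]
  have "\<exists>C. \<forall>w. 0 \<le> 2 * C - 2 * V w + measure \<Lambda> UNIV * ln (1 + (cmod w)\<^sup>2) \<and>
     (\<integral>\<^sup>+t. log_kernel w t \<partial>\<Lambda>) = ennreal (2 * C - 2 * V w + measure \<Lambda> UNIV * ln (1 + (cmod w)\<^sup>2))"
  proof (rule root_measures_potential[where P="\<lambda>k. P (s k)" and n="\<lambda>k. n (s k)" and \<epsilon>="\<lambda>k. 1 / real (Suc (s k))" and D="range z"])
    have "(\<lambda>k. 1 / real (Suc k)) \<longlonglongrightarrow> 0" by real_asymp
    then show eps: "(\<lambda>k. 1 / real (Suc (s k))) \<longlonglongrightarrow> 0"
      using filterlim_compose[OF _ filterlim_subseq[OF s]] by blast
    show "\<forall>\<^sub>F k in sequentially. exp (real (n (s k)) * (V w - \<delta>)) \<le> cmod (poly (P (s k)) w)"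
      if "w \<in> range z" "\<delta> > 0" for w \<delta>
    proof -
      obtain i where i: "w = z i" using \<open>w \<in> range z\<close> by blast
      have "\<forall>\<^sub>F k in sequentially. 1 / real (Suc (s k)) < \<delta>"
        using order_tendstoD(2)[OF eps \<open>\<delta> > 0\<close>] .
      moreover have "\<forall>\<^sub>F k in sequentially. k \<ge> i" by (rule eventually_ge_at_top)
      ultimately show ?thesis
      proof eventually_elim
        case (elim k)
        have "i < Suc (s k)" using elim(2) seq_suble[OF s, of k] by simp
        have "exp (real (n (s k)) * (V w - \<delta>)) \<le> exp (real (n (s k)) * (V (z i) - 1 / real (Suc (s k))))"
          using elim(1) i by (intro exp_le_cancel_iff[THEN iffD2] mult_left_mono) auto
        also have "\<dots> \<le> cmod (poly (P (s k)) w)" using lo[OF \<open>i < Suc (s k)\<close>] i by simp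
        finally show ?case .
      qed
    qed
  qed (use continuous_V z P0 npos up \<Lambda> vague' in auto)
  then obtain C where C: "\<And>w. 0 \<le> 2 * C - 2 * V w + measure \<Lambda> UNIV * ln (1 + (cmod w)\<^sup>2)"
     "\<And>w. (\<integral>\<^sup>+t. log_kernel w t \<partial>\<Lambda>) = ennreal (2 * C - 2 * V w + measure \<Lambda> UNIV * ln (1 + (cmod w)\<^sup>2))"
    by blast
  have \<Lambda>g: "\<Lambda> = green_measure" by (rule green_measure_unique[OF \<Lambda> C])
  have "\<forall>\<^sub>F k in sequentially. zero_measure (n (s k)) (P (s k)) \<in> U"
  proof (rule eventually_in_weak_star_open[OF U])
    fix f :: "complex \<Rightarrow> real" assume f: "continuous_on UNIV f" "bounded (range f)"
    show "(\<lambda>k. \<integral>w. f w \<partial>zero_measure (n (s k)) (P (s k))) \<longlonglongrightarrow> (\<integral>w. f w \<partial>equilibrium_measure K)"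
      unfolding equilibrium_measure_eq
      by (rule zero_measures_converge[OF P0 deg npos vague'[unfolded \<Lambda>g] f])
  qed (use zero_measure_props[OF P0] in auto)
  then show False using notU by simp
qed

end

section \<open>Anti-concentration of weighted sums of i.i.d. variables\<close>

text \<open>Fubini: for a fixed value of \<open>Z\<close> the sum is a shift of
  \<open>h (X \<omega>)\<close>, whose concentration is at most \<open>Q\<close> whatever the shift.
  The set \<open>E\<close> allows the bound to be used on part of the probability space.\<close>

lemma (in prob_space) indep_shift_concentration:
  fixes h f :: "'b \<Rightarrow> complex"
  assumes ind: "indep_var N0 X N Z"
    and Q: "\<And>x. prob {\<omega> \<in> space M. cmod (h (X \<omega>) - x) \<le> r} \<le> Q"
    and h[measurable]: "h \<in> borel_measurable N0"
    and f[measurable]: "f \<in> borel_measurable N" and E[measurable]: "E \<in> sets N"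
  shows "prob {\<omega> \<in> space M. cmod (h (X \<omega>) + f (Z \<omega>)) \<le> r \<and> Z \<omega> \<in> E} \<le> Q * prob {\<omega> \<in> space M. Z \<omega> \<in> E}"
proof -
  have [measurable]: "X \<in> measurable M N0" "Z \<in> measurable M N"
    using ind by (auto simp: indep_var_distribution_eq)
  have "0 \<le> prob {\<omega> \<in> space M. cmod (h (X \<omega>) - 0) \<le> r}" by simp
  then have Q0: "Q \<ge> 0" using Q order_trans by blast
  interpret X: prob_space "distr M N0 X" by (rule prob_space_distr) simp
  interpret Z: prob_space "distr M N Z" by (rule prob_space_distr) simp
  interpret XZ: pair_sigma_finite "distr M N0 X" "distr M N Z" ..
  define W where "W = {p \<in> space (N0 \<Otimes>\<^sub>M N). cmod (h (fst p) + f (snd p)) \<le> r \<and> snd p \<in> E}"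
  have W[measurable]: "W \<in> sets (N0 \<Otimes>\<^sub>M N)" unfolding W_def by measurable
  have "emeasure M {\<omega> \<in> space M. cmod (h (X \<omega>) + f (Z \<omega>)) \<le> r \<and> Z \<omega> \<in> E} =
      emeasure (distr M (N0 \<Otimes>\<^sub>M N) (\<lambda>\<omega>. (X \<omega>, Z \<omega>))) W"
    by (subst emeasure_distr)
      (auto simp: W_def space_pair_measure intro!: arg_cong[where f="emeasure M"]
        dest: measurable_space[OF \<open>Z \<in> measurable M N\<close>] measurable_space[OF \<open>X \<in> measurable M N0\<close>])
  also have "distr M (N0 \<Otimes>\<^sub>M N) (\<lambda>\<omega>. (X \<omega>, Z \<omega>)) = distr M N0 X \<Otimes>\<^sub>M distr M N Z"
    using ind by (simp add: indep_var_distribution_eq)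
  also have "emeasure (distr M N0 X \<Otimes>\<^sub>M distr M N Z) W =
      (\<integral>\<^sup>+v. emeasure (distr M N0 X) ((\<lambda>u. (u, v)) -` W) \<partial>distr M N Z)"
    by (rule XZ.emeasure_pair_measure_alt2) simp
  also have "\<dots> \<le> (\<integral>\<^sup>+v. ennreal Q * indicator E v \<partial>distr M N Z)"
  proof (rule nn_integral_mono)
    fix v assume "v \<in> space (distr M N Z)"
    show "emeasure (distr M N0 X) ((\<lambda>u. (u, v)) -` W) \<le> ennreal Q * indicator E v"
    proof (cases "v \<in> E")
      case True
      have "emeasure (distr M N0 X) ((\<lambda>u. (u, v)) -` W) \<le> emeasure (distr M N0 X) {u \<in> space N0. cmod (h u - (- f v)) \<le> r}"
        by (rule emeasure_mono) (auto simp: W_def space_pair_measure)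
      also have "\<dots> = emeasure M {\<omega> \<in> space M. cmod (h (X \<omega>) - (- f v)) \<le> r}"
        by (subst emeasure_distr) (auto intro!: arg_cong[where f="emeasure M"]
          dest: measurable_space[OF \<open>X \<in> measurable M N0\<close>])
      also have "\<dots> \<le> ennreal Q" using Q[of "- f v"] by (simp add: emeasure_eq_measure ennreal_leI)
      finally show ?thesis using True by simp
    next
      case False
      then have "(\<lambda>u. (u, v)) -` W = {}" by (auto simp: W_def)
      then show ?thesis by simp
    qed
  qed
  also have "\<dots> = ennreal Q * emeasure (distr M N Z) E"
    by (simp add: nn_integral_cmult)
  also have "emeasure (distr M N Z) E = emeasure M {\<omega> \<in> space M. Z \<omega> \<in> E}"
    by (subst emeasure_distr) (auto intro!: arg_cong[where f="emeasure M"])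
  finally show ?thesis
    using Q0 by (simp add: emeasure_eq_measure flip: ennreal_mult)
qed

section \<open>Joint laws of i.i.d. variables and concentration of their sums\<close>

locale iid_sequence = prob_space M for M :: "'w measure" +
  fixes \<xi> :: "nat \<Rightarrow> 'w \<Rightarrow> complex"
  assumes indep: "indep_vars (\<lambda>_. borel) \<xi> UNIV"
    and ident: "\<And>j. distr M borel (\<xi> j) = distr M borel (\<xi> 0)"
begin

lemma measurable_\<xi> [measurable]: "\<xi> j \<in> borel_measurable M"
  using indep by (auto simp: indep_vars_def)

lemma prob_\<xi>:
  assumes [measurable]: "A \<in> sets borel"
  shows "prob {\<omega> \<in> space M. \<xi> j \<omega> \<in> A} = measure (distr M borel (\<xi> 0)) A"
proof -
  have "measure (distr M borel (\<xi> j)) A = prob {\<omega> \<in> space M. \<xi> j \<omega> \<in> A}"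
    by (subst measure_distr) (auto intro!: arg_cong[where f=prob])
  then show ?thesis using ident[of j] by simp
qed

lemma prob_rectangle:
  assumes J: "finite J" and A: "\<And>i. i \<in> J \<Longrightarrow> A i \<in> sets borel"
  shows "prob {\<omega> \<in> space M. \<forall>j\<in>J. \<xi> j \<omega> \<in> A j} = (\<Prod>j\<in>J. measure (distr M borel (\<xi> 0)) (A j))"
proof (cases "J = {}")
  case True
  then show ?thesis by (simp add: prob_space)
next
  case False
  have "{\<omega> \<in> space M. \<forall>j\<in>J. \<xi> j \<omega> \<in> A j} = (\<Inter>j\<in>J. \<xi> j -` A j \<inter> space M)"
    using False by auto
  also have "prob \<dots> = (\<Prod>j\<in>J. prob (\<xi> j -` A j \<inter> space M))"
    using indep_varsD[OF indep False J, of A] A by simp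
  also have "\<dots> = (\<Prod>j\<in>J. measure (distr M borel (\<xi> 0)) (A j))"
    using prob_\<xi>[OF A] by (intro prod.cong) (auto simp: vimage_def Int_def conj_commute)
  finally show ?thesis .
qed

lemma distr_family:
  assumes I: "finite I" and \<pi>: "inj_on \<pi> I"
  shows "distr M (PiM I (\<lambda>_. borel)) (\<lambda>\<omega>. \<lambda>i\<in>I. \<xi> (\<pi> i) \<omega>) = PiM I (\<lambda>_. distr M borel (\<xi> 0))"
proof -
  interpret L: prob_space "distr M borel (\<xi> 0)" by (rule prob_space_distr) simp
  interpret product_sigma_finite "\<lambda>_. distr M borel (\<xi> 0)" ..
  show ?thesis
  proof (rule PiM_eqI)
    show "finite I" by fact
    show "sets (distr M (PiM I (\<lambda>_. borel)) (\<lambda>\<omega>. \<lambda>i\<in>I. \<xi> (\<pi> i) \<omega>)) = sets (PiM I (\<lambda>_. distr M borel (\<xi> 0)))"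
      by (simp cong: sets_PiM_cong)
    fix A assume A: "\<And>i. i \<in> I \<Longrightarrow> A i \<in> sets (distr M borel (\<xi> 0))"
    have m: "(\<lambda>\<omega>. \<lambda>i\<in>I. \<xi> (\<pi> i) \<omega>) \<in> measurable M (PiM I (\<lambda>_. borel))" by measurable
    have "emeasure (distr M (PiM I (\<lambda>_. borel)) (\<lambda>\<omega>. \<lambda>i\<in>I. \<xi> (\<pi> i) \<omega>)) (Pi\<^sub>E I A) =
        emeasure M {\<omega> \<in> space M. \<forall>j\<in>\<pi> ` I. \<xi> j \<omega> \<in> A (inv_into I \<pi> j)}"
      using A I \<pi> by (subst emeasure_distr[OF m])
        (auto intro!: sets_PiM_I_finite arg_cong[where f="emeasure M"] simp: PiE_iff)
    also have "\<dots> = ennreal (\<Prod>j\<in>\<pi> ` I. measure (distr M borel (\<xi> 0)) (A (inv_into I \<pi> j)))"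
      unfolding emeasure_eq_measure
      by (subst prob_rectangle) (use A I \<pi> in \<open>auto\<close>)
    also have "\<dots> = ennreal (\<Prod>i\<in>I. measure (distr M borel (\<xi> 0)) (A i))"
      using \<pi> by (subst prod.reindex) auto
    also have "\<dots> = (\<Prod>i\<in>I. emeasure (distr M borel (\<xi> 0)) (A i))"
      by (simp add: L.emeasure_eq_measure prod_ennreal)
    finally show "emeasure (distr M (PiM I (\<lambda>_. borel)) (\<lambda>\<omega>. \<lambda>i\<in>I. \<xi> (\<pi> i) \<omega>)) (Pi\<^sub>E I A) =
        (\<Prod>i\<in>I. emeasure (distr M borel (\<xi> 0)) (A i))" .
  qed
qed

text \<open>Exchangeability: distinct variables have the same joint law whichever indices they
  carry.\<close>

lemma prob_sum_reindex:
  assumes I: "finite I" and \<pi>: "inj_on \<pi> I"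
  shows "prob {\<omega> \<in> space M. cmod ((\<Sum>i\<in>I. a i * \<xi> (\<pi> i) \<omega>) - x) \<le> r} =
    prob {\<omega> \<in> space M. cmod ((\<Sum>i\<in>I. a i * \<xi> i \<omega>) - x) \<le> r}"
proof -
  define E where "E = {v \<in> space (PiM I (\<lambda>_. borel :: complex measure)). cmod ((\<Sum>i\<in>I. a i * v i) - x) \<le> r}"
  have E: "E \<in> sets (PiM I (\<lambda>_. borel))" unfolding E_def by measurable
  have eq: "prob {\<omega> \<in> space M. cmod ((\<Sum>i\<in>I. a i * \<xi> (\<rho> i) \<omega>) - x) \<le> r} =
      measure (PiM I (\<lambda>_. distr M borel (\<xi> 0))) E" if \<rho>: "inj_on \<rho> I" for \<rho>
  proof -
    have m: "(\<lambda>\<omega>. \<lambda>i\<in>I. \<xi> (\<rho> i) \<omega>) \<in> measurable M (PiM I (\<lambda>_. borel))" by measurable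
    have "{\<omega> \<in> space M. cmod ((\<Sum>i\<in>I. a i * \<xi> (\<rho> i) \<omega>) - x) \<le> r} =
        (\<lambda>\<omega>. \<lambda>i\<in>I. \<xi> (\<rho> i) \<omega>) -` E \<inter> space M"
      by (auto simp: E_def space_PiM)
    then show ?thesis
      unfolding distr_family[OF I \<rho>, symmetric] by (simp add: measure_distr[OF m E])
  qed
  show ?thesis using eq[OF \<pi>] eq[of "\<lambda>i. i"] by simp
qed

text \<open>Replacing, one at a time, the variables of a block by independent copies (taken from the
  variables with index beyond \<open>n\<close>) produces \<open>m + 1\<close> equidistributed sums. On the rectangle event they are pairwise more than \<open>2 r\<close> apart, so at most
  one of them lies in a given disc of radius \<open>r\<close>.\<close>

lemma concentration_step:
  fixes a :: "nat \<Rightarrow> complex" and b :: "nat \<Rightarrow> nat"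
  assumes J: "finite J" "\<And>j. j \<in> J \<Longrightarrow> j \<le> n"
    and b: "inj_on b {..<m}" "b ` {..<m} \<inter> J = {}" "\<And>l. l < m \<Longrightarrow> b l \<le> n"
    and Q: "\<And>x. prob {\<omega> \<in> space M. cmod ((\<Sum>j\<in>J. a j * \<xi> j \<omega>) - x) \<le> r} \<le> Q"
    and AB: "\<And>l. l < m \<Longrightarrow> A l \<in> sets borel" "\<And>l. l < m \<Longrightarrow> B l \<in> sets borel"
    and sep: "\<And>l u v. l < m \<Longrightarrow> u \<in> A l \<Longrightarrow> v \<in> B l \<Longrightarrow> 2 * r < Re (\<beta> * (a (b l) * (v - u)))"
    and \<beta>: "cmod \<beta> = 1" and r: "r \<ge> 0"
    and \<gamma>: "\<And>l. l < m \<Longrightarrow> measure (distr M borel (\<xi> 0)) (A l) * measure (distr M borel (\<xi> 0)) (B l) = \<gamma>"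
  shows "prob {\<omega> \<in> space M. cmod ((\<Sum>j\<in>J \<union> b ` {..<m}. a j * \<xi> j \<omega>) - x) \<le> r}
    \<le> \<gamma> ^ m / real (m + 1) + (1 - \<gamma> ^ m) * Q"
proof -
  \<comment> \<open>Variables with index beyond \<open>n\<close> do not occur in the sum, so these
    are independent copies.\<close>
  define \<kappa> where "\<kappa> l = Suc n + b l" for l
  define I where "I = J \<union> b ` {..<m}"
  define N where "N = b ` {..<m} \<union> \<kappa> ` {..<m}"
  have fin: "finite I" "finite N" using J by (auto simp: I_def N_def)
  have \<kappa>n: "\<kappa> l > n" for l by (simp add: \<kappa>_def)
  have JN: "J \<inter> N = {}"
    using b(2) J(2) \<kappa>n by (auto simp: N_def) (metis not_le)
  define Z where "Z \<omega> = (\<lambda>j\<in>N. \<xi> j \<omega>)" for \<omega>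
  define S where "S \<omega> = (\<Sum>j\<in>J. a j * \<xi> j \<omega>)" for \<omega>
  \<comment> \<open>The variables of the block with \<open>l < i\<close> are replaced by their
    copies; consecutive values of \<open>i\<close> differ in one summand.\<close>
  define Y where "Y i z = (\<Sum>l<m. a (b l) * z (if l < i then \<kappa> l else b l))" for i :: nat and z :: "nat \<Rightarrow> complex"
  define G where "G = {z \<in> space (PiM N (\<lambda>_. borel)). \<forall>l<m. z (b l) \<in> A l \<and> z (\<kappa> l) \<in> B l}"
  define T where "T i \<omega> = S \<omega> + Y i (Z \<omega>)" for i \<omega>
  have [measurable]: "(\<lambda>z. z j) \<in> borel_measurable (PiM N (\<lambda>_. borel))" if "j \<in> N" for j
    using that by (rule measurable_component_singleton)
  have bN: "b l \<in> N" "\<kappa> l \<in> N" if "l < m" for l using that by (auto simp: N_def)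
  have Ym: "Y i \<in> borel_measurable (PiM N (\<lambda>_. borel))" for i
    unfolding Y_def[abs_def] using bN by (intro borel_measurable_sum borel_measurable_times) auto
  have Gm: "G \<in> sets (PiM N (\<lambda>_. borel))"
  proof -
    have "G = (\<Inter>l\<in>{..<m}. {z \<in> space (PiM N (\<lambda>_. borel)). z (b l) \<in> A l \<and> z (\<kappa> l) \<in> B l}) \<inter> space (PiM N (\<lambda>_. borel))"
      by (auto simp: G_def)
    also have "\<dots> \<in> sets (PiM N (\<lambda>_. borel))"
    proof (cases "m = 0")
      case False
      have "{z \<in> space (PiM N (\<lambda>_. borel)). z (b l) \<in> A l \<and> z (\<kappa> l) \<in> B l} \<in> sets (PiM N (\<lambda>_. borel))"
        if "l < m" for l
        using AB that bN[OF that] by (intro sets.sets_Collect_conj measurable_sets_Collect[OF measurable_component_singleton]) auto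
      then show ?thesis using False by (intro sets.Int sets.finite_INT sets.top) auto
    qed simp
    finally show ?thesis .
  qed
  have Zm: "Z \<in> measurable M (PiM N (\<lambda>_. borel))" unfolding Z_def by measurable
  have ind: "indep_var (PiM J (\<lambda>_. borel)) (\<lambda>\<omega>. \<lambda>j\<in>J. \<xi> j \<omega>) (PiM N (\<lambda>_. borel)) Z"
    unfolding Z_def[abs_def] by (rule indep_var_restrict[OF indep JN]) auto
  have [measurable]: "S \<in> borel_measurable M" unfolding S_def by measurable
  have [measurable]: "T i \<in> borel_measurable M" for i
    unfolding T_def using measurable_compose[OF Zm Ym] by measurable
  \<comment> \<open>Each modified sum is the original one after an injective relabelling of the
    variables.\<close>
  have law: "prob {\<omega> \<in> space M. cmod (T i \<omega> - x) \<le> r} =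
      prob {\<omega> \<in> space M. cmod ((\<Sum>j\<in>I. a j * \<xi> j \<omega>) - x) \<le> r}" for i
  proof -
    define \<pi> where "\<pi> j = (if j \<in> b ` {..<i} \<inter> b ` {..<m} then Suc n + j else j)" for j
    have jn: "j \<le> n" if "j \<in> I" for j using that J b by (auto simp: I_def)
    have "inj_on \<pi> I"
    proof (rule inj_onI)
      fix j j' assume "j \<in> I" "j' \<in> I" "\<pi> j = \<pi> j'"
      then show "j = j'" using jn[of j] jn[of j'] by (auto simp: \<pi>_def split: if_splits)
    qed
    moreover have "T i \<omega> = (\<Sum>j\<in>I. a j * \<xi> (\<pi> j) \<omega>)" for \<omega>
    proof -
      have "(\<Sum>j\<in>I. a j * \<xi> (\<pi> j) \<omega>) = (\<Sum>j\<in>J. a j * \<xi> (\<pi> j) \<omega>) + (\<Sum>j\<in>b ` {..<m}. a j * \<xi> (\<pi> j) \<omega>)"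
        unfolding I_def using J b by (intro sum.union_disjoint) auto
      also have "(\<Sum>j\<in>J. a j * \<xi> (\<pi> j) \<omega>) = S \<omega>"
        unfolding S_def using b(2) by (intro sum.cong refl) (auto simp: \<pi>_def)
      also have "(\<Sum>j\<in>b ` {..<m}. a j * \<xi> (\<pi> j) \<omega>) = (\<Sum>l<m. a (b l) * \<xi> (\<pi> (b l)) \<omega>)"
        using b(1) by (subst sum.reindex) auto
      also have "\<dots> = Y i (Z \<omega>)"
        unfolding Y_def
      proof (intro sum.cong refl)
        fix l assume l: "l \<in> {..<m}"
        have "b l \<in> b ` {..<i} \<inter> b ` {..<m} \<longleftrightarrow> l < i"
        proof
          assume "b l \<in> b ` {..<i} \<inter> b ` {..<m}"
          then obtain l' l'' where "l' < i" "b l = b l'" by auto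
          show "l < i"
          proof (cases "l' < m")
            case True
            then have "l = l'" using b(1) l \<open>b l = b l'\<close> by (auto dest: inj_onD)
            then show ?thesis using \<open>l' < i\<close> by simp
          next
            case False
            then show ?thesis using l \<open>l' < i\<close> by simp
          qed
        qed (use l in auto)
        then show "a (b l) * \<xi> (\<pi> (b l)) \<omega> = a (b l) * Z \<omega> (if l < i then \<kappa> l else b l)"
          using l bN[of l] by (auto simp: \<pi>_def Z_def \<kappa>_def)
      qed
      finally show ?thesis by (simp add: T_def)
    qed
    ultimately show ?thesis using prob_sum_reindex[OF fin(1), of \<pi> a x r] by simp
  qed
  have PG: "prob {\<omega> \<in> space M. Z \<omega> \<in> G} = \<gamma> ^ m"
  proof -
    define A' where "A' j = (if j \<le> n then A (the_inv_into {..<m} b j) else B (the_inv_into {..<m} b (j - Suc n)))" for j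
    have A': "A' (b l) = A l" "A' (\<kappa> l) = B l" if "l < m" for l
      using that b by (auto simp: A'_def \<kappa>_def the_inv_into_f_f)
    have inj\<kappa>: "inj_on \<kappa> {..<m}" using b(1) by (auto simp: \<kappa>_def inj_on_def)
    have disj: "b ` {..<m} \<inter> \<kappa> ` {..<m} = {}" using b(3) \<kappa>n by auto (metis not_le)
    have "{\<omega> \<in> space M. Z \<omega> \<in> G} = {\<omega> \<in> space M. \<forall>j\<in>N. \<xi> j \<omega> \<in> A' j}"
    proof -
      have "(\<forall>j\<in>N. \<xi> j \<omega> \<in> A' j) \<longleftrightarrow> (\<forall>l<m. \<xi> (b l) \<omega> \<in> A' (b l)) \<and> (\<forall>l<m. \<xi> (\<kappa> l) \<omega> \<in> A' (\<kappa> l))" for \<omega>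
        unfolding N_def by blast
      moreover have "Z \<omega> \<in> G \<longleftrightarrow> (\<forall>l<m. \<xi> (b l) \<omega> \<in> A l) \<and> (\<forall>l<m. \<xi> (\<kappa> l) \<omega> \<in> B l)" for \<omega>
        using bN by (auto simp: G_def Z_def space_PiM)
      ultimately show ?thesis using A' by simp
    qed
    also have "prob \<dots> = (\<Prod>j\<in>N. measure (distr M borel (\<xi> 0)) (A' j))"
      by (rule prob_rectangle) (use fin AB A' in \<open>auto simp: N_def\<close>)
    also have "\<dots> = (\<Prod>l<m. measure (distr M borel (\<xi> 0)) (A' (b l))) * (\<Prod>l<m. measure (distr M borel (\<xi> 0)) (A' (\<kappa> l)))"
      unfolding N_def using disj b(1) inj\<kappa> by (subst prod.union_disjoint) (auto simp: prod.reindex)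
    also have "\<dots> = (\<Prod>l<m. \<gamma>)"
      unfolding prod.distrib[symmetric] using A' \<gamma> by (intro prod.cong) auto
    finally show ?thesis by simp
  qed
  have mG: "{\<omega> \<in> space M. Z \<omega> \<in> G} \<in> events"
    using measurable_sets[OF Zm Gm] by (simp add: vimage_def Int_def conj_commute)
  have mT: "{\<omega> \<in> space M. cmod (T i \<omega> - x) \<le> r} \<in> events" for i by measurable
  have mTG: "{\<omega> \<in> space M. cmod (T i \<omega> - x) \<le> r \<and> Z \<omega> \<in> G} \<in> events" for i
    using sets.Int[OF mT[of i] mG] by (simp add: Int_def conj_commute conj_left_commute)
  \<comment> \<open>Off the rectangle event the block and its copies count as a fixed shift, and the
    concentration of the remaining sum over \<open>J\<close> is used.\<close>
  have off: "prob {\<omega> \<in> space M. cmod (T i \<omega> - x) \<le> r \<and> Z \<omega> \<notin> G} \<le> Q * (1 - \<gamma> ^ m)" for i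
  proof -
    define E where "E = space (PiM N (\<lambda>_. borel :: complex measure)) - G"
    have E: "E \<in> sets (PiM N (\<lambda>_. borel))" unfolding E_def using Gm by auto
    have ZE: "Z \<omega> \<in> E \<longleftrightarrow> Z \<omega> \<notin> G" for \<omega>
      by (auto simp: E_def Z_def space_PiM)
    have "prob {\<omega> \<in> space M. cmod ((\<Sum>j\<in>J. a j * (\<lambda>j\<in>J. \<xi> j \<omega>) j) + (Y i (Z \<omega>) - x)) \<le> r \<and> Z \<omega> \<in> E}
        \<le> Q * prob {\<omega> \<in> space M. Z \<omega> \<in> E}"
      by (rule indep_shift_concentration[OF ind, where h="\<lambda>v. \<Sum>j\<in>J. a j * v j"]) (use Q Ym E in auto)
    then have "prob {\<omega> \<in> space M. cmod (S \<omega> + (Y i (Z \<omega>) - x)) \<le> r \<and> Z \<omega> \<in> E} \<le> Q * prob {\<omega> \<in> space M. Z \<omega> \<in> E}"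
      by (simp add: S_def)
    also have "{\<omega> \<in> space M. Z \<omega> \<in> E} = space M - {\<omega> \<in> space M. Z \<omega> \<in> G}" using ZE by auto
    also have "prob \<dots> = 1 - \<gamma> ^ m" using prob_compl[OF mG] PG by simp
    finally show ?thesis by (simp add: T_def ZE add_diff_eq)
  qed
  \<comment> \<open>All \<open>m + 1\<close> sums meet the disc with the same probability. When
    these are added, the parts on the rectangle event are disjoint, so together they contribute at
    most its probability once.\<close>
  have "real (m + 1) * prob {\<omega> \<in> space M. cmod ((\<Sum>j\<in>I. a j * \<xi> j \<omega>) - x) \<le> r} =
      (\<Sum>i\<le>m. prob {\<omega> \<in> space M. cmod (T i \<omega> - x) \<le> r})"
    by (simp add: law)
  also have "\<dots> \<le> (\<Sum>i\<le>m. prob {\<omega> \<in> space M. cmod (T i \<omega> - x) \<le> r \<and> Z \<omega> \<in> G} + Q * (1 - \<gamma> ^ m))"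
  proof (rule sum_mono)
    fix i
    have "prob {\<omega> \<in> space M. cmod (T i \<omega> - x) \<le> r} \<le>
        prob ({\<omega> \<in> space M. cmod (T i \<omega> - x) \<le> r \<and> Z \<omega> \<in> G} \<union> {\<omega> \<in> space M. cmod (T i \<omega> - x) \<le> r \<and> Z \<omega> \<notin> G})"
      by (rule arg_cong[where f=prob, THEN eq_refl]) auto
    also have "\<dots> \<le> prob {\<omega> \<in> space M. cmod (T i \<omega> - x) \<le> r \<and> Z \<omega> \<in> G} +
        prob {\<omega> \<in> space M. cmod (T i \<omega> - x) \<le> r \<and> Z \<omega> \<notin> G}"
    proof (rule measure_Un_le[OF mTG])
      show "{\<omega> \<in> space M. cmod (T i \<omega> - x) \<le> r \<and> Z \<omega> \<notin> G} \<in> events"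
        using sets.Diff[OF mT[of i] mG] by (rule back_subst[of "\<lambda>X. X \<in> events"]) auto
    qed
    finally show "prob {\<omega> \<in> space M. cmod (T i \<omega> - x) \<le> r} \<le>
        prob {\<omega> \<in> space M. cmod (T i \<omega> - x) \<le> r \<and> Z \<omega> \<in> G} + Q * (1 - \<gamma> ^ m)"
      using off[of i] by linarith
  qed
  also have "\<dots> = (\<Sum>i\<le>m. prob {\<omega> \<in> space M. cmod (T i \<omega> - x) \<le> r \<and> Z \<omega> \<in> G}) + real (m + 1) * (Q * (1 - \<gamma> ^ m))"
    by (simp add: sum.distrib)
  also have "(\<Sum>i\<le>m. prob {\<omega> \<in> space M. cmod (T i \<omega> - x) \<le> r \<and> Z \<omega> \<in> G}) =
      prob (\<Union>i\<in>{..m}. {\<omega> \<in> space M. cmod (T i \<omega> - x) \<le> r \<and> Z \<omega> \<in> G})"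
  proof (rule finite_measure_finite_Union[symmetric])
    \<comment> \<open>The difference is a sum of terms whose real parts, after rotation by
      \<open>\<beta>\<close>, all exceed \<open>2 * r\<close>. They cannot cancel, so one of them
      already separates the two sums.\<close>
    have far: "\<not> (cmod (T i \<omega> - x) \<le> r \<and> cmod (T i' \<omega> - x) \<le> r)" if "i < i'" "i' \<le> m" "Z \<omega> \<in> G" for i i' \<omega>
    proof
      assume *: "cmod (T i \<omega> - x) \<le> r \<and> cmod (T i' \<omega> - x) \<le> r"
      have "T i' \<omega> - T i \<omega> = (\<Sum>l<m. if i \<le> l \<and> l < i' then a (b l) * (Z \<omega> (\<kappa> l) - Z \<omega> (b l)) else 0)"
        unfolding T_def Y_def using that(1)
        by (auto simp: sum_subtractf[symmetric] algebra_simps intro!: sum.cong)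
      also have "\<dots> = (\<Sum>l\<in>{i..<i'}. a (b l) * (Z \<omega> (\<kappa> l) - Z \<omega> (b l)))"
        by (rule sum.mono_neutral_cong_right) (use that in auto)
      finally have eq: "Re (\<beta> * (T i' \<omega> - T i \<omega>)) = (\<Sum>l\<in>{i..<i'}. Re (\<beta> * (a (b l) * (Z \<omega> (\<kappa> l) - Z \<omega> (b l)))))"
        by (simp add: sum_distrib_left)
      have s1: "(\<Sum>l\<in>{i}. Re (\<beta> * (a (b l) * (Z \<omega> (\<kappa> l) - Z \<omega> (b l))))) \<le>
          (\<Sum>l\<in>{i..<i'}. Re (\<beta> * (a (b l) * (Z \<omega> (\<kappa> l) - Z \<omega> (b l)))))"
      proof (rule sum_mono2)
        fix l assume "l \<in> {i..<i'} - {i}"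
        then have "l < m" using that by auto
        then have "2 * r < Re (\<beta> * (a (b l) * (Z \<omega> (\<kappa> l) - Z \<omega> (b l))))"
          using that(3) by (intro sep) (auto simp: G_def)
        then show "0 \<le> Re (\<beta> * (a (b l) * (Z \<omega> (\<kappa> l) - Z \<omega> (b l))))" using r by linarith
      qed (use that in auto)
      have s2: "2 * r < (\<Sum>l\<in>{i}. Re (\<beta> * (a (b l) * (Z \<omega> (\<kappa> l) - Z \<omega> (b l)))))"
        using that by (simp only: sum.insert_if sum.empty finite.emptyI empty_iff if_False add_0_right)
          (intro sep, auto simp: G_def)
      have "2 * r < Re (\<beta> * (T i' \<omega> - T i \<omega>))"
        unfolding eq by (rule less_le_trans[OF s2 s1])
      also have "\<dots> \<le> cmod (T i' \<omega> - T i \<omega>)"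
        using complex_Re_le_cmod[of "\<beta> * (T i' \<omega> - T i \<omega>)"] \<beta> by (simp add: norm_mult)
      also have "\<dots> \<le> 2 * r" using * norm_triangle_ineq4[of "T i' \<omega> - x" "T i \<omega> - x"] by simp
      finally show False by simp
    qed
    show "disjoint_family_on (\<lambda>i. {\<omega> \<in> space M. cmod (T i \<omega> - x) \<le> r \<and> Z \<omega> \<in> G}) {..m}"
      unfolding disjoint_family_on_def
    proof (intro ballI impI)
      fix i i' assume "i \<in> {..m}" "i' \<in> {..m}" "i \<noteq> i'"
      then show "{\<omega> \<in> space M. cmod (T i \<omega> - x) \<le> r \<and> Z \<omega> \<in> G} \<inter> {\<omega> \<in> space M. cmod (T i' \<omega> - x) \<le> r \<and> Z \<omega> \<in> G} = {}"
        using far[of i i'] far[of i' i] by (cases i i' rule: linorder_cases) auto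
    qed
  qed (use mTG in auto)
  also have "\<dots> \<le> prob {\<omega> \<in> space M. Z \<omega> \<in> G}"
    by (intro finite_measure_mono mG) auto
  also note PG
  finally have "real (m + 1) * prob {\<omega> \<in> space M. cmod ((\<Sum>j\<in>I. a j * \<xi> j \<omega>) - x) \<le> r} \<le>
      \<gamma> ^ m + real (m + 1) * (Q * (1 - \<gamma> ^ m))" by simp
  then have "prob {\<omega> \<in> space M. cmod ((\<Sum>j\<in>I. a j * \<xi> j \<omega>) - x) \<le> r} \<le>
      (\<gamma> ^ m + real (m + 1) * (Q * (1 - \<gamma> ^ m))) / real (m + 1)"
    by (simp add: pos_le_divide_eq mult.commute)
  also have "\<dots> = \<gamma> ^ m / real (m + 1) + (1 - \<gamma> ^ m) * Q"
    by (simp add: add_divide_distrib mult.commute del: of_nat_add)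
  finally show ?thesis by (simp add: I_def)
qed

text \<open>Blocks of \<open>m\<close> large weights are split off one after another. Each
  application of \<open>concentration_step\<close> maps a bound \<open>q\<close> to
  \<open>\<gamma> ^ m / (m + 1) + (1 - \<gamma> ^ m) * q\<close>. This contracts to the fixed point
  \<open>1 / (m + 1)\<close>, small for large \<open>m\<close>, and \<open>N\<close> blocks make the
  remaining error small. Balls about two points of the support take the place of moment
  conditions.\<close>

theorem anti_concentration:
  assumes nd: "nondegenerate M (\<xi> 0)" and \<eta>: "\<eta> > 0"
  shows "\<exists>k. \<exists>r>0. \<forall>n a x. k \<le> card {j. j \<le> n \<and> 1 \<le> cmod (a j)} \<longrightarrow>
    prob {\<omega> \<in> space M. cmod ((\<Sum>j\<le>n. a j * \<xi> j \<omega>) - x) \<le> r} \<le> \<eta>"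
proof -
  let ?L = "distr M borel (\<xi> 0)"
  interpret L: prob_space ?L by (rule prob_space_distr) simp
  obtain u v where u: "u \<in> measure_support ?L" and v: "v \<in> measure_support ?L" and uv: "u \<noteq> v"
    using nd by (auto simp: nondegenerate_def)
  define d where "d = v - u"
  \<comment> \<open>With these radii \<open>y - x\<close> lies within \<open>cmod d / 8\<close> of
    \<open>d\<close> or \<open>- d\<close>. Weights of modulus at least 1 and a real part of at
    least half the modulus then leave a separation of \<open>3 * cmod d / 8\<close>, above
    \<open>2 * r = cmod d / 4\<close>.\<close>
  define \<rho> where "\<rho> = cmod d / 16"
  define r where "r = cmod d / 8"
  have d: "cmod d > 0" using uv by (simp add: d_def)
  define \<gamma> where "\<gamma> = measure ?L (ball u \<rho>) * measure ?L (ball v \<rho>)"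
  have "emeasure ?L (ball u \<rho>) > 0" "emeasure ?L (ball v \<rho>) > 0"
    using u v d by (auto simp: measure_support_def \<rho>_def)
  then have \<gamma>: "\<gamma> > 0" "\<gamma> \<le> 1"
    by (auto simp: \<gamma>_def L.emeasure_eq_measure intro!: mult_le_one)
  obtain m :: nat where m: "1 / real (m + 1) < \<eta> / 2"
    using \<eta> nat_approx_posE[of "\<eta> / 2"] by auto
  have gm: "0 < \<gamma> ^ m" "\<gamma> ^ m \<le> 1" using \<gamma> by (auto simp: power_le_one)
  have "(\<lambda>N. (1 - \<gamma> ^ m) ^ N) \<longlonglongrightarrow> 0" using gm by (intro LIMSEQ_realpow_zero) auto
  then have "\<forall>\<^sub>F N in sequentially. (1 - \<gamma> ^ m) ^ N < \<eta> / 2" using \<eta> by (intro order_tendstoD(2)) auto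
  then obtain N where N: "(1 - \<gamma> ^ m) ^ N < \<eta> / 2" by (auto simp: eventually_sequentially)
  have main: "\<forall>x. prob {\<omega> \<in> space M. cmod ((\<Sum>j\<in>J. a j * \<xi> j \<omega>) - x) \<le> r} \<le> 1 / real (m + 1) + (1 - \<gamma> ^ m) ^ N"
    if "J \<subseteq> {..n}" "2 * m * N \<le> card {j \<in> J. 1 \<le> cmod (a j)}" for N J n and a :: "nat \<Rightarrow> complex"
    using that
  proof (induction N arbitrary: J)
    case 0
    show ?case using prob_le_1 by (auto intro: order_trans)
  next
    case (Suc N)
    define H where "H = {j \<in> J. 1 \<le> cmod (a j)}"
    have finJ: "finite J" using Suc.prems(1) finite_subset by blast
    then have finH: "finite H" by (simp add: H_def)
    \<comment> \<open>The real or the imaginary part is at least half the modulus, so at least half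
      of the large weights share a rotation \<open>\<beta>\<close>, 1 or \<open>\<i>\<close>. This
      is the factor 2 in \<open>2 * m * N\<close>.\<close>
    define H1 where "H1 = {j \<in> H. cmod (a j * d) / 2 \<le> \<bar>Re (1 * (a j * d))\<bar>}"
    define H2 where "H2 = {j \<in> H. cmod (a j * d) / 2 \<le> \<bar>Re (\<i> * (a j * d))\<bar>}"
    have "H \<subseteq> H1 \<union> H2"
    proof
      fix j assume "j \<in> H"
      moreover have "cmod (a j * d) \<le> \<bar>Re (a j * d)\<bar> + \<bar>Im (a j * d)\<bar>" by (rule cmod_le)
      moreover have "\<bar>Re (\<i> * (a j * d))\<bar> = \<bar>Im (a j * d)\<bar>" by simp
      ultimately show "j \<in> H1 \<union> H2" unfolding H1_def H2_def by auto
    qed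
    moreover have "finite H1" "finite H2" using finH by (auto simp: H1_def H2_def)
    ultimately have "card H \<le> card H1 + card H2"
      by (meson card_Un_le card_mono finite_UnI order_trans)
    moreover have "2 * m \<le> card H" using Suc.prems(2) by (simp add: H_def)
    ultimately have "m \<le> card H1 \<or> m \<le> card H2" by linarith
    then obtain \<beta> D where D: "D \<subseteq> H" "card D = m" and \<beta>: "cmod \<beta> = 1"
      and big: "\<And>j. j \<in> D \<Longrightarrow> cmod (a j * d) / 2 \<le> \<bar>Re (\<beta> * (a j * d))\<bar>"
    proof
      assume "m \<le> card H1"
      then obtain D where "D \<subseteq> H1" "card D = m" by (meson obtain_subset_with_card_n)
      then show thesis using that[of D 1] by (auto simp: H1_def)
    next
      assume "m \<le> card H2"
      then obtain D where "D \<subseteq> H2" "card D = m" by (meson obtain_subset_with_card_n)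
      then show thesis using that[of D \<i>] by (auto simp: H2_def)
    qed
    have finD: "finite D" using D finH finite_subset by blast
    obtain b where b: "bij_betw b {..<m} D"
      using ex_bij_betw_nat_finite[OF finD] D(2) by (auto simp: atLeast0LessThan)
    have bD: "b l \<in> D" if "l < m" for l using b that by (auto simp: bij_betw_def)
    have D': "D \<subseteq> J" "D \<subseteq> {..n}" using D Suc.prems(1) by (auto simp: H_def)
    \<comment> \<open>Interchanging the two balls corrects the sign of the real part and leaves the
      product \<open>\<gamma>\<close> of their masses unchanged.\<close>
    define pos where "pos l \<longleftrightarrow> Re (\<beta> * (a (b l) * d)) \<ge> 0" for l
    define A where "A l = (if pos l then ball u \<rho> else ball v \<rho>)" for l
    define B where "B l = (if pos l then ball v \<rho> else ball u \<rho>)" for l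
    have IH: "\<forall>x. prob {\<omega> \<in> space M. cmod ((\<Sum>j\<in>J - D. a j * \<xi> j \<omega>) - x) \<le> r} \<le> 1 / real (m + 1) + (1 - \<gamma> ^ m) ^ N"
    proof (rule Suc.IH)
      have "{j \<in> J - D. 1 \<le> cmod (a j)} = H - D" by (auto simp: H_def)
      then show "2 * m * N \<le> card {j \<in> J - D. 1 \<le> cmod (a j)}"
        using Suc.prems(2) D finD by (simp add: card_Diff_subset H_def[symmetric])
    qed (use Suc.prems(1) in auto)
    have sep: "2 * r < Re (\<beta> * (a (b l) * (y - x)))" if l: "l < m" and x: "x \<in> A l" and y: "y \<in> B l" for l x y
    proof -
      define c where "c = \<beta> * a (b l)"
      have c: "cmod c = cmod (a (b l))" "cmod c \<ge> 1"
        using bD[OF l] D \<beta> by (auto simp: c_def norm_mult H_def)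
      have "cmod c * cmod d = cmod (a (b l) * d)" "c * d = \<beta> * (a (b l) * d)"
        by (simp_all only: c(1) norm_mult c_def mult.assoc \<beta> mult_1_left)
      then have bg: "cmod c * cmod d / 2 \<le> \<bar>Re (c * d)\<bar>"
        using big[OF bD[OF l]] by (simp only:)
      define e where "e = (if pos l then (y - x) - d else (y - x) + d)"
      have e: "cmod e \<le> cmod d / 8"
      proof (cases "pos l")
        case True
        then have "cmod (u - x) < \<rho>" "cmod (v - y) < \<rho>" using x y by (auto simp: A_def B_def dist_norm)
        moreover have "e = (u - x) - (v - y)" using True by (simp add: e_def d_def)
        ultimately show ?thesis using norm_triangle_ineq4[of "u - x" "v - y"] by (simp add: \<rho>_def)
      next
        case False
        then have "cmod (v - x) < \<rho>" "cmod (u - y) < \<rho>" using x y by (auto simp: A_def B_def dist_norm)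
        moreover have "e = (v - x) - (u - y)" using False by (simp add: e_def d_def)
        ultimately show ?thesis using norm_triangle_ineq4[of "v - x" "u - y"] by (simp add: \<rho>_def)
      qed
      have ce: "\<bar>Re (c * e)\<bar> \<le> cmod c * (cmod d / 8)"
        using abs_Re_le_cmod[of "c * e"] mult_left_mono[OF e norm_ge_zero[of c]] by (simp add: norm_mult)
      have "Re (\<beta> * (a (b l) * (y - x))) = \<bar>Re (c * d)\<bar> + Re (c * e)"
      proof (cases "pos l")
        case True
        then have "y - x = d + e" "Re (c * d) \<ge> 0" by (auto simp: e_def pos_def c_def mult.assoc)
        then show ?thesis by (simp add: c_def mult.assoc[symmetric] distrib_left right_diff_distrib del: times_complex.sel)
      next
        case False
        then have "y - x = - d + e" "Re (c * d) < 0" by (auto simp: e_def pos_def c_def mult.assoc)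
        then show ?thesis by (simp add: c_def mult.assoc[symmetric] distrib_left right_diff_distrib del: times_complex.sel)
      qed
      also have "\<dots> \<ge> cmod c * cmod d / 2 - cmod c * (cmod d / 8)" using bg ce by linarith
      also have "cmod c * cmod d / 2 - cmod c * (cmod d / 8) = cmod c * (3 * cmod d / 8)" by (simp add: algebra_simps)
      also have "\<dots> \<ge> 1 * (3 * cmod d / 8)" using c(2) by (intro mult_right_mono) auto
      finally have "3 * cmod d / 8 \<le> Re (\<beta> * (a (b l) * (y - x)))" by simp
      moreover have "2 * r < 3 * cmod d / 8" using d by (simp add: r_def)
      ultimately show ?thesis by linarith
    qed
    show ?case
    proof
      fix x
      have "prob {\<omega> \<in> space M. cmod ((\<Sum>j\<in>(J - D) \<union> b ` {..<m}. a j * \<xi> j \<omega>) - x) \<le> r}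
          \<le> \<gamma> ^ m / real (m + 1) + (1 - \<gamma> ^ m) * (1 / real (m + 1) + (1 - \<gamma> ^ m) ^ N)"
      proof (rule concentration_step[where A=A and B=B and \<beta>=\<beta> and n=n])
        show "2 * r < Re (\<beta> * (a (b l) * (v - u)))" if "l < m" "u \<in> A l" "v \<in> B l" for l u v
          using sep that by blast
      qed (use finJ Suc.prems(1) b bD D' IH \<beta> d in
        \<open>auto simp: bij_betw_def A_def B_def \<gamma>_def r_def mult.commute\<close>)
      also have "(J - D) \<union> b ` {..<m} = J" using b D' by (auto simp: bij_betw_def)
      also have "\<gamma> ^ m / real (m + 1) + (1 - \<gamma> ^ m) * (1 / real (m + 1) + (1 - \<gamma> ^ m) ^ N) =
          1 / real (m + 1) + (1 - \<gamma> ^ m) ^ Suc N"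
        by (simp add: algebra_simps diff_divide_distrib)
      finally show "prob {\<omega> \<in> space M. cmod ((\<Sum>j\<in>J. a j * \<xi> j \<omega>) - x) \<le> r} \<le> 1 / real (m + 1) + (1 - \<gamma> ^ m) ^ Suc N" .
    qed
  qed
  show ?thesis
  proof (intro exI[of _ "2 * m * N"] exI[of _ r] conjI allI impI)
    fix n and a :: "nat \<Rightarrow> complex" and x
    assume "2 * m * N \<le> card {j. j \<le> n \<and> 1 \<le> cmod (a j)}"
    then have "2 * m * N \<le> card {j \<in> {..n}. 1 \<le> cmod (a j)}" by (simp add: atMost_def)
    from main[OF subset_refl this]
    have "prob {\<omega> \<in> space M. cmod ((\<Sum>j\<le>n. a j * \<xi> j \<omega>) - x) \<le> r} \<le> 1 / real (m + 1) + (1 - \<gamma> ^ m) ^ N" by blast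
    then show "prob {\<omega> \<in> space M. cmod ((\<Sum>j\<le>n. a j * \<xi> j \<omega>) - x) \<le> r} \<le> \<eta>" using m N by linarith
  qed (use d in \<open>simp add: r_def\<close>)
qed

end

section \<open>Orthonormal polynomials\<close>

locale bernstein_markov_setup = green_setup +
  fixes \<tau> :: "complex measure"
  assumes finite_\<tau>: "finite_measure \<tau>" and \<tau>_on_K: "borel_measure_on K \<tau>"
    and bm: "bernstein_markov K \<tau>"
begin

lemma sets_\<tau> [measurable_cong]: "sets \<tau> = sets borel"
  using \<tau>_on_K by (simp add: borel_measure_on_def)

lemma space_\<tau>: "space \<tau> = UNIV"
  using sets_eq_imp_space_eq[OF sets_\<tau>] by simp

lemma AE_in_K: "AE z in \<tau>. z \<in> K"
  by (rule AE_I[of _ _ "- K"])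
    (use \<tau>_on_K compact_imp_closed[OF compact_K] in \<open>auto simp: borel_measure_on_def\<close>)

lemma measurable_poly [measurable]: "poly p \<in> borel_measurable borel" for p :: "complex poly"
  by (intro borel_measurable_continuous_onI continuous_intros)

lemma poly_bounded_on_K:
  obtains B where "\<And>z. z \<in> K \<Longrightarrow> cmod (poly p z) \<le> B" "B \<ge> 0"
proof -
  have "bounded (poly p ` K)"
    by (intro compact_imp_bounded compact_continuous_image continuous_intros compact_K)
  then show thesis using that by (auto simp: bounded_pos) (metis less_imp_le)
qed

lemma integrable_poly_product: "integrable \<tau> (\<lambda>z. poly p z * cnj (poly q z))"
proof -
  interpret finite_measure \<tau> by (rule finite_\<tau>)
  obtain A where A: "\<And>z. z \<in> K \<Longrightarrow> cmod (poly p z) \<le> A" "A \<ge> 0" using poly_bounded_on_K by blast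
  obtain B where B: "\<And>z. z \<in> K \<Longrightarrow> cmod (poly q z) \<le> B" "B \<ge> 0" using poly_bounded_on_K by blast
  have "(\<lambda>z. poly p z * cnj (poly q z)) \<in> borel_measurable borel"
    by (intro borel_measurable_continuous_onI continuous_intros)
  then have "(\<lambda>z. poly p z * cnj (poly q z)) \<in> borel_measurable \<tau>" by measurable
  moreover have "AE z in \<tau>. norm (poly p z * cnj (poly q z)) \<le> A * B"
    using AE_in_K by eventually_elim (use A B in \<open>auto simp: norm_mult intro!: mult_mono\<close>)
  ultimately show ?thesis by (intro integrable_const_bound)
qed

abbreviation inner_poly :: "complex poly \<Rightarrow> complex poly \<Rightarrow> complex" where
  "inner_poly \<equiv> L2_inner_poly \<tau>"

abbreviation norm_poly :: "complex poly \<Rightarrow> real" where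
  "norm_poly \<equiv> L2_norm_poly \<tau>"

lemma inner_poly_add_left: "inner_poly (p + q) r = inner_poly p r + inner_poly q r"
  unfolding L2_inner_poly_def by (simp add: distrib_right integrable_poly_product)

lemma inner_poly_diff_left: "inner_poly (p - q) r = inner_poly p r - inner_poly q r"
  unfolding L2_inner_poly_def by (simp add: left_diff_distrib integrable_poly_product)

lemma inner_poly_smult_left: "inner_poly (smult c p) r = c * inner_poly p r"
  unfolding L2_inner_poly_def by (simp add: mult.assoc)

lemma inner_poly_sum_left: "inner_poly (\<Sum>i\<in>I. f i) r = (\<Sum>i\<in>I. inner_poly (f i) r)"
proof (induction I rule: infinite_finite_induct)
  case (insert i I)
  then show ?case by (simp add: inner_poly_add_left)
qed (simp_all add: L2_inner_poly_def)

lemma inner_poly_cnj: "inner_poly q p = cnj (inner_poly p q)"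
proof -
  have "(\<integral>z. cnj (poly p z * cnj (poly q z)) \<partial>\<tau>) = cnj (\<integral>z. poly p z * cnj (poly q z) \<partial>\<tau>)"
    by (rule integral_bounded_linear[OF bounded_linear_cnj integrable_poly_product])
  then show ?thesis by (simp add: L2_inner_poly_def mult.commute)
qed

lemma norm_poly_sq: "complex_of_real ((norm_poly p)\<^sup>2) = inner_poly p p"
proof -
  have "inner_poly p p = (\<integral>z. complex_of_real ((cmod (poly p z))\<^sup>2) \<partial>\<tau>)"
    unfolding L2_inner_poly_def complex_norm_square ..
  also have "\<dots> = complex_of_real (\<integral>z. (cmod (poly p z))\<^sup>2 \<partial>\<tau>)"
    by (rule integral_complex_of_real)
  also have "(\<integral>z. (cmod (poly p z))\<^sup>2 \<partial>\<tau>) = (norm_poly p)\<^sup>2"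
    by (simp add: L2_norm_poly_def integral_nonneg_AE)
  finally show ?thesis by simp
qed

lemma norm_poly_nonneg: "norm_poly p \<ge> 0"
  by (simp add: L2_norm_poly_def integral_nonneg_AE)

text \<open>Bernstein-Markov bounds \<open>p\<close> on the infinite set \<open>K\<close> by its
  norm, so a vanishing norm forces \<open>p = 0\<close>. In particular Gram-Schmidt never divides by
  0.\<close>

lemma norm_poly_pos:
  assumes "p \<noteq> 0"
  shows "norm_poly p > 0"
proof -
  obtain w where w: "w \<in> K" "poly p w \<noteq> 0" using poly_nonzero_on_K[OF assms] by blast
  obtain C where "\<forall>n::nat. \<forall>p :: complex poly. degree p \<le> n \<longrightarrow>
        (\<forall>z\<in>K. cmod (poly p z) \<le> C * exp (1 * real n) * L2_norm_poly \<tau> p)"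
    using bm unfolding bernstein_markov_def by (metis zero_less_one)
  then have "cmod (poly p w) \<le> C * exp (1 * real (degree p)) * norm_poly p" using w by blast
  then have "norm_poly p \<noteq> 0" using w by auto
  then show ?thesis using norm_poly_nonneg[of p] by simp
qed

abbreviation orth :: "nat \<Rightarrow> complex poly" where
  "orth \<equiv> gram_schmidt_poly \<tau>"

lemma orth_facts: "degree (orth j) = j \<and> (\<forall>k<j. inner_poly (orth j) (orth k) = 0) \<and> inner_poly (orth j) (orth j) = 1"
proof (induction j rule: less_induct)
  case (less j)
  note IH = less
  define s where "s = (\<Sum>k<j. smult (inner_poly (monom 1 j) (orth k)) (orth k))"
  define r where "r = monom 1 j - s"
  have qj: "orth j = smult (of_real (1 / norm_poly r)) r"
    by (subst gram_schmidt_poly.simps) (simp add: r_def s_def Let_def)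
  have sj: "coeff s j = 0" "degree s \<le> j"
  proof -
    have "coeff (orth k) j = 0" if "k < j" for k
      using less[OF that] that by (intro coeff_eq_0) simp
    then show "coeff s j = 0" by (simp add: s_def coeff_sum)
    show "degree s \<le> j" unfolding s_def
      using less by (intro degree_sum_le order_trans[OF degree_smult_le]) auto
  qed
  have cr: "coeff r j = 1" by (simp add: r_def sj)
  have "degree r \<le> j" unfolding r_def by (intro degree_diff_le degree_monom_le sj)
  moreover have "j \<le> degree r" by (rule le_degree) (simp add: cr)
  ultimately have dr: "degree r = j" by simp
  have r0: "r \<noteq> 0" using cr by auto
  note nr = norm_poly_pos[OF r0]
  have orth_lt: "inner_poly (orth k) (orth l) = (if k = l then 1 else 0)" if "k < j" "l < j" for k l
  proof (cases k l rule: linorder_cases)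
    case less
    then have "inner_poly (orth l) (orth k) = 0" using IH that by blast
    then have "inner_poly (orth k) (orth l) = 0" by (subst inner_poly_cnj) simp
    then show ?thesis using less by simp
  next
    case greater
    then have "inner_poly (orth k) (orth l) = 0" using IH that by blast
    then show ?thesis using greater by simp
  next
    case equal
    then show ?thesis using IH that by auto
  qed
  have rl: "inner_poly r (orth l) = 0" if "l < j" for l
  proof -
    have "inner_poly s (orth l) = (\<Sum>k<j. inner_poly (monom 1 j) (orth k) * (if k = l then 1 else 0))"
      unfolding s_def inner_poly_sum_left inner_poly_smult_left
      using orth_lt that by (intro sum.cong) auto
    also have "\<dots> = (\<Sum>k<j. if k = l then inner_poly (monom 1 j) (orth k) else 0)"
      by (intro sum.cong) auto
    also have "\<dots> = inner_poly (monom 1 j) (orth l)" using that by simp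
    finally show ?thesis by (simp add: r_def inner_poly_diff_left)
  qed
  have "inner_poly (orth j) (orth j) = 1"
  proof -
    have "inner_poly (orth j) (orth j) = of_real (1 / norm_poly r) * cnj (of_real (1 / norm_poly r) * inner_poly r r)"
      unfolding qj inner_poly_smult_left by (subst inner_poly_cnj) (simp add: inner_poly_smult_left)
    also have "\<dots> = of_real (1 / norm_poly r * (1 / norm_poly r) * (norm_poly r)\<^sup>2)"
      unfolding norm_poly_sq[symmetric] by simp
    also have "1 / norm_poly r * (1 / norm_poly r) * (norm_poly r)\<^sup>2 = 1"
      using nr by (simp add: power2_eq_square)
    finally show ?thesis by simp
  qed
  moreover have "degree (orth j) = j" unfolding qj using nr dr by simp
  moreover have "inner_poly (orth j) (orth k) = 0" if "k < j" for k
    unfolding qj inner_poly_smult_left using rl[OF that] by simp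
  ultimately show ?case by blast
qed

lemma degree_orth: "degree (orth j) = j"
  using orth_facts by blast

lemma inner_orth: "inner_poly (orth j) (orth k) = (if j = k then 1 else 0)"
proof (cases j k rule: linorder_cases)
  case less
  then have "inner_poly (orth k) (orth j) = 0" using orth_facts by blast
  then have "inner_poly (orth j) (orth k) = 0" by (subst inner_poly_cnj) simp
  then show ?thesis using less by simp
qed (use orth_facts in auto)

lemma norm_orth: "norm_poly (orth j) = 1"
proof -
  have "complex_of_real ((norm_poly (orth j))\<^sup>2) = 1" unfolding norm_poly_sq by (simp add: inner_orth)
  then have "(norm_poly (orth j))\<^sup>2 = 1" by (simp only: of_real_eq_1_iff)
  then show ?thesis using norm_poly_nonneg[of "orth j"] by (simp add: power2_eq_1_iff)
qed

lemma orth_nonzero: "orth j \<noteq> 0"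
  using inner_orth[of j j] by (auto simp: L2_inner_poly_def)

section \<open>The Bergman function and lower bounds for orthonormal polynomials\<close>

lemma orth_expansion:
  assumes "degree p \<le> m"
  shows "\<exists>c. p = (\<Sum>j\<le>m. smult (c j) (orth j))"
  using assms
proof (induction m arbitrary: p)
  case 0
  then obtain a where a: "p = [:a:]" by (metis degree_eq_zeroE le_zero_eq)
  obtain b where b: "orth 0 = [:b:]" using degree_orth[of 0] by (metis degree_eq_zeroE)
  then have "b \<noteq> 0" using orth_nonzero[of 0] by auto
  then show ?case using a b by (intro exI[of _ "\<lambda>_. a / b"]) simp
next
  case (Suc m)
  define c where "c = coeff p (Suc m) / coeff (orth (Suc m)) (Suc m)"
  have "coeff (orth (Suc m)) (Suc m) \<noteq> 0"
    using orth_nonzero[of "Suc m"] degree_orth[of "Suc m"] by (metis leading_coeff_0_iff)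
  then have 0: "coeff (p - smult c (orth (Suc m))) (Suc m) = 0" by (simp add: c_def)
  have "degree (p - smult c (orth (Suc m))) \<le> Suc m"
    using Suc.prems degree_orth by (intro degree_diff_le order_trans[OF degree_smult_le]) auto
  then have "degree (p - smult c (orth (Suc m))) \<le> m"
    using 0 by (metis le_SucE leading_coeff_0_iff degree_0 zero_le)
  then obtain c' where c': "p - smult c (orth (Suc m)) = (\<Sum>j\<le>m. smult (c' j) (orth j))" using Suc.IH by blast
  have "p = (\<Sum>j\<le>m. smult (c' j) (orth j)) + smult c (orth (Suc m))" using c' by (simp add: algebra_simps)
  also have "(\<Sum>j\<le>m. smult (c' j) (orth j)) = (\<Sum>j\<le>m. smult ((c'(Suc m := c)) j) (orth j))"
    by (intro sum.cong) auto
  finally have "p = (\<Sum>j\<le>Suc m. smult ((c'(Suc m := c)) j) (orth j))" by simp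
  then show ?case by blast
qed

text \<open>Parseval and Cauchy-Schwarz; the sum on the right is the Bergman (Christoffel) function
  of \<open>\<tau>\<close>.\<close>

lemma bergman_bound:
  assumes "degree p \<le> m"
  shows "(cmod (poly p z))\<^sup>2 \<le> (norm_poly p)\<^sup>2 * (\<Sum>j\<le>m. (cmod (poly (orth j) z))\<^sup>2)"
proof -
  obtain c where c: "p = (\<Sum>j\<le>m. smult (c j) (orth j))" using orth_expansion[OF assms] by blast
  have coef: "inner_poly p (orth j) = c j" if "j \<le> m" for j
  proof -
    have "inner_poly p (orth j) = (\<Sum>i\<le>m. c i * (if i = j then 1 else 0))"
      by (subst c) (simp only: inner_poly_sum_left inner_poly_smult_left inner_orth)
    also have "\<dots> = (\<Sum>i\<le>m. if i = j then c i else 0)" by (intro sum.cong) auto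
    finally show ?thesis using that by simp
  qed
  have "inner_poly p p = (\<Sum>j\<le>m. c j * inner_poly (orth j) p)"
    by (subst (1) c) (simp only: inner_poly_sum_left inner_poly_smult_left)
  also have "\<dots> = (\<Sum>j\<le>m. complex_of_real ((cmod (c j))\<^sup>2))"
  proof (intro sum.cong refl)
    fix j assume "j \<in> {..m}"
    then have "inner_poly (orth j) p = cnj (c j)" using coef[of j] by (subst inner_poly_cnj) simp
    then show "c j * inner_poly (orth j) p = complex_of_real ((cmod (c j))\<^sup>2)"
      by (simp only: complex_norm_square)
  qed
  finally have "complex_of_real ((norm_poly p)\<^sup>2) = complex_of_real (\<Sum>j\<le>m. (cmod (c j))\<^sup>2)"
    by (simp only: norm_poly_sq of_real_sum)
  then have parseval: "(norm_poly p)\<^sup>2 = (\<Sum>j\<le>m. (cmod (c j))\<^sup>2)" by (simp only: of_real_eq_iff)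
  have "poly p z = (\<Sum>j\<le>m. c j * poly (orth j) z)" by (subst c) (simp add: poly_sum)
  then have "cmod (poly p z) \<le> (\<Sum>j\<le>m. cmod (c j) * cmod (poly (orth j) z))"
    by (metis (no_types, lifting) norm_mult norm_sum sum.cong)
  then have "(cmod (poly p z))\<^sup>2 \<le> (\<Sum>j\<le>m. cmod (c j) * cmod (poly (orth j) z))\<^sup>2"
    by (intro power_mono) auto
  also have "\<dots> \<le> (\<Sum>j\<le>m. (cmod (c j))\<^sup>2) * (\<Sum>j\<le>m. (cmod (poly (orth j) z))\<^sup>2)"
    by (rule Cauchy_Schwarz_ineq_sum)
  finally show ?thesis by (simp add: parseval)
qed

lemma orth_upper:
  assumes "\<epsilon> > 0"
  shows "\<exists>C>0. \<forall>j z. cmod (poly (orth j) z) \<le> C * exp (real j * (V z + \<epsilon>))"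
proof -
  obtain C where C: "C > 0" "\<forall>n::nat. \<forall>p :: complex poly. degree p \<le> n \<longrightarrow>
        (\<forall>z\<in>K. cmod (poly p z) \<le> C * exp (\<epsilon> * real n) * L2_norm_poly \<tau> p)"
    using bm assms unfolding bernstein_markov_def by blast
  have "cmod (poly (orth j) z) \<le> C * exp (real j * (V z + \<epsilon>))" for j z
  proof -
    have "cmod (poly (orth j) z) \<le> (C * exp (\<epsilon> * real j)) * exp (real (degree (orth j)) * V z)"
    proof (rule bernstein_walsh)
      fix w assume "w \<in> K"
      then show "cmod (poly (orth j) w) \<le> C * exp (\<epsilon> * real j)"
        using C(2)[rule_format, of "orth j" j w] degree_orth norm_orth by simp
    qed (use C in simp)
    also have "\<dots> = C * exp (real j * (V z + \<epsilon>))"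
      by (simp add: degree_orth mult.assoc exp_add[symmetric] algebra_simps)
    finally show ?thesis .
  qed
  then show ?thesis using C(1) by blast
qed

text \<open>A power of a polynomial nearly extremal at \<open>z\<close> is bounded by 1 on
  \<open>K\<close>, so its squared norm is at most the mass of \<open>\<tau>\<close>. By
  \<open>bergman_bound\<close> the Bergman function at \<open>z\<close> is then nearly as large as
  exp (2 n V(z)), and one of its n + 1 terms has to be large.\<close>

lemma orth_max_lower:
  assumes \<epsilon>: "\<epsilon> > 0"
  shows "\<forall>\<^sub>F n in sequentially. \<exists>j\<le>n. exp (real n * (V z - \<epsilon>)) \<le> cmod (poly (orth j) z)"
proof -
  interpret T: finite_measure \<tau> by (rule finite_\<tau>)
  obtain p where p: "degree p > 0" "\<forall>w\<in>K. cmod (poly p w) \<le> 1" "exp (real (degree p) * (V z - \<epsilon>/2)) \<le> cmod (poly p z)"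
    using V_approx[of "\<epsilon>/2" z] \<epsilon> by auto
  define d where "d = degree p"
  define c0 where "c0 = real d * \<bar>V z - \<epsilon>/2\<bar>"
  define m where "m = measure \<tau> UNIV + 1"
  have m: "m > 0" by (simp add: m_def add_nonneg_pos)
  have "filterlim (\<lambda>x::real. exp (x * \<epsilon> - 2 * c0) / (m * (x + 1))) at_top at_top"
    using m \<epsilon> by real_asymp
  then have "filterlim (\<lambda>n. exp (real n * \<epsilon> - 2 * c0) / (m * (real n + 1))) at_top sequentially"
    by (rule filterlim_compose[OF _ filterlim_real_sequentially])
  then have "\<forall>\<^sub>F n in sequentially. 1 \<le> exp (real n * \<epsilon> - 2 * c0) / (m * (real n + 1))"
    by (simp add: filterlim_at_top)
  then show ?thesis
  proof eventually_elim
    case (elim n)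
    define l where "l = n div d"
    have ld: "l * d \<le> n" "n < l * d + d"
      using p(1) by (auto simp: l_def d_def) (metis add.commute dividend_less_div_times)
    have dl: "degree (p ^ l) \<le> n" using degree_power_le[of p l] ld by (simp add: d_def mult.commute)
    have nl: "(norm_poly (p ^ l))\<^sup>2 \<le> m"
    proof -
      have "(norm_poly (p ^ l))\<^sup>2 = (\<integral>z. (cmod (poly (p ^ l) z))\<^sup>2 \<partial>\<tau>)"
        by (simp add: L2_norm_poly_def integral_nonneg_AE)
      also have "\<dots> \<le> (\<integral>z. 1 \<partial>\<tau>)"
      proof (rule integral_mono_AE)
        show AE: "AE z in \<tau>. (cmod (poly (p ^ l) z))\<^sup>2 \<le> 1"
          using AE_in_K by eventually_elim (use p(2) in \<open>auto simp: norm_power power_le_one\<close>)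
        show "integrable \<tau> (\<lambda>z. (cmod (poly (p ^ l) z))\<^sup>2)"
          by (rule T.integrable_const_bound[of _ 1]) (use AE in \<open>auto simp del: poly_power\<close>)
      qed simp
      finally show ?thesis by (simp add: m_def space_\<tau>)
    qed
    define S where "S = (\<Sum>j\<le>n. (cmod (poly (orth j) z))\<^sup>2)"
    have "real n * (V z - \<epsilon>/2) - c0 \<le> real (l * d) * (V z - \<epsilon>/2)"
    proof -
      have "(real n - real (l * d)) * (V z - \<epsilon>/2) \<le> \<bar>(real n - real (l * d)) * (V z - \<epsilon>/2)\<bar>" by (rule abs_ge_self)
      also have "\<dots> = \<bar>real n - real (l * d)\<bar> * \<bar>V z - \<epsilon>/2\<bar>" by (rule abs_mult)
      also have "\<dots> \<le> real d * \<bar>V z - \<epsilon>/2\<bar>"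
      proof (rule mult_right_mono)
        have "real (l * d) \<le> real n" "real n \<le> real (l * d + d)"
          using ld by (simp_all only: of_nat_le_iff less_imp_le)
        then show "\<bar>real n - real (l * d)\<bar> \<le> real d" by auto
      qed simp
      finally show ?thesis by (simp add: c0_def algebra_simps)
    qed
    then have "exp (real n * (V z - \<epsilon>/2) - c0) \<le> exp (real (l * d) * (V z - \<epsilon>/2))" by simp
    also have "\<dots> = exp (real d * (V z - \<epsilon>/2)) ^ l" by (simp add: exp_of_nat_mult[symmetric] mult_ac)
    also have "\<dots> \<le> cmod (poly p z) ^ l" using p(3) by (intro power_mono) (auto simp: d_def)
    finally have "(exp (real n * (V z - \<epsilon>/2) - c0))\<^sup>2 \<le> (cmod (poly p z) ^ l)\<^sup>2"
      by (intro power_mono) auto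
    also have "\<dots> = (cmod (poly (p ^ l) z))\<^sup>2" by (simp add: norm_power)
    also have "\<dots> \<le> (norm_poly (p ^ l))\<^sup>2 * S" unfolding S_def by (rule bergman_bound[OF dl])
    also have "\<dots> \<le> m * S" using nl by (intro mult_right_mono) (auto simp: S_def sum_nonneg)
    finally have low: "(exp (real n * (V z - \<epsilon>/2) - c0))\<^sup>2 \<le> m * S" .
    show ?case
    proof (rule ccontr)
      assume "\<not> ?thesis"
      then have lt: "cmod (poly (orth j) z) < exp (real n * (V z - \<epsilon>))" if "j \<le> n" for j using that by force
      have "S < (\<Sum>j\<le>n. (exp (real n * (V z - \<epsilon>)))\<^sup>2)"
        unfolding S_def using lt by (intro sum_strict_mono power_strict_mono) auto
      also have "\<dots> = (real n + 1) * (exp (real n * (V z - \<epsilon>)))\<^sup>2" by simp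
      finally have "m * S < m * ((real n + 1) * (exp (real n * (V z - \<epsilon>)))\<^sup>2)"
        using m by simp
      with low have "(exp (real n * (V z - \<epsilon>/2) - c0))\<^sup>2 < m * (real n + 1) * (exp (real n * (V z - \<epsilon>)))\<^sup>2"
        by (simp add: mult.assoc)
      also have "(exp (real n * (V z - \<epsilon>/2) - c0))\<^sup>2 = exp (real n * \<epsilon> - 2 * c0) * (exp (real n * (V z - \<epsilon>)))\<^sup>2"
        by (simp add: exp_add[symmetric] exp_double[symmetric] algebra_simps)
      finally have "exp (real n * \<epsilon> - 2 * c0) < m * (real n + 1)" by simp
      then show False using elim m by (simp add: le_divide_eq)
    qed
  qed
qed

text \<open>One large value, at some index \<open>i\<close>, comes from
  \<open>orth_max_lower\<close>. As \<open>orth_upper\<close> limits growth, \<open>i / n\<close> is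
  bounded below by a ratio close to 1, so the induction hypothesis at \<open>i - 1\<close> gives
  \<open>k\<close> further indices whose values are still large on the scale of \<open>n\<close>.
  Positivity of \<open>V z\<close> is what forces \<open>i\<close> to grow.\<close>

lemma many_large_orth_outside:
  assumes V: "V z > 0" and \<delta>: "\<delta> > 0"
  shows "\<forall>\<^sub>F n in sequentially. k \<le> card {j. j \<le> n \<and> exp (real n * (V z - \<delta>)) \<le> cmod (poly (orth j) z)}"
  using \<delta>
proof (induction k arbitrary: \<delta>)
  case (Suc k)
  define e where "e = min \<delta> (V z) / 4"
  have e: "e > 0" "4 * e \<le> \<delta>" "4 * e \<le> V z" using V Suc.prems by (auto simp: e_def)
  obtain n0 where n0: "\<And>n. n \<ge> n0 \<Longrightarrow> k \<le> card {j. j \<le> n \<and> exp (real n * (V z - e)) \<le> cmod (poly (orth j) z)}"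
    using Suc.IH[OF e(1)] by (auto simp: eventually_sequentially)
  obtain C where C: "C > 0" "\<And>j. cmod (poly (orth j) z) \<le> C * exp (real j * (V z + e))"
    using orth_upper[OF e(1)] by blast
  have Ve: "V z - e > 0" "V z + e > 0" using e by auto
  have "filterlim (\<lambda>x::real. x * (V z - e) - ln C) at_top at_top" using Ve by real_asymp
  then have "filterlim (\<lambda>n. real n * (V z - e) - ln C) at_top sequentially"
    by (rule filterlim_compose[OF _ filterlim_real_sequentially])
  then have ev1: "\<forall>\<^sub>F n in sequentially. (real n0 + 1) * (V z + e) \<le> real n * (V z - e) - ln C"
    by (simp add: filterlim_at_top)
  \<comment> \<open>The growth bound gives roughly \<open>i \<ge> n * (V z - e) / (V z + e)\<close>.
    Multiplied by \<open>V z - e\<close>, this still exceeds \<open>n * (V z - 4 * e)\<close>, which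
    explains the quarter in the choice of \<open>e\<close>.\<close>
  have pos: "(V z - e) * (V z - e) / (V z + e) - (V z - 4 * e) > 0"
  proof -
    have "(V z - e) * (V z - e) - (V z - 4 * e) * (V z + e) = e * (V z + 5 * e)" by (simp add: algebra_simps)
    then have "(V z - 4 * e) * (V z + e) < (V z - e) * (V z - e)" using e Ve by (simp add: algebra_simps add_pos_pos)
    then show ?thesis using Ve by (simp add: less_divide_eq)
  qed
  have "filterlim (\<lambda>x::real. x * ((V z - e) * (V z - e) / (V z + e) - (V z - 4 * e)) - (ln C / (V z + e) + 1) * (V z - e)) at_top at_top"
    using pos by real_asymp
  then have "filterlim (\<lambda>n. real n * ((V z - e) * (V z - e) / (V z + e) - (V z - 4 * e)) - (ln C / (V z + e) + 1) * (V z - e)) at_top sequentially"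
    by (rule filterlim_compose[OF _ filterlim_real_sequentially])
  then have ev2: "\<forall>\<^sub>F n in sequentially. 0 \<le> real n * ((V z - e) * (V z - e) / (V z + e) - (V z - 4 * e)) - (ln C / (V z + e) + 1) * (V z - e)"
    unfolding filterlim_at_top by blast
  from orth_max_lower[OF e(1), of z] ev1 ev2 show ?case
  proof eventually_elim
    case (elim n)
    obtain i where i: "i \<le> n" "exp (real n * (V z - e)) \<le> cmod (poly (orth i) z)" using elim(1) by blast
    have "exp (real n * (V z - e)) \<le> C * exp (real i * (V z + e))" using i(2) C(2)[of i] by linarith
    also have "\<dots> = exp (ln C + real i * (V z + e))" using C(1) by (simp add: exp_add)
    finally have ineq: "real n * (V z - e) - ln C \<le> real i * (V z + e)" by simp
    then have "(real n0 + 1) * (V z + e) \<le> real i * (V z + e)" using elim(2) by linarith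
    then have "real n0 + 1 \<le> real i" using Ve by simp
    then have i0: "n0 + 1 \<le> i" by linarith
    \<comment> \<open>The induction hypothesis is applied one index lower, so that \<open>i\<close>
      itself is not counted twice.\<close>
    define i' where "i' = i - 1"
    have i': "n0 \<le> i'" "i = Suc i'" using i0 by (auto simp: i'_def)
    have "(real n * (V z - e) - ln C) / (V z + e) \<le> real i" using ineq Ve by (simp add: pos_divide_le_eq)
    then have "((real n * (V z - e) - ln C) / (V z + e) - 1) * (V z - e) \<le> real i' * (V z - e)"
      using Ve i' by (intro mult_right_mono) auto
    moreover have "((real n * (V z - e) - ln C) / (V z + e) - 1) * (V z - e) - real n * (V z - 4 * e) =
       real n * ((V z - e) * (V z - e) / (V z + e) - (V z - 4 * e)) - (ln C / (V z + e) + 1) * (V z - e)"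
      by (simp add: diff_divide_distrib add_divide_distrib algebra_simps)
    ultimately have "real n * (V z - 4 * e) \<le> real i' * (V z - e)" using elim(3) by linarith
    moreover have "real n * (V z - \<delta>) \<le> real n * (V z - 4 * e)" using e by (intro mult_left_mono) auto
    ultimately have exps: "exp (real n * (V z - \<delta>)) \<le> exp (real i' * (V z - e))" by simp
    define A where "A = {j. j \<le> i' \<and> exp (real i' * (V z - e)) \<le> cmod (poly (orth j) z)}"
    have finA: "finite A" by (rule finite_subset[of _ "{..i'}"]) (auto simp: A_def)
    have "Suc k \<le> card (insert i A)"
      using n0[OF i'(1)] finA i' by (simp add: A_def[symmetric]) (simp add: A_def card_insert_if)
    also have "\<dots> \<le> card {j. j \<le> n \<and> exp (real n * (V z - \<delta>)) \<le> cmod (poly (orth j) z)}"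
    proof (rule card_mono)
      show "finite {j. j \<le> n \<and> exp (real n * (V z - \<delta>)) \<le> cmod (poly (orth j) z)}"
        by (rule finite_subset[of _ "{..n}"]) auto
      have "exp (real n * (V z - \<delta>)) \<le> exp (real n * (V z - e))" using e by (simp add: mult_left_mono)
      then have "exp (real n * (V z - \<delta>)) \<le> cmod (poly (orth i) z)" using i(2) by (rule order_trans)
      moreover have "exp (real n * (V z - \<delta>)) \<le> cmod (poly (orth j) z) \<and> j \<le> n" if "j \<in> A" for j
        using that i(1) i'(2) order_trans[OF exps] by (auto simp: A_def)
      ultimately show "insert i A \<subseteq> {j. j \<le> n \<and> exp (real n * (V z - \<delta>)) \<le> cmod (poly (orth j) z)}"
        using i(1) by blast
    qed
    finally show ?case .
  qed
qed simp

text \<open>Where \<open>V\<close> vanishes the threshold tends to 0, and the first \<open>k\<close>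
  polynomials, fixed and nonzero at \<open>z\<close>, eventually exceed it.\<close>

theorem many_large_orth:
  assumes nz: "\<And>j. poly (orth j) z \<noteq> 0" and \<delta>: "\<delta> > 0"
  shows "\<forall>\<^sub>F n in sequentially. k \<le> card {j. j \<le> n \<and> exp (real n * (V z - \<delta>)) \<le> cmod (poly (orth j) z)}"
proof (cases "V z = 0")
  case False
  then show ?thesis using many_large_orth_outside[OF _ \<delta>] V_nonneg[of z] by simp
next
  case True
  have "\<forall>\<^sub>F n in sequentially. exp (real n * (V z - \<delta>)) < cmod (poly (orth j) z)" for j
  proof (rule order_tendstoD(2))
    have "((\<lambda>x::real. exp (x * (0 - \<delta>))) \<longlongrightarrow> 0) at_top" using \<delta> by real_asymp
    then show "(\<lambda>n. exp (real n * (V z - \<delta>))) \<longlonglongrightarrow> 0"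
      unfolding True by (rule filterlim_compose[OF _ filterlim_real_sequentially])
  qed (use nz in simp)
  then have "\<forall>\<^sub>F n in sequentially. \<forall>j\<in>{..<k}. exp (real n * (V z - \<delta>)) < cmod (poly (orth j) z)"
    by (intro eventually_ball_finite) auto
  moreover have "\<forall>\<^sub>F n in sequentially. n \<ge> k" by (rule eventually_ge_at_top)
  ultimately show ?thesis
  proof eventually_elim
    case (elim n)
    have "card {..<k} \<le> card {j. j \<le> n \<and> exp (real n * (V z - \<delta>)) \<le> cmod (poly (orth j) z)}"
    proof (rule card_mono)
      show "finite {j. j \<le> n \<and> exp (real n * (V z - \<delta>)) \<le> cmod (poly (orth j) z)}"
        by (rule finite_subset[of _ "{..n}"]) auto
    qed (use elim in \<open>auto intro: less_imp_le\<close>)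
    then show ?case by simp
  qed
qed

end

section \<open>Measurability of the zero measure\<close>

lemma simultaneous_convergent_subsequence:
  fixes v :: "nat \<Rightarrow> nat \<Rightarrow> complex"
  assumes "\<And>k i. i < d \<Longrightarrow> cmod (v k i) \<le> R"
  shows "\<exists>s L. strict_mono (s :: nat \<Rightarrow> nat) \<and> (\<forall>i<d. (\<lambda>k. v (s k) i) \<longlonglongrightarrow> L i)"
  using assms
proof (induction d)
  case 0
  show ?case by (auto intro!: exI[of _ id] strict_mono_id)
next
  case (Suc d)
  then obtain s L where s: "strict_mono (s :: nat \<Rightarrow> nat)" and L: "\<And>i. i < d \<Longrightarrow> (\<lambda>k. v (s k) i) \<longlonglongrightarrow> L i"
    by (metis less_Suc_eq)
  have "seq_compact (cball (0::complex) R)" by (simp add: compact_imp_seq_compact)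
  moreover have "\<forall>k. v (s k) d \<in> cball 0 R" using Suc.prems by simp
  ultimately obtain l r where r: "strict_mono (r :: nat \<Rightarrow> nat)" "((\<lambda>k. v (s k) d) \<circ> r) \<longlonglongrightarrow> l"
    unfolding seq_compact_def by metis
  have "(\<lambda>k. v ((s \<circ> r) k) i) \<longlonglongrightarrow> (L(d := l)) i" if "i < Suc d" for i
  proof (cases "i = d")
    case False
    then have "((\<lambda>k. v (s k) i) \<circ> r) \<longlonglongrightarrow> L i"
      using that L[of i] r(1) by (intro LIMSEQ_subseq_LIMSEQ) auto
    then show ?thesis using False by (simp add: o_def)
  qed (use r(2) in \<open>simp add: o_def\<close>)
  then show ?case using strict_mono_o[OF s r(1)] by blast
qed

definition poly_of_coeffs :: "nat \<Rightarrow> (nat \<Rightarrow> complex) \<Rightarrow> complex poly" where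
  "poly_of_coeffs d c = (\<Sum>i\<le>d. monom (c i) i)"

lemma poly_poly_of_coeffs: "poly (poly_of_coeffs d c) z = (\<Sum>i\<le>d. c i * z ^ i)"
  by (simp add: poly_of_coeffs_def poly_sum poly_monom)

lemma coeff_poly_of_coeffs: "coeff (poly_of_coeffs d c) i = (if i \<le> d then c i else 0)"
  by (simp add: poly_of_coeffs_def coeff_sum)

lemma degree_poly_of_coeffs:
  assumes "c d \<noteq> 0"
  shows "degree (poly_of_coeffs d c) = d" "poly_of_coeffs d c \<noteq> 0" "lead_coeff (poly_of_coeffs d c) = c d"
proof -
  have "coeff (poly_of_coeffs d c) d \<noteq> 0" using assms by (simp add: coeff_poly_of_coeffs)
  then show "poly_of_coeffs d c \<noteq> 0" by auto
  have "degree (poly_of_coeffs d c) \<le> d" by (rule degree_le) (simp add: coeff_poly_of_coeffs)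
  then show "degree (poly_of_coeffs d c) = d"
    using le_degree[OF \<open>coeff (poly_of_coeffs d c) d \<noteq> 0\<close>] by simp
  then show "lead_coeff (poly_of_coeffs d c) = c d" by (simp add: coeff_poly_of_coeffs)
qed

text \<open>Cauchy's bound; it keeps the roots in a compact set while the leading coefficient stays
  away from 0.\<close>

lemma root_bound:
  assumes c: "c d \<noteq> 0" and z: "poly (poly_of_coeffs d c) z = 0"
  shows "cmod z \<le> 1 + (\<Sum>i<d. cmod (c i)) / cmod (c d)"
proof (cases "cmod z \<le> 1")
  case True
  then show ?thesis by (simp add: add_increasing2 sum_nonneg)
next
  case False
  have "d \<noteq> 0"
  proof
    assume "d = 0"
    then show False using z c by (simp add: poly_poly_of_coeffs)
  qed
  then obtain d' where d': "d = Suc d'" by (cases d) auto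
  have "(\<Sum>i\<le>d. c i * z ^ i) = (\<Sum>i<d. c i * z ^ i) + c d * z ^ d"
    by (simp add: lessThan_Suc_atMost[symmetric])
  then have "c d * z ^ d = - (\<Sum>i<d. c i * z ^ i)"
    using z by (simp add: poly_poly_of_coeffs eq_neg_iff_add_eq_0 add.commute)
  then have "cmod (c d) * cmod z ^ d = cmod (\<Sum>i<d. c i * z ^ i)" by (metis norm_minus_cancel norm_mult norm_power)
  also have "\<dots> \<le> (\<Sum>i<d. cmod (c i) * cmod z ^ d')"
  proof (rule order_trans[OF norm_sum], rule sum_mono)
    fix i assume "i \<in> {..<d}"
    then have "cmod z ^ i \<le> cmod z ^ d'" using False d' by (intro power_increasing) auto
    then show "norm (c i * z ^ i) \<le> cmod (c i) * cmod z ^ d'" by (simp add: norm_mult norm_power mult_left_mono)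
  qed
  also have "\<dots> = (\<Sum>i<d. cmod (c i)) * cmod z ^ d'" by (simp add: sum_distrib_right)
  finally have "(cmod (c d) * cmod z) * cmod z ^ d' \<le> (\<Sum>i<d. cmod (c i)) * cmod z ^ d'"
    by (simp only: d' power_Suc mult.assoc)
  moreover have "0 < cmod z ^ d'" using False by (intro zero_less_power) linarith
  ultimately have "cmod (c d) * cmod z \<le> (\<Sum>i<d. cmod (c i))"
    by (rule mult_right_le_imp_le)
  then have "cmod z \<le> (\<Sum>i<d. cmod (c i)) / cmod (c d)" using c by (simp add: pos_le_divide_eq mult.commute)
  then show ?thesis by simp
qed

lemma poly_list_roots:
  assumes "c d \<noteq> 0" "mset zs = proots (poly_of_coeffs d c)"
  shows "length zs = d" "poly (poly_of_coeffs d c) z = c d * (\<Prod>i<d. z - zs ! i)"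
proof -
  note D = degree_poly_of_coeffs[of c d, OF assms(1)]
  show len: "length zs = d"
    using size_proots_complex[of "poly_of_coeffs d c"] assms(2) D(1) by (metis size_mset)
  have "poly (poly_of_coeffs d c) z = c d * (\<Prod>w\<in>#mset zs. z - w)"
    unfolding assms(2) using poly_proots[OF D(2)] D(3) by simp
  also have "(\<Prod>w\<in>#mset zs. z - w) = (\<Prod>w\<leftarrow>zs. z - w)"
    by (simp flip: prod_mset_prod_list)
  also have "\<dots> = (\<Prod>i<d. z - zs ! i)"
    using len by (simp add: prod.list_conv_set_nth atLeast0LessThan)
  finally show "poly (poly_of_coeffs d c) z = c d * (\<Prod>i<d. z - zs ! i)" .
qed

text \<open>Continuity of the roots at fixed degree, by compactness: bounded root vectors have a
  convergent subsequence, and its limit is a root vector of the limit polynomial because the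
  factorised values converge.\<close>

lemma root_sums_converge:
  fixes f :: "complex \<Rightarrow> real" and x :: "nat \<Rightarrow> nat \<Rightarrow> complex"
  assumes x: "\<And>i. (\<lambda>k. x k i) \<longlonglongrightarrow> l i" and l: "l d \<noteq> 0" and f: "continuous_on UNIV f"
  shows "(\<lambda>k. \<Sum>z\<in>#proots (poly_of_coeffs d (x k)). f z) \<longlonglongrightarrow> (\<Sum>z\<in>#proots (poly_of_coeffs d l). f z)"
proof (rule ccontr)
  define S where "S c = (\<Sum>z\<in>#proots (poly_of_coeffs d c). f z)" for c
  assume "\<not> ?thesis"
  then obtain e where e: "e > 0" "\<And>N. \<exists>k\<ge>N. dist (S (x k)) (S l) \<ge> e"
    unfolding S_def lim_sequentially by (metis not_le)
  have ev: "\<forall>\<^sub>F k in sequentially. cmod (l d) / 2 < cmod (x k d)"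
    using l by (intro order_tendstoD(1)[OF tendsto_norm[OF x]]) auto
  then obtain N0 where N0: "\<And>k. k \<ge> N0 \<Longrightarrow> cmod (l d) / 2 < cmod (x k d)" by (auto simp: eventually_sequentially)
  have "infinite {k. k \<ge> N0 \<and> dist (S (x k)) (S l) \<ge> e}"
    unfolding infinite_nat_iff_unbounded_le
  proof
    fix N
    obtain k where "k \<ge> max N N0" "dist (S (x k)) (S l) \<ge> e" using e(2) by blast
    then show "\<exists>n\<ge>N. n \<in> {k. k \<ge> N0 \<and> dist (S (x k)) (S l) \<ge> e}" by auto
  qed
  then obtain r where r: "strict_mono (r :: nat \<Rightarrow> nat)" "\<And>k. r k \<ge> N0" "\<And>k. dist (S (x (r k))) (S l) \<ge> e"
    using infinite_enumerate by (metis (no_types, lifting) mem_Collect_eq)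
  define y where "y k = x (r k)" for k
  have y: "(\<lambda>k. y k i) \<longlonglongrightarrow> l i" for i
    using LIMSEQ_subseq_LIMSEQ[OF x r(1)] by (simp add: y_def o_def)
  have yd: "cmod (l d) / 2 < cmod (y k d)" for k using N0 r(2) by (simp add: y_def)
  then have yd0: "y k d \<noteq> 0" for k by (metis divide_nonneg_pos norm_ge_zero norm_zero not_le zero_less_numeral)
  have "\<forall>k. \<exists>zs. mset zs = proots (poly_of_coeffs d (y k))" by (simp add: ex_mset)
  then obtain zs where zs: "\<And>k. mset (zs k) = proots (poly_of_coeffs d (y k))" by metis
  note PL = poly_list_roots[OF yd0 zs]
  have "\<exists>B. \<forall>k. cmod (y k i) \<le> B" for i
    using convergent_imp_Bseq[of "\<lambda>k. y k i"] y by (auto simp: convergent_def Bseq_def)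
  then obtain B where B: "\<And>i k. cmod (y k i) \<le> B i" by metis
  define R where "R = 1 + (\<Sum>i<d. B i) / (cmod (l d) / 2)"
  have bnd: "cmod (zs k ! i) \<le> R" if i: "i < d" for k i
  proof -
    have "zs k ! i \<in># proots (poly_of_coeffs d (y k))" using i PL(1)[of k] by (simp flip: zs)
    then have "poly (poly_of_coeffs d (y k)) (zs k ! i) = 0"
      using degree_poly_of_coeffs(2)[of "y k" d, OF yd0] by (simp add: set_count_proots)
    from root_bound[of "y k" d, OF yd0 this]
    have "cmod (zs k ! i) \<le> 1 + (\<Sum>i<d. cmod (y k i)) / cmod (y k d)" .
    also have "(\<Sum>i<d. cmod (y k i)) / cmod (y k d) \<le> (\<Sum>i<d. B i) / (cmod (l d) / 2)"
      using yd[of k] l B by (intro frac_le sum_mono sum_nonneg) (auto intro: order_trans[OF norm_ge_zero])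
    finally show ?thesis by (simp add: R_def)
  qed
  obtain s L where s: "strict_mono (s :: nat \<Rightarrow> nat)" and L: "\<And>i. i < d \<Longrightarrow> (\<lambda>k. zs (s k) ! i) \<longlonglongrightarrow> L i"
    using simultaneous_convergent_subsequence[of d "\<lambda>k i. zs k ! i" R] bnd by blast
  have ys: "(\<lambda>k. y (s k) i) \<longlonglongrightarrow> l i" for i
    using LIMSEQ_subseq_LIMSEQ[OF y s] by (simp add: o_def)
  have "poly (poly_of_coeffs d l) z = poly (smult (l d) (\<Prod>i<d. [:- L i, 1:])) z" for z
  proof (rule LIMSEQ_unique)
    show "(\<lambda>k. poly (poly_of_coeffs d (y (s k))) z) \<longlonglongrightarrow> poly (poly_of_coeffs d l) z"
      unfolding poly_poly_of_coeffs by (intro tendsto_intros ys)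
    have "(\<lambda>k. y (s k) d * (\<Prod>i<d. z - zs (s k) ! i)) \<longlonglongrightarrow> l d * (\<Prod>i<d. z - L i)"
      by (intro tendsto_intros ys L) auto
    then show "(\<lambda>k. poly (poly_of_coeffs d (y (s k))) z) \<longlonglongrightarrow> poly (smult (l d) (\<Prod>i<d. [:- L i, 1:])) z"
      unfolding PL(2) by (simp add: poly_prod)
  qed
  then have "poly_of_coeffs d l = smult (l d) (\<Prod>i<d. [:- L i, 1:])" by (intro poly_eqI_degree[of UNIV] poly_ext)
  then have "proots (poly_of_coeffs d l) = (\<Sum>i<d. {#L i#})"
    using l by (simp add: proots_prod)
  moreover have "(\<Sum>z\<in>#(\<Sum>i\<in>I. {#L i#}). f z) = (\<Sum>i\<in>I. f (L i))" if "finite I" for I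
    using that by (induction I rule: finite_induct) auto
  ultimately have Sl: "S l = (\<Sum>i<d. f (L i))" by (simp add: S_def)
  have Sy: "S (y k) = (\<Sum>i<d. f (zs k ! i))" for k
  proof -
    have "S (y k) = (\<Sum>z\<leftarrow>zs k. f z)" unfolding S_def zs[symmetric] by (simp flip: sum_mset_sum_list)
    then show ?thesis using PL(1)[of k] by (simp add: sum_list_sum_nth atLeast0LessThan)
  qed
  have "(\<lambda>k. \<Sum>i<d. f (zs (s k) ! i)) \<longlonglongrightarrow> (\<Sum>i<d. f (L i))"
    using f L by (intro tendsto_sum isCont_tendsto_compose[of _ f]) (auto simp: continuous_on_eq_continuous_at)
  then have "(\<lambda>k. S (y (s k))) \<longlonglongrightarrow> S l" unfolding Sl Sy .
  then have "\<forall>\<^sub>F k in sequentially. dist (S (y (s k))) (S l) < e" using e(1) by (rule tendstoD)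
  then obtain k where "dist (S (y (s k))) (S l) < e" by (auto simp: eventually_sequentially)
  then show False using r(3)[of "s k"] by (simp add: y_def)
qed

lemma zero_measure_finite: "finite_measure (zero_measure n p)" "sets (zero_measure n p) = sets borel"
proof -
  have "finite_measure (null_measure borel :: complex measure)" by (rule finite_measureI) simp
  then show "finite_measure (zero_measure n p)" "sets (zero_measure n p) = sets borel"
    using zero_measure_props(1)[of p n] zero_measure_props(2)[of p n] by (cases "p = 0"; simp add: zero_measure_def)+
qed

text \<open>Where the coefficient of index \<open>d\<close> is nonzero, the roots depend
  continuously on the coefficients. Openness is tested by sequences, which converge in each
  coordinate.\<close>

lemma open_zero_measure_stratum:
  assumes U: "openin weak_star_topology U"
  shows "open {c :: nat \<Rightarrow> complex. c d \<noteq> 0 \<and> zero_measure n (poly_of_coeffs d c) \<in> U}" (is "open ?O")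
  unfolding open_closed closed_sequential_limits
proof (intro allI impI, elim conjE)
  fix x :: "nat \<Rightarrow> nat \<Rightarrow> complex" and l
  assume x: "\<forall>k. x k \<in> - ?O" and lim: "x \<longlonglongrightarrow> l"
  have xi: "(\<lambda>k. x k i) \<longlonglongrightarrow> l i" for i
  proof -
    have "isCont (\<lambda>c :: nat \<Rightarrow> complex. c i) l"
      by (rule continuous_on_interior[OF continuous_on_product_coordinates]) simp
    then show ?thesis by (rule isCont_tendsto_compose[of l "\<lambda>c. c i" x, OF _ lim])
  qed
  show "l \<in> - ?O"
  proof
    assume lO: "l \<in> ?O"
    have "\<forall>\<^sub>F k in sequentially. x k d \<noteq> 0"
      using lO by (intro tendsto_imp_eventually_ne[OF xi]) auto
    moreover have "\<forall>\<^sub>F k in sequentially. zero_measure n (poly_of_coeffs d (x k)) \<in> U"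
    proof (rule eventually_in_weak_star_open[OF U])
      fix f :: "complex \<Rightarrow> real" assume f: "continuous_on UNIV f" "bounded (range f)"
      have fm: "f \<in> borel_measurable borel" by (rule borel_measurable_continuous_onI[OF f(1)])
      \<comment> \<open>For \<open>n = 0\<close> both sides are 0, as division by 0 gives 0.\<close>
      have "(\<lambda>k. (\<Sum>z\<in>#proots (poly_of_coeffs d (x k)). f z) / real n)
          \<longlonglongrightarrow> (\<Sum>z\<in>#proots (poly_of_coeffs d l). f z) / real n"
        using lO by (cases "n = 0") (auto intro!: tendsto_divide root_sums_converge xi f)
      moreover have "\<forall>\<^sub>F k in sequentially. (\<Sum>z\<in>#proots (poly_of_coeffs d (x k)). f z) / real n =
          (\<integral>z. f z \<partial>zero_measure n (poly_of_coeffs d (x k)))"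
        using \<open>\<forall>\<^sub>F k in sequentially. x k d \<noteq> 0\<close>
        by eventually_elim (use degree_poly_of_coeffs(2) zero_measure_props(3) fm in metis)
      ultimately show "(\<lambda>k. \<integral>z. f z \<partial>zero_measure n (poly_of_coeffs d (x k)))
          \<longlonglongrightarrow> (\<integral>z. f z \<partial>zero_measure n (poly_of_coeffs d l))"
        using lO zero_measure_props(3)[OF degree_poly_of_coeffs(2) fm] by (simp add: filterlim_cong)
    qed (use lO zero_measure_finite in auto)
    ultimately have "\<forall>\<^sub>F k in sequentially. x k \<in> ?O" by eventually_elim simp
    then show False using x by (auto simp: eventually_sequentially)
  qed
qed

text \<open>\<open>measure\<close> is 0 on non-measurable sets, so a limit 1 needs this. Zero
  measures jump when the leading coefficient tends to 0 and roots run to infinity; the event is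
  therefore cut by degree into preimages of open strata on which the higher coefficients
  vanish.\<close>

theorem measurable_zero_measure_in_open:
  fixes H :: "'w \<Rightarrow> complex poly"
  assumes U: "openin weak_star_topology U"
    and H: "\<And>i. (\<lambda>\<omega>. coeff (H \<omega>) i) \<in> borel_measurable M"
    and deg: "\<And>\<omega>. degree (H \<omega>) \<le> n"
  shows "{\<omega> \<in> space M. zero_measure n (H \<omega>) \<in> U} \<in> sets M"
proof -
  define X where "X \<omega> = (\<lambda>i. coeff (H \<omega>) i)" for \<omega>
  have [measurable]: "X \<in> borel_measurable M"
    unfolding X_def by (intro measurable_coordinatewise_then_product H)
  note [measurable] = H
  have PX: "poly_of_coeffs (degree (H \<omega>)) (X \<omega>) = H \<omega>" for \<omega>
    by (rule poly_eqI) (simp add: coeff_poly_of_coeffs X_def coeff_eq_0)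
  define Strat where "Strat d = {c :: nat \<Rightarrow> complex. c d \<noteq> 0 \<and> zero_measure n (poly_of_coeffs d c) \<in> U}" for d
  have [measurable]: "Strat d \<in> sets borel" for d
    unfolding Strat_def by (intro borel_open open_zero_measure_stratum U)
  define E where "E d = {\<omega> \<in> space M. X \<omega> \<in> Strat d \<and> (\<forall>i\<in>{d<..n}. coeff (H \<omega>) i = 0)}" for d
  have E: "E d \<in> sets M" for d unfolding E_def by measurable
  \<comment> \<open>The piece on which the polynomial vanishes identically and its zero measure is
    null.\<close>
  define E0 where "E0 = {\<omega> \<in> space M. (\<forall>i\<in>{..n}. coeff (H \<omega>) i = 0) \<and> (null_measure borel :: complex measure) \<in> U}"
  have E0: "E0 \<in> sets M" unfolding E0_def by measurable
  have "{\<omega> \<in> space M. zero_measure n (H \<omega>) \<in> U} = (\<Union>d\<in>{..n}. E d) \<union> E0"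
  proof (intro set_eqI iffI)
    fix \<omega> assume "\<omega> \<in> {\<omega> \<in> space M. zero_measure n (H \<omega>) \<in> U}"
    then have w: "\<omega> \<in> space M" "zero_measure n (H \<omega>) \<in> U" by auto
    show "\<omega> \<in> (\<Union>d\<in>{..n}. E d) \<union> E0"
    proof (cases "H \<omega> = 0")
      case True
      then show ?thesis using w by (simp add: E0_def zero_measure_def)
    next
      case False
      then have "X \<omega> (degree (H \<omega>)) \<noteq> 0" by (simp add: X_def)
      then have "\<omega> \<in> E (degree (H \<omega>))" using w PX[of \<omega>] by (auto simp: E_def Strat_def coeff_eq_0)
      then show ?thesis using deg by blast
    qed
  next
    fix \<omega> assume "\<omega> \<in> (\<Union>d\<in>{..n}. E d) \<union> E0"
    then consider d where "d \<le> n" "\<omega> \<in> E d" | "\<omega> \<in> E0" by blast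
    then show "\<omega> \<in> {\<omega> \<in> space M. zero_measure n (H \<omega>) \<in> U}"
    proof cases
      case 1
      then have w: "\<omega> \<in> space M" "coeff (H \<omega>) d \<noteq> 0" "zero_measure n (poly_of_coeffs d (X \<omega>)) \<in> U"
        and z: "\<And>i. d < i \<Longrightarrow> i \<le> n \<Longrightarrow> coeff (H \<omega>) i = 0"
        by (auto simp: E_def Strat_def X_def)
      have "degree (H \<omega>) = d"
      proof (rule antisym)
        show "degree (H \<omega>) \<le> d"
          using z deg[of \<omega>] by (metis coeff_0 leading_coeff_0_iff not_le w(2))
      qed (rule le_degree[OF w(2)])
      then show ?thesis using w PX[of \<omega>] by simp
    next
      case 2
      have "H \<omega> = 0"
      proof (rule ccontr)
        assume "H \<omega> \<noteq> 0"
        then have "lead_coeff (H \<omega>) \<noteq> 0" by simp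
        moreover have "degree (H \<omega>) \<in> {..n}" using deg[of \<omega>] by simp
        ultimately show False using 2 unfolding E0_def by blast
      qed
      then show ?thesis using 2 by (simp add: E0_def zero_measure_def)
    qed
  qed
  then show ?thesis using E E0 by auto
qed

section \<open>Random orthogonal polynomials\<close>

locale random_orthogonal = bernstein_markov_setup K V \<tau> + iid_sequence M \<xi>
  for K V \<tau> and M :: "'w measure" and \<xi> +
  assumes nondeg: "nondegenerate M (\<xi> 0)"
    and tail: "(\<lambda>t::real. measure M {\<omega> \<in> space M. cmod (\<xi> 0 \<omega>) > exp t}) \<in> o[at_top](\<lambda>t. 1 / t)"
begin

abbreviation H :: "nat \<Rightarrow> 'w \<Rightarrow> complex poly" where
  "H \<equiv> random_poly \<tau> \<xi>"

lemma poly_H: "poly (H n \<omega>) z = (\<Sum>j\<le>n. \<xi> j \<omega> * poly (orth j) z)"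
  by (simp add: random_poly_def poly_sum)

lemma degree_H: "degree (H n \<omega>) \<le> n"
  unfolding random_poly_def
  by (intro degree_sum_le order_trans[OF degree_smult_le]) (auto simp: degree_orth)

lemma measurable_coeff_H: "(\<lambda>\<omega>. coeff (H n \<omega>) i) \<in> borel_measurable M"
  unfolding random_poly_def coeff_sum coeff_smult by measurable

lemma measurable_poly_H [measurable]: "(\<lambda>\<omega>. poly (H n \<omega>) z) \<in> borel_measurable M"
  unfolding poly_H by measurable

text \<open>Dividing by the threshold at \<open>\<delta> / 2\<close> makes many weights at least 1
  in modulus, while the event puts the weighted sum within a radius tending to 0 of the origin;
  \<open>anti_concentration\<close> makes this unlikely.\<close>

lemma pointwise_lower:
  assumes nz: "\<And>j. poly (orth j) z \<noteq> 0" and \<delta>: "\<delta> > 0"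
  shows "(\<lambda>n. prob {\<omega> \<in> space M. cmod (poly (H n \<omega>) z) < exp (real n * (V z - \<delta>))}) \<longlonglongrightarrow> 0"
proof (rule tendstoI)
  fix \<eta> :: real assume \<eta>: "\<eta> > 0"
  obtain k r where r: "r > 0" and ac: "\<And>n a x. k \<le> card {j. j \<le> n \<and> 1 \<le> cmod (a j)} \<Longrightarrow>
    prob {\<omega> \<in> space M. cmod ((\<Sum>j\<le>n. a j * \<xi> j \<omega>) - x) \<le> r} \<le> \<eta> / 2"
    using anti_concentration[OF nondeg half_gt_zero[OF \<eta>]] by blast
  have "((\<lambda>x::real. exp (- x * \<delta> / 2)) \<longlongrightarrow> 0) at_top" using \<delta> by real_asymp
  then have "(\<lambda>n. exp (- real n * \<delta> / 2)) \<longlonglongrightarrow> 0"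
    by (rule filterlim_compose[OF _ filterlim_real_sequentially])
  then have "\<forall>\<^sub>F n in sequentially. exp (- real n * \<delta> / 2) < r" using r by (rule order_tendstoD(2))
  moreover have "\<forall>\<^sub>F n in sequentially. k \<le> card {j. j \<le> n \<and> exp (real n * (V z - \<delta> / 2)) \<le> cmod (poly (orth j) z)}"
    using many_large_orth[OF nz, of "\<delta> / 2" k] \<delta> by simp
  ultimately show "\<forall>\<^sub>F n in sequentially.
      dist (prob {\<omega> \<in> space M. cmod (poly (H n \<omega>) z) < exp (real n * (V z - \<delta>))}) 0 < \<eta>"
  proof eventually_elim
    case (elim n)
    define E where "E = exp (real n * (V z - \<delta> / 2))"
    have E: "E > 0" by (simp add: E_def)
    define a where "a j = poly (orth j) z / of_real E" for j
    have na: "cmod (a j) = cmod (poly (orth j) z) / E" for j using E by (simp add: a_def norm_divide)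
    have "{j. j \<le> n \<and> 1 \<le> cmod (a j)} = {j. j \<le> n \<and> exp (real n * (V z - \<delta> / 2)) \<le> cmod (poly (orth j) z)}"
      using E by (simp add: na le_divide_eq E_def[symmetric])
    then have c: "k \<le> card {j. j \<le> n \<and> 1 \<le> cmod (a j)}" using elim(2) by simp
    have eq: "(\<Sum>j\<le>n. a j * \<xi> j \<omega>) = poly (H n \<omega>) z / of_real E" for \<omega>
      by (simp add: a_def poly_H sum_divide_distrib mult.commute)
    have "{\<omega> \<in> space M. cmod (poly (H n \<omega>) z) < exp (real n * (V z - \<delta>))} \<subseteq>
        {\<omega> \<in> space M. cmod ((\<Sum>j\<le>n. a j * \<xi> j \<omega>) - 0) \<le> r}"
    proof safe
      fix \<omega> assume lt: "cmod (poly (H n \<omega>) z) < exp (real n * (V z - \<delta>))"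
      have "cmod (poly (H n \<omega>) z) / E \<le> exp (real n * (V z - \<delta>)) / E"
        using lt E by (intro divide_right_mono) auto
      also have "\<dots> = exp (- real n * \<delta> / 2)"
        unfolding E_def exp_diff[symmetric] by (simp add: algebra_simps)
      also have "\<dots> \<le> r" using elim(1) by simp
      finally show "cmod ((\<Sum>j\<le>n. a j * \<xi> j \<omega>) - 0) \<le> r"
        using E by (simp add: eq norm_divide)
    qed
    then have "prob {\<omega> \<in> space M. cmod (poly (H n \<omega>) z) < exp (real n * (V z - \<delta>))} \<le> \<eta> / 2"
      by (rule order_trans[OF finite_measure_mono ac[OF c]]) measurable
    then show ?case using \<eta> by simp
  qed
qed

text \<open>A union bound over \<open>n + 1\<close> identically distributed coefficients, each with
  tail o(1/n) at height \<open>exp (n * \<delta>)\<close>.\<close>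

lemma coefficients_bounded:
  assumes \<delta>: "\<delta> > 0"
  shows "(\<lambda>n. prob {\<omega> \<in> space M. \<exists>j\<le>n. exp (real n * \<delta>) < cmod (\<xi> j \<omega>)}) \<longlonglongrightarrow> 0"
proof -
  define f where "f t = prob {\<omega> \<in> space M. cmod (\<xi> 0 \<omega>) > exp t}" for t
  have "((\<lambda>t. f t / (1 / t)) \<longlongrightarrow> 0) at_top"
    using smalloD_tendsto[OF tail] by (simp add: f_def)
  moreover have "filterlim (\<lambda>n. real n * \<delta>) at_top sequentially"
    using \<delta> by (intro filterlim_at_top_mult_tendsto_pos[OF tendsto_const] filterlim_real_sequentially)
  ultimately have l1: "(\<lambda>n. f (real n * \<delta>) / (1 / (real n * \<delta>))) \<longlonglongrightarrow> 0"
    by (rule filterlim_compose)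
  \<comment> \<open>For \<open>n > 0\<close> the expression equals
    \<open>2 * n * f (n * \<delta>)\<close>, which dominates the union bound because
    \<open>n + 1 \<le> 2 * n\<close>.\<close>
  have "(\<lambda>n. 2 / \<delta> * (f (real n * \<delta>) / (1 / (real n * \<delta>)))) \<longlonglongrightarrow> 2 / \<delta> * 0"
    by (intro tendsto_intros l1)
  then have l2: "(\<lambda>n. 2 / \<delta> * (f (real n * \<delta>) / (1 / (real n * \<delta>)))) \<longlonglongrightarrow> 0" by simp
  show ?thesis
  proof (rule tendsto_sandwich[OF _ _ tendsto_const l2])
    show "\<forall>\<^sub>F n in sequentially. prob {\<omega> \<in> space M. \<exists>j\<le>n. exp (real n * \<delta>) < cmod (\<xi> j \<omega>)} \<le>
        2 / \<delta> * (f (real n * \<delta>) / (1 / (real n * \<delta>)))"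
      using eventually_gt_at_top[of 0]
    proof eventually_elim
      case (elim n)
      have pj: "prob {\<omega> \<in> space M. exp (real n * \<delta>) < cmod (\<xi> j \<omega>)} = f (real n * \<delta>)" for j
      proof -
        have A: "{z. exp (real n * \<delta>) < cmod z} \<in> sets borel" by measurable
        show ?thesis using prob_\<xi>[OF A, of j] prob_\<xi>[OF A, of 0] by (simp add: f_def)
      qed
      have "prob {\<omega> \<in> space M. \<exists>j\<le>n. exp (real n * \<delta>) < cmod (\<xi> j \<omega>)} =
          prob (\<Union>j\<in>{..n}. {\<omega> \<in> space M. exp (real n * \<delta>) < cmod (\<xi> j \<omega>)})"
        by (rule arg_cong[where f=prob]) auto
      also have "\<dots> \<le> (\<Sum>j\<le>n. prob {\<omega> \<in> space M. exp (real n * \<delta>) < cmod (\<xi> j \<omega>)})"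
        by (rule finite_measure_subadditive_finite) auto
      also have "\<dots> = (real n + 1) * f (real n * \<delta>)" by (simp add: pj)
      also have "\<dots> \<le> (2 * real n) * f (real n * \<delta>)"
        using elim by (intro mult_right_mono) (auto simp: f_def)
      also have "\<dots> = 2 / \<delta> * (f (real n * \<delta>) / (1 / (real n * \<delta>)))"
        using \<delta> by simp
      finally show ?case .
    qed
  qed auto
qed

text \<open>The margin is split in three: one third for the coefficients, one for
  \<open>orth_upper\<close>, one for the factor \<open>(n + 1) * C\<close>. As \<open>V\<close> is
  nonnegative, the index \<open>j\<close> may be replaced by \<open>n\<close> in the
  exponent.\<close>

lemma uniform_upper:
  assumes \<delta>: "\<delta> > 0"
  shows "\<forall>\<^sub>F n in sequentially. \<forall>\<omega>. (\<forall>j\<le>n. cmod (\<xi> j \<omega>) \<le> exp (real n * (\<delta> / 3))) \<longrightarrow>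
    (\<forall>w. cmod (poly (H n \<omega>) w) \<le> exp (real n * (V w + \<delta>)))"
proof -
  obtain C where C: "C > 0" "\<And>j z. cmod (poly (orth j) z) \<le> C * exp (real j * (V z + \<delta> / 3))"
    using orth_upper[of "\<delta> / 3"] \<delta> by auto
  have "((\<lambda>x::real. (x + 1) * C / exp (x * (\<delta> / 3))) \<longlongrightarrow> 0) at_top" using \<delta> C(1) by real_asymp
  then have "(\<lambda>n. (real n + 1) * C / exp (real n * (\<delta> / 3))) \<longlonglongrightarrow> 0"
    by (rule filterlim_compose[OF _ filterlim_real_sequentially])
  then have "\<forall>\<^sub>F n in sequentially. (real n + 1) * C / exp (real n * (\<delta> / 3)) < 1"
    by (rule order_tendstoD(2)) simp
  then show ?thesis
  proof eventually_elim
    case (elim n)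
    show ?case
    proof (intro allI impI)
      fix \<omega> w assume \<xi>: "\<forall>j\<le>n. cmod (\<xi> j \<omega>) \<le> exp (real n * (\<delta> / 3))"
      have "cmod (poly (H n \<omega>) w) \<le> (\<Sum>j\<le>n. cmod (\<xi> j \<omega> * poly (orth j) w))"
        unfolding poly_H by (rule norm_sum)
      also have "\<dots> \<le> (\<Sum>j\<le>n. exp (real n * (\<delta> / 3)) * (C * exp (real n * (V w + \<delta> / 3))))"
      proof (rule sum_mono)
        fix j assume "j \<in> {..n}"
        then have j: "j \<le> n" by simp
        have "cmod (poly (orth j) w) \<le> C * exp (real j * (V w + \<delta> / 3))" by (rule C(2))
        also have "\<dots> \<le> C * exp (real n * (V w + \<delta> / 3))"
          using C(1) j V_nonneg[of w] \<delta> by (intro mult_left_mono exp_le_cancel_iff[THEN iffD2] mult_right_mono) auto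
        finally show "cmod (\<xi> j \<omega> * poly (orth j) w) \<le> exp (real n * (\<delta> / 3)) * (C * exp (real n * (V w + \<delta> / 3)))"
          unfolding norm_mult using \<xi> j by (intro mult_mono) auto
      qed
      also have "\<dots> = ((real n + 1) * C) * (exp (real n * (\<delta> / 3)) * exp (real n * (V w + \<delta> / 3)))"
        by simp
      also have "\<dots> \<le> exp (real n * (\<delta> / 3)) * (exp (real n * (\<delta> / 3)) * exp (real n * (V w + \<delta> / 3)))"
        using elim by (intro mult_right_mono) (auto simp: divide_less_eq)
      also have "\<dots> = exp (real n * (V w + \<delta>))"
        unfolding exp_add[symmetric] by (simp add: algebra_simps)
      finally show "cmod (poly (H n \<omega>) w) \<le> exp (real n * (V w + \<delta>))" .
    qed
  qed
qed

text \<open>The zeros of all orthonormal polynomials form a countable set, so its complement is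
  dense; \<open>many_large_orth\<close> asks for points of this complement.\<close>

lemma good_points_dense:
  obtains z :: "nat \<Rightarrow> complex" where "closure (range z) = UNIV" "\<And>i j. poly (orth j) (z i) \<noteq> 0"
proof -
  define B where "B = (\<Union>j. {z. poly (orth j) z = 0})"
  have cB: "countable B"
    unfolding B_def using poly_roots_finite[OF orth_nonzero] by (intro countable_UN) (auto intro: countable_finite)
  have "interior B = {}"
  proof (rule ccontr)
    assume "interior B \<noteq> {}"
    then obtain x e where "e > 0" "ball x e \<subseteq> B" by (auto simp: mem_interior)
    then show False using cB uncountable_ball[of e x] countable_subset by blast
  qed
  then have dB: "closure (- B) = UNIV" by (simp add: closure_complement)
  obtain T where T: "countable T" "T \<subseteq> - B" "- B \<subseteq> closure T" using separable by blast
  have cT: "closure T = UNIV" using closure_mono[OF T(3)] dB by auto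
  then have "T \<noteq> {}" by auto
  then have r: "range (from_nat_into T) = T" using T(1) by (rule range_from_nat_into)
  show thesis
  proof (rule that)
    show "closure (range (from_nat_into T)) = UNIV" using r cT by simp
    fix i j
    have "from_nat_into T i \<in> - B" using T(2) from_nat_into[OF \<open>T \<noteq> {}\<close>, of i] by (rule subsetD)
    then show "poly (orth j) (from_nat_into T i) \<noteq> 0" by (auto simp: B_def)
  qed
qed

theorem zero_measures_converge_in_probability:
  assumes U: "openin weak_star_topology U" "equilibrium_measure K \<in> U"
  shows "(\<lambda>n. prob {\<omega> \<in> space M. zero_measure n (H n \<omega>) \<in> U}) \<longlonglongrightarrow> 1"
proof -
  obtain z :: "nat \<Rightarrow> complex" where z: "closure (range z) = UNIV" "\<And>i j. poly (orth j) (z i) \<noteq> 0"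
    by (rule good_points_dense) (rule that; assumption)
  obtain N \<delta> n0 where \<delta>: "\<delta> > 0" and near: "\<And>n P. n \<ge> n0 \<Longrightarrow> degree P \<le> n \<Longrightarrow>
     (\<forall>w. cmod (poly P w) \<le> exp (real n * (V w + \<delta>))) \<Longrightarrow>
     (\<forall>i<N. exp (real n * (V (z i) - \<delta>)) \<le> cmod (poly P (z i))) \<Longrightarrow> zero_measure n P \<in> U"
    using zero_measure_near_equilibrium[OF U z(1)] by blast
  define A where "A n = {\<omega> \<in> space M. \<exists>j\<le>n. exp (real n * (\<delta> / 3)) < cmod (\<xi> j \<omega>)}" for n
  define B where "B i n = {\<omega> \<in> space M. cmod (poly (H n \<omega>) (z i)) < exp (real n * (V (z i) - \<delta>))}" for i n
  define G where "G n = {\<omega> \<in> space M. zero_measure n (H n \<omega>) \<in> U}" for n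
  have G: "G n \<in> events" for n
    unfolding G_def by (rule measurable_zero_measure_in_open[OF U(1) measurable_coeff_H degree_H])
  have A: "A n \<in> events" for n unfolding A_def by measurable
  have B: "B i n \<in> events" for i n unfolding B_def by measurable
  have ev: "\<forall>\<^sub>F n in sequentially. 1 - (prob (A n) + (\<Sum>i<N. prob (B i n))) \<le> prob (G n)"
    using uniform_upper[OF \<delta>] eventually_ge_at_top[of n0]
  proof eventually_elim
    case (elim n)
    have "space M - G n \<subseteq> A n \<union> (\<Union>i\<in>{..<N}. B i n)"
    proof
      fix \<omega> assume "\<omega> \<in> space M - G n"
      then have w: "\<omega> \<in> space M" "zero_measure n (H n \<omega>) \<notin> U" by (auto simp: G_def)
      show "\<omega> \<in> A n \<union> (\<Union>i\<in>{..<N}. B i n)"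
      proof (rule ccontr)
        assume "\<not> ?thesis"
        then have "\<forall>j\<le>n. cmod (\<xi> j \<omega>) \<le> exp (real n * (\<delta> / 3))"
          and "\<forall>i<N. exp (real n * (V (z i) - \<delta>)) \<le> cmod (poly (H n \<omega>) (z i))"
          using w by (auto simp: A_def B_def not_less)
        then have "zero_measure n (H n \<omega>) \<in> U"
          using elim by (intro near degree_H) auto
        then show False using w by simp
      qed
    qed
    then have "prob (space M - G n) \<le> prob (A n \<union> (\<Union>i\<in>{..<N}. B i n))"
      using A B by (intro finite_measure_mono) auto
    also have "\<dots> \<le> prob (A n) + prob (\<Union>i\<in>{..<N}. B i n)"
      using A B by (intro measure_Un_le) auto
    also have "prob (\<Union>i\<in>{..<N}. B i n) \<le> (\<Sum>i<N. prob (B i n))"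
      using B by (intro finite_measure_subadditive_finite) auto
    finally show ?case using prob_compl[OF G[of n]] by simp
  qed
  have lim: "(\<lambda>n. 1 - (prob (A n) + (\<Sum>i<N. prob (B i n)))) \<longlonglongrightarrow> 1"
  proof -
    have "(\<lambda>n. prob (A n)) \<longlonglongrightarrow> 0"
      unfolding A_def by (rule coefficients_bounded) (use \<delta> in simp)
    moreover have "(\<lambda>n. prob (B i n)) \<longlonglongrightarrow> 0" for i
      unfolding B_def by (rule pointwise_lower[OF z(2) \<delta>])
    ultimately have "(\<lambda>n. 1 - (prob (A n) + (\<Sum>i<N. prob (B i n)))) \<longlonglongrightarrow> 1 - (0 + (\<Sum>i<N. 0))"
      by (intro tendsto_diff tendsto_add tendsto_const tendsto_sum)
    then show ?thesis by simp
  qed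
  show ?thesis
    unfolding G_def[symmetric] by (rule tendsto_sandwich[OF ev _ lim tendsto_const]) simp
qed

end

theorem theorem5p3:
  fixes K :: "complex set" and \<tau> :: "complex measure"
    and M :: "'w measure" and \<xi> :: "nat \<Rightarrow> 'w \<Rightarrow> complex"
  assumes "compact K" and "regular_set K"
    and "finite_measure \<tau>" and "borel_measure_on K \<tau>" and "bernstein_markov K \<tau>"
    and "prob_space M"
    and "prob_space.indep_vars M (\<lambda>_. borel) \<xi> UNIV"
    and "\<And>j. distr M borel (\<xi> j) = distr M borel (\<xi> 0)"
    and "nondegenerate M (\<xi> 0)"
    and "(\<lambda>t::real. measure M {\<omega> \<in> space M. cmod (\<xi> 0 \<omega>) > exp t}) \<in> o[at_top](\<lambda>t. 1 / t)"
  shows "\<forall>U. openin weak_star_topology U \<longrightarrow> equilibrium_measure K \<in> U \<longrightarrow>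
    (\<lambda>n. measure M {\<omega> \<in> space M. zero_measure n (random_poly \<tau> \<xi> n \<omega>) \<in> U}) \<longlonglongrightarrow> 1"
proof -
  interpret green_setup K "\<lambda>z. real_of_ereal (green_function K z)"
    by (rule regular_set_green_setup) fact+
  interpret random_orthogonal K "\<lambda>z. real_of_ereal (green_function K z)" \<tau> M \<xi>
    by (intro random_orthogonal.intro bernstein_markov_setup.intro bernstein_markov_setup_axioms.intro
      iid_sequence.intro iid_sequence_axioms.intro random_orthogonal_axioms.intro green_setup_axioms assms)
  show ?thesis using zero_measures_converge_in_probability by blast
qed

end
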